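(* Let $\mathcal S$ be a (finite) real number and consider all Schrödinger L-systems $\Theta_{\mu,h}$ ($\operatorname{Im}h>0$, $\mu\in\mathbb R\cup\{\infty\}$) that have c-entropy $\mathcal S$ and whose impedance function $V_{\Theta_{\mu,h}}(z)$ belongs to the generalized Donoghue class $\mathfrak M_\kappa$ with $\kappa=e^{-\mathcal S}$. Within this class the minimum coefficient of dissipation is $$\mathcal D_{min}=-\tanh\left(\frac{\mathcal S}{2}\right)\operatorname{Im}m_\infty(i),$$ and the L-system $\Theta_{\mu,h}$ of this class with the minimum coefficient of dissipation is uniquely determined by the parameters $$h=-\operatorname{Re}m_\infty(i)-i\tanh\left(\frac{\mathcal S}{2}\right)\operatorname{Im}m_\infty(i)\quad\text{and}\quad \mu=\infty.$$
   Context: Setting. Let $\ell\in\mathbb R$, let $q$ be a (fixed) real locally summable function on $[\ell,+\infty)$, $l(y)=-y''+q(x)y$, $\mathcal H=L_2(\ell,+\infty)$. Let $D^*$ be the set of $y\in\mathcal H$ that are locally absolutely continuous together with $y'$ and satisfy $l(y)\in\mathcal H$. The minimal symmetric operator $\dot A y=l(y)$ with boundary conditions $y(\ell)=y'(\ell)=0$ is assumed to have deficiency indices $(1,1)$; $\operatorname{Dom}(\dot A^* )=D^*$, $\dot A^*y=l(y)$. For $h\in\mathbb C$ with $\operatorname{Im}h>0$, $T_h y=l(y)$ with domain $\{y\in D^*: y'(\ell)=hy(\ell)\}$. Weyl function. Let $\varphi_1,\varphi_2$ solve $l(\varphi_k)=\lambda\varphi_k$ with $\varphi_1(\ell,\lambda)=0,\varphi_1'(\ell,\lambda)=1$,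 $\varphi_2(\ell,\lambda)=-1,\varphi_2'(\ell,\lambda)=0$. The Weyl function $m_\infty(\lambda)$ is such that $\varphi_2(\cdot,\lambda)+m_\infty(\lambda)\varphi_1(\cdot,\lambda)\in L_2(\ell,+\infty)$. One has $\operatorname{Im}m_\infty(i)<0$. Schrödinger L-systems. $\mathcal H_+=D^*$ with $(y,z)_+=\int_\ell^\infty (y\bar z+l(y)\overline{l(z)})dx$, and $\mathcal H_+\subset\mathcal H\subset\mathcal H_-$ is the corresponding rigged triplet; $\delta(x-\ell),\delta'(x-\ell)\in\mathcal H_-$ act by $(y,\delta)=y(\ell)$, $(y,\delta')=-y'(\ell)$. For $\mu\in\mathbb R\cup\{\infty\}$ put $\mathbb A_{\mu,h}y=-y''+q y-\frac1{\mu-h}[y'(\ell)-hy(\ell)][\mu\delta(x-\ell)+\delta'(x-\ell)]$ and $g=\frac{(\operatorname{Im}h)^{1/2}}{|\mu-h|}[\mu\delta(x-\ell)+\delta'(x-\ell)]$ (limits as $\mu\to\infty$ if $\mu=\infty$), $Kc=cg$ for $c\in\mathbb C$; then $\operatorname{Im}\mathbb A_{\mu,h}=KK^*$. The array $\Theta_{\mu,h}=(\mathbb A_{\mu,h},K,1;\ \mathcal H_+\subset\mathcal H\subset\mathcal H_-,\mathbb C)$ is the Schrödinger L-system with main operator $T_h$ and state-space operator $\mathbb A_{\mu,h}$. Its transfer function is $W_{\Theta_{\mu,h}}(z)=I-2iK^*(\mathbb A_{\mu,h}-zI)^{-1}K=\frac{\mu-h}{\mu-\bar h}\cdot\frac{m_\infty(z)+\bar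 h}{m_\infty(z)+h}$ and its impedance function is $V_{\Theta_{\mu,h}}(z)=K^*(\operatorname{Re}\mathbb A_{\mu,h}-zI)^{-1}K=\frac{(m_\infty(z)+\mu)\operatorname{Im}h}{(\mu-\operatorname{Re}h)m_\infty(z)+\mu\operatorname{Re}h-|h|^2}$ (limits as $\mu\to\infty$ if $\mu=\infty$). The coefficient of dissipation of $\Theta_{\mu,h}$ (and of $T_h$) is $\mathcal D=\operatorname{Im}h$. The c-entropy of $\Theta_{\mu,h}$ is $\mathcal S=-\ln|W_{\Theta_{\mu,h}}(-i)|$; it equals $-\ln|\kappa|$ where $|\kappa|=\left|\frac{m_\infty(i)+h}{m_\infty(i)+\bar h}\right|<1$ is the modulus of von Neumann's parameter of $T_h$. Generalized Donoghue class. For $0\le\kappa<1$, $\mathfrak M_\kappa$ is the class of all Herglotz-Nevanlinna functions $M(z)=\int_{\mathbb R}\left(\frac1{\lambda-z}-\frac{\lambda}{1+\lambda^2}\right)d\sigma(\lambda)$, $\sigma$ an infinite Borel measure with $\int_{\mathbb R}\frac{d\sigma(\lambda)}{1+\lambda^2}=\frac{1-\kappa}{1+\kappa}$ (equivalently, $M(i)=i\frac{1-\kappa}{1+\kappa}$). *)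

theory Defs
  imports "HOL-Analysis.Analysis"
begin

section \<open>The differential expression on the half-line\<close>

text \<open>
  Functions on the half-line are total functions of which only the values on \<open>{l..}\<close> matter.
  Measurability is Lebesgue measurability.
\<close>

definition locally_summable :: "real \<Rightarrow> (real \<Rightarrow> real) \<Rightarrow> bool" where
  "locally_summable l q \<longleftrightarrow> (\<forall>b\<ge>l. set_integrable lebesgue {l..b} q)"

definition L2 :: "real \<Rightarrow> (real \<Rightarrow> complex) set" where
  "L2 l = {f. set_borel_measurable lebesgue {l..} f \<and>
              set_integrable lebesgue {l..} (\<lambda>x. (cmod (f x))\<^sup>2)}"

definition inner_L2 :: "real \<Rightarrow> (real \<Rightarrow> complex) \<Rightarrow> (real \<Rightarrow> complex) \<Rightarrow> complex" where
  "inner_L2 l f g = (LINT x:{l..}|lebesgue. f x * cnj (g x))"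

text \<open>
  The usual epsilon-delta definition; a finite family of non-overlapping closed subintervals of
  \<open>{a..b}\<close> is a division of a subset of \<open>{a..b}\<close>.
\<close>

definition abs_cont_on :: "real \<Rightarrow> real \<Rightarrow> (real \<Rightarrow> complex) \<Rightarrow> bool" where
  "abs_cont_on a b f \<longleftrightarrow>
     (\<forall>e>0. \<exists>d>0. \<forall>\<D> S. \<D> division_of S \<and> S \<subseteq> {a..b} \<and> (\<Sum>k\<in>\<D>. Sup k - Inf k) < d
        \<longrightarrow> (\<Sum>k\<in>\<D>. cmod (f (Sup k) - f (Inf k))) < e)"

definition loc_abs_cont :: "real \<Rightarrow> (real \<Rightarrow> complex) \<Rightarrow> bool" where
  "loc_abs_cont l f \<longleftrightarrow> (\<forall>b\<ge>l. abs_cont_on l b f)"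

text \<open>The derivative at the end-point \<open>l\<close> is one-sided.\<close>

definition D1 :: "real \<Rightarrow> (real \<Rightarrow> complex) \<Rightarrow> real \<Rightarrow> complex" where
  "D1 l y x = vector_derivative y (at x within {l..})"

definition sl_expr :: "real \<Rightarrow> (real \<Rightarrow> real) \<Rightarrow> (real \<Rightarrow> complex) \<Rightarrow> real \<Rightarrow> complex" where
  "sl_expr l q y x = - D1 l (D1 l y) x + complex_of_real (q x) * y x"

text \<open>
  \<open>y\<close> and \<open>y'\<close> are locally absolutely continuous.  The last conjunct follows from absolute
  continuity of \<open>y'\<close> (Lebesgue); it is spelled out because it gives \<open>y''\<close> its meaning.
\<close>

definition sl_regular :: "real \<Rightarrow> (real \<Rightarrow> complex) \<Rightarrow> bool" where
  "sl_regular l y \<longleftrightarrow>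
     loc_abs_cont l y \<and> (\<forall>x\<ge>l. y differentiable (at x within {l..})) \<and>
     loc_abs_cont l (D1 l y) \<and>
     (AE x in lebesgue. x \<ge> l \<longrightarrow> D1 l y differentiable (at x within {l..}))"

definition sl_solution :: "real \<Rightarrow> (real \<Rightarrow> real) \<Rightarrow> complex \<Rightarrow> (real \<Rightarrow> complex) \<Rightarrow> bool" where
  "sl_solution l q z y \<longleftrightarrow>
     sl_regular l y \<and> (AE x in lebesgue. x \<ge> l \<longrightarrow> sl_expr l q y x = z * y x)"

text \<open>The domain of the adjoint of the minimal operator; also the space \<open>H\<^sub>+\<close>.\<close>

definition Dstar :: "real \<Rightarrow> (real \<Rightarrow> real) \<Rightarrow> (real \<Rightarrow> complex) set" where
  "Dstar l q = {y \<in> L2 l. sl_regular l y \<and> sl_expr l q y \<in> L2 l}"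

text \<open>
  The deficiency subspace at \<open>z\<close> is the kernel of \<open>A\<^sup>* - z\<close>, where \<open>A\<^sup>*\<close>, the adjoint of the
  minimal operator, acts as the differential expression on \<open>Dstar\<close>.  Being continuous, its elements
  are equal in \<open>L\<^sub>2\<close> iff they agree on \<open>{l..}\<close>.
\<close>

definition deficiency_space ::
    "real \<Rightarrow> (real \<Rightarrow> real) \<Rightarrow> complex \<Rightarrow> (real \<Rightarrow> complex) set" where
  "deficiency_space l q z =
     {y \<in> Dstar l q. AE x in lebesgue. x \<ge> l \<longrightarrow> sl_expr l q y x = z * y x}"

definition one_dimensional :: "real \<Rightarrow> (real \<Rightarrow> complex) set \<Rightarrow> bool" where
  "one_dimensional l N \<longleftrightarrow>
     (\<exists>u\<in>N. (\<exists>x\<ge>l. u x \<noteq> 0) \<and> (\<forall>y\<in>N. \<exists>c. \<forall>x\<ge>l. y x = c * u x))"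

definition deficiency_indices_1_1 :: "real \<Rightarrow> (real \<Rightarrow> real) \<Rightarrow> bool" where
  "deficiency_indices_1_1 l q \<longleftrightarrow>
     one_dimensional l (deficiency_space l q \<i>) \<and> one_dimensional l (deficiency_space l q (- \<i>))"

definition weyl_function ::
    "real \<Rightarrow> (real \<Rightarrow> real) \<Rightarrow> (complex \<Rightarrow> real \<Rightarrow> complex) \<Rightarrow> (complex \<Rightarrow> real \<Rightarrow> complex)
      \<Rightarrow> (complex \<Rightarrow> complex) \<Rightarrow> bool" where
  "weyl_function l q \<phi>1 \<phi>2 m \<longleftrightarrow>
     (\<forall>z. sl_solution l q z (\<phi>1 z) \<and> \<phi>1 z l = 0 \<and> D1 l (\<phi>1 z) l = 1) \<and>
     (\<forall>z. sl_solution l q z (\<phi>2 z) \<and> \<phi>2 z l = -1 \<and> D1 l (\<phi>2 z) l = 0) \<and>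
     (\<forall>z. Im z \<noteq> 0 \<longrightarrow> (\<lambda>x. \<phi>2 z x + m z * \<phi>1 z x) \<in> L2 l)"


section \<open>Schroedinger L-systems\<close>

text \<open>
  An element \<open>F\<close> of \<open>H\<^sub>-\<close> is represented by its action \<open>w \<mapsto> (F, w)\<close> on \<open>H\<^sub>+ = Dstar l q\<close>,
  which is antilinear in \<open>w\<close>; two elements of \<open>H\<^sub>-\<close> are equal iff they agree on \<open>Dstar l q\<close>.
  Accordingly an operator from \<open>H\<^sub>+\<close> to \<open>H\<^sub>-\<close> is a sesquilinear form \<open>(y, w) \<mapsto> (\<A> y, w)\<close>, and
  \<open>y \<in> H\<^sub>+\<close> is, as an element of \<open>H\<^sub>-\<close>, the functional \<open>inner_L2 l y\<close>.
\<close>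

type_synonym func = "real \<Rightarrow> complex"
type_synonym neg_elem = "func \<Rightarrow> complex"

text \<open>The conjugates of \<open>(w, \<delta>) = w(l)\<close> and \<open>(w, \<delta>') = - w'(l)\<close>.\<close>

definition delta :: "real \<Rightarrow> neg_elem" where
  "delta l w = cnj (w l)"

definition delta' :: "real \<Rightarrow> neg_elem" where
  "delta' l w = - cnj (D1 l w l)"

datatype ext_real_param = Fin real | Infty

text \<open>The equations for \<open>Infty\<close> are the limits of those for \<open>Fin \<mu>\<close> as \<open>\<mu>\<close> tends to infinity.\<close>

fun state_op ::
    "real \<Rightarrow> (real \<Rightarrow> real) \<Rightarrow> ext_real_param \<Rightarrow> complex \<Rightarrow> func \<Rightarrow> neg_elem" where
  "state_op l q (Fin \<mu>) h y w =
     inner_L2 l (sl_expr l q y) w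
       - 1 / (of_real \<mu> - h) * (D1 l y l - h * y l) * (of_real \<mu> * delta l w + delta' l w)"
| "state_op l q Infty h y w =
     inner_L2 l (sl_expr l q y) w - (D1 l y l - h * y l) * delta l w"

fun channel_vec :: "real \<Rightarrow> ext_real_param \<Rightarrow> complex \<Rightarrow> neg_elem" where
  "channel_vec l (Fin \<mu>) h w =
     of_real (sqrt (Im h) / cmod (of_real \<mu> - h)) * (of_real \<mu> * delta l w + delta' l w)"
| "channel_vec l Infty h w = of_real (sqrt (Im h)) * delta l w"

text \<open>\<open>(\<A> + \<A>\<^sup>*) / 2\<close>, where \<open>(\<A>\<^sup>* y, w)\<close> is the conjugate of \<open>(\<A> w, y)\<close>.\<close>

definition re_part :: "(func \<Rightarrow> neg_elem) \<Rightarrow> func \<Rightarrow> neg_elem" where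
  "re_part A y w = (A y w + cnj (A w y)) / 2"

text \<open>
  The number \<open>K\<^sup>* (\<A> - z)\<^sup>-\<^sup>1 K 1\<close> for the channel operator \<open>K c = c g\<close>, whose adjoint
  is \<open>K\<^sup>* y = (y, g)\<close>, the conjugate of \<open>g y\<close>.
\<close>

definition compressed_resolvent ::
    "real \<Rightarrow> (real \<Rightarrow> real) \<Rightarrow> (func \<Rightarrow> neg_elem) \<Rightarrow> neg_elem \<Rightarrow> complex \<Rightarrow> complex" where
  "compressed_resolvent l q A g z =
     (THE v. \<exists>y\<in>Dstar l q. (\<forall>w\<in>Dstar l q. A y w - z * inner_L2 l y w = g w) \<and> v = cnj (g y))"

definition transfer_function ::
    "real \<Rightarrow> (real \<Rightarrow> real) \<Rightarrow> ext_real_param \<Rightarrow> complex \<Rightarrow> complex \<Rightarrow> complex" where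
  "transfer_function l q \<mu> h z =
     1 - 2 * \<i> * compressed_resolvent l q (state_op l q \<mu> h) (channel_vec l \<mu> h) z"

definition impedance_function ::
    "real \<Rightarrow> (real \<Rightarrow> real) \<Rightarrow> ext_real_param \<Rightarrow> complex \<Rightarrow> complex \<Rightarrow> complex" where
  "impedance_function l q \<mu> h z =
     compressed_resolvent l q (re_part (state_op l q \<mu> h)) (channel_vec l \<mu> h) z"

definition dissipation_coeff :: "ext_real_param \<times> complex \<Rightarrow> real" where
  "dissipation_coeff \<Theta> = Im (snd \<Theta>)"

definition c_entropy :: "real \<Rightarrow> (real \<Rightarrow> real) \<Rightarrow> ext_real_param \<Rightarrow> complex \<Rightarrow> ereal" where
  "c_entropy l q \<mu> h =
     (let W = transfer_function l q \<mu> h (- \<i>)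
      in if W = 0 then \<infinity> else ereal (- ln (cmod W)))"


section \<open>Generalized Donoghue classes\<close>

text \<open>The functions are considered on the non-real numbers only.\<close>

definition gen_donoghue :: "real \<Rightarrow> (complex \<Rightarrow> complex) set" where
  "gen_donoghue \<kappa> =
     {M. 0 \<le> \<kappa> \<and> \<kappa> < 1 \<and>
         (\<exists>\<sigma> :: real measure. sets \<sigma> = sets borel \<and> emeasure \<sigma> UNIV = \<infinity> \<and>
            integrable \<sigma> (\<lambda>t. 1 / (1 + t\<^sup>2)) \<and>
            (LINT t|\<sigma>. 1 / (1 + t\<^sup>2)) = (1 - \<kappa>) / (1 + \<kappa>) \<and>
            (\<forall>z. Im z \<noteq> 0 \<longrightarrow>
               M z = (LINT t|\<sigma>. 1 / (complex_of_real t - z) - complex_of_real (t / (1 + t\<^sup>2)))))}"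

text \<open>An L-system is identified with its parameters \<open>(\<mu>, h)\<close>.\<close>

definition entropy_donoghue_systems ::
    "real \<Rightarrow> (real \<Rightarrow> real) \<Rightarrow> real \<Rightarrow> (ext_real_param \<times> complex) set" where
  "entropy_donoghue_systems l q S =
     {(\<mu>, h). Im h > 0 \<and> c_entropy l q \<mu> h = ereal S \<and>
              impedance_function l q \<mu> h \<in> gen_donoghue (exp (- S))}"

end

theory Submission
  imports Defs "HOL-Probability.Probability" "HOL-Complex_Analysis.Complex_Analysis"
begin

text \<open>
  Write \<open>M = m(\<i>)\<close>, \<open>\<kappa> = exp (- S)\<close> and \<open>\<tau> = tanh (S / 2) = (1 - \<kappa>) / (1 + \<kappa>)\<close>.  Once the transfer and the
  impedance functions are known in terms of \<open>m\<close>, the optimization is plane geometry.  The c-entropy of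
  \<open>(\<mu>, h)\<close> is \<open>S\<close> iff \<open>\<bar>M + h\<bar> = \<kappa> \<bar>M + cnj h\<bar>\<close>, an Apollonius circle for \<open>h\<close> whose lowest point is
  \<open>h0 = - Re M - \<i> \<tau> Im M\<close> (\<open>Apollonius_lowest_point\<close>).  For \<open>h = h0\<close> the value of the impedance at \<open>\<i>\<close>
  prescribed by the Donoghue class excludes every finite \<open>\<mu>\<close> (\<open>impedance_Fin_not_gen_donoghue\<close>).  What
  remains is the existence part: the impedance of \<open>(\<infinity>, h0)\<close>, which is \<open>Im h0 / (m - Re M)\<close>, does have an
  integral representation of the required kind (\<open>impedance_Infty_gen_donoghue\<close>).

  The analysis behind this has three layers.

  The first is the limit-point property (\<open>limit_point\<close>): deficiency indices \<open>(1, 1)\<close> imply that the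
  Wronskian of any two elements of the maximal domain tends to zero at infinity.  The point \<open>M\<close>
  lies in all of Weyl's nested discs, which fixes the sign of the boundary term of the Weyl solution
  \<open>\<psi>\<close> at every \<open>b\<close>.  The truncation of an arbitrary \<open>y\<close> to \<open>[l, b]\<close>, matched to a multiple of \<open>\<psi>\<close> at
  \<open>b\<close>, is therefore bounded uniformly in \<open>b\<close>, and letting \<open>b\<close> tend to infinity kills the boundary term.
  The basis is Lagrange's identity, an instance of the fundamental theorem of calculus for absolutely
  continuous functions.

  The second layer consists of consequences of Green's formula without boundary term at infinity.  It
  gives \<open>Im m = - Im z \<cdot> \<parallel>\<psi>\<parallel>\<^sup>2\<close>, the symmetry and the holomorphy of \<open>m\<close>, and the closed formulas for the
  transfer and impedance functions: a square-integrable solution is a multiple of \<open>\<psi>\<close>, and the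
  rank-one boundary term determines the multiple (\<open>compressed_resolvent_eq\<close>).  That the resolvent
  equation forces \<open>l(y) = z y\<close> uses the density of the minimal domain; this contains the solutions
  multiplied by \<open>C\<^sup>2\<close> bumps, while smooth functions need not belong to it, \<open>q\<close> being only locally summable.

  The third layer is the Herglotz representation.  In the disc it follows from Schwarz's formula on
  smaller circles and Helly's selection theorem; the Cayley transform carries it to the half-plane
  (\<open>Herglotz_half_plane\<close>), where a linear term \<open>p z\<close> may appear.  The Donoghue class demands that \<open>p = 0\<close>
  and that the measure is infinite.  Both follow from the behaviour of \<open>\<parallel>\<psi>\<parallel>\<close> along the imaginary axis,
  which is found by testing Green's formula with elements of the domain that have given boundary
  values at \<open>l\<close> but arbitrarily small norm (\<open>psi_norm_growth\<close>, \<open>psi_norm_quotient_growth\<close>).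
\<close>

section \<open>Absolute continuity\<close>

lemma abs_cont_onE:
  assumes "abs_cont_on a b f" "e > 0"
  obtains d where "d > 0" "\<And>\<D> S. \<D> division_of S \<Longrightarrow> S \<subseteq> {a..b} \<Longrightarrow>
      (\<Sum>k\<in>\<D>. Sup k - Inf k) < d \<Longrightarrow> (\<Sum>k\<in>\<D>. cmod (f (Sup k) - f (Inf k))) < e"
proof -
  have "\<exists>d>0. \<forall>\<D> S. \<D> division_of S \<and> S \<subseteq> {a..b} \<and> (\<Sum>k\<in>\<D>. Sup k - Inf k) < d
        \<longrightarrow> (\<Sum>k\<in>\<D>. cmod (f (Sup k) - f (Inf k))) < e"
    using assms unfolding abs_cont_on_def by (elim allE impE)
  then show thesis
    by (elim exE conjE) (rule that; blast)
qed

lemma abs_cont_on_subset: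
  assumes "abs_cont_on a b f" and sub: "{c..d} \<subseteq> {a..b}"
  shows "abs_cont_on c d f"
  unfolding abs_cont_on_def
proof (intro allI impI)
  fix e :: real assume "e > 0"
  obtain \<delta> where \<delta>: "\<delta> > 0" "\<And>\<D> S. \<D> division_of S \<Longrightarrow> S \<subseteq> {a..b} \<Longrightarrow>
      (\<Sum>k\<in>\<D>. Sup k - Inf k) < \<delta> \<Longrightarrow> (\<Sum>k\<in>\<D>. cmod (f (Sup k) - f (Inf k))) < e"
    by (rule abs_cont_onE[OF assms(1) \<open>e > 0\<close>]) (rule that; blast)
  show "\<exists>\<delta>>0. \<forall>\<D> S. \<D> division_of S \<and> S \<subseteq> {c..d} \<and> (\<Sum>k\<in>\<D>. Sup k - Inf k) < \<delta> \<longrightarrow>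
      (\<Sum>k\<in>\<D>. cmod (f (Sup k) - f (Inf k))) < e"
    using \<delta>(1) by (intro exI[of _ \<delta>] conjI allI impI \<delta>(2)) (use sub in auto)
qed

lemma abs_cont_on_pair:
  assumes "abs_cont_on a b f" "e > 0"
  obtains d where "d > 0" "\<And>u v. u \<in> {a..b} \<Longrightarrow> v \<in> {a..b} \<Longrightarrow> \<bar>u - v\<bar> < d \<Longrightarrow> cmod (f u - f v) < e"
proof -
  obtain d where d: "d > 0" and D: "\<And>\<D> S. \<D> division_of S \<Longrightarrow> S \<subseteq> {a..b} \<Longrightarrow>
      (\<Sum>k\<in>\<D>. Sup k - Inf k) < d \<Longrightarrow> (\<Sum>k\<in>\<D>. cmod (f (Sup k) - f (Inf k))) < e"
    by (rule abs_cont_onE[OF assms]) (rule that; blast)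
  have *: "cmod (f v - f u) < e" if "u \<in> {a..b}" "v \<in> {a..b}" "u \<le> v" "v - u < d" for u v
  proof -
    have "{cbox u v} division_of cbox u v"
      using that by (intro division_of_self) auto
    then show ?thesis
      using D[of "{cbox u v}" "cbox u v"] that by auto
  qed
  show thesis
  proof (rule that[OF d])
    fix u v assume "u \<in> {a..b}" "v \<in> {a..b}" "\<bar>u - v\<bar> < d"
    then show "cmod (f u - f v) < e"
      using *[of u v] *[of v u] by (cases "u \<le> v") (auto simp: norm_minus_commute)
  qed
qed

lemma abs_cont_on_imp_continuous_on:
  assumes "abs_cont_on a b f"
  shows "continuous_on {a..b} f"
proof -
  have "\<exists>d>0. \<forall>x'\<in>{a..b}. dist x' x < d \<longrightarrow> dist (f x') (f x) < e"
    if "x \<in> {a..b}" "e > 0" for x e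
    using abs_cont_on_pair[OF assms \<open>e > 0\<close>] that by (metis dist_norm real_norm_def)
  then show ?thesis
    unfolding continuous_on_iff by blast
qed

lemma division_of_real_member:
  fixes k :: "real set"
  assumes "\<D> division_of S" "k \<in> \<D>"
  shows "k = {Inf k..Sup k}" "Inf k \<le> Sup k" "Inf k \<in> k" "Sup k \<in> k" "k \<subseteq> S"
proof -
  obtain a b where "k = cbox a b"
    using division_ofD(4)[OF assms] by blast
  moreover have "k \<noteq> {}" "k \<subseteq> S"
    using division_ofD(2,3)[OF assms] by auto
  ultimately show "k = {Inf k..Sup k}" "Inf k \<le> Sup k" "Inf k \<in> k" "Sup k \<in> k" "k \<subseteq> S"
    by auto
qed

lemma abs_cont_on_mult:
  assumes "abs_cont_on a b f" "abs_cont_on a b g"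
  shows "abs_cont_on a b (\<lambda>x. f x * g x)"
  unfolding abs_cont_on_def
proof (intro allI impI)
  fix e :: real assume "e > 0"
  have "bounded (f ` {a..b})" "bounded (g ` {a..b})"
    using assms by (auto intro!: compact_imp_bounded compact_continuous_image abs_cont_on_imp_continuous_on)
  then obtain M N where MN: "\<forall>x\<in>{a..b}. cmod (f x) \<le> M" "\<forall>x\<in>{a..b}. cmod (g x) \<le> N"
    unfolding bounded_iff by auto
  define B where "B = max 1 (max M N)"
  have B: "B > 0" "\<And>x. x \<in> {a..b} \<Longrightarrow> cmod (f x) \<le> B" "\<And>x. x \<in> {a..b} \<Longrightarrow> cmod (g x) \<le> B"
    using MN by (auto simp: B_def le_max_iff_disj)
  define e' where "e' = e / (2 * B)"
  have "e' > 0" using \<open>e > 0\<close> B by (simp add: e'_def)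
  obtain d1 where d1: "d1 > 0" "\<And>\<D> S. \<D> division_of S \<Longrightarrow> S \<subseteq> {a..b} \<Longrightarrow>
      (\<Sum>k\<in>\<D>. Sup k - Inf k) < d1 \<Longrightarrow> (\<Sum>k\<in>\<D>. cmod (f (Sup k) - f (Inf k))) < e'"
    by (rule abs_cont_onE[OF assms(1) \<open>e' > 0\<close>]) (rule that; blast)
  obtain d2 where d2: "d2 > 0" "\<And>\<D> S. \<D> division_of S \<Longrightarrow> S \<subseteq> {a..b} \<Longrightarrow>
      (\<Sum>k\<in>\<D>. Sup k - Inf k) < d2 \<Longrightarrow> (\<Sum>k\<in>\<D>. cmod (g (Sup k) - g (Inf k))) < e'"
    by (rule abs_cont_onE[OF assms(2) \<open>e' > 0\<close>]) (rule that; blast)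
  show "\<exists>d>0. \<forall>\<D> S. \<D> division_of S \<and> S \<subseteq> {a..b} \<and> (\<Sum>k\<in>\<D>. Sup k - Inf k) < d \<longrightarrow>
      (\<Sum>k\<in>\<D>. cmod (f (Sup k) * g (Sup k) - f (Inf k) * g (Inf k))) < e"
  proof (intro exI[of _ "min d1 d2"] conjI allI impI)
    show "min d1 d2 > 0" using d1 d2 by simp
    fix \<D> S assume *: "\<D> division_of S \<and> S \<subseteq> {a..b} \<and> (\<Sum>k\<in>\<D>. Sup k - Inf k) < min d1 d2"
    have "cmod (f (Sup k) * g (Sup k) - f (Inf k) * g (Inf k))
        \<le> B * cmod (g (Sup k) - g (Inf k)) + B * cmod (f (Sup k) - f (Inf k))" if "k \<in> \<D>" for k
    proof -
      have k: "Inf k \<in> {a..b}" "Sup k \<in> {a..b}"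
        using division_of_real_member(2,3,4,5)[of \<D> S k] * that by auto
      have "f (Sup k) * g (Sup k) - f (Inf k) * g (Inf k)
          = f (Sup k) * (g (Sup k) - g (Inf k)) + g (Inf k) * (f (Sup k) - f (Inf k))"
        by (simp add: algebra_simps)
      also have "cmod \<dots> \<le> cmod (f (Sup k)) * cmod (g (Sup k) - g (Inf k)) + cmod (g (Inf k)) * cmod (f (Sup k) - f (Inf k))"
        by (metis norm_mult norm_triangle_ineq)
      also have "\<dots> \<le> B * cmod (g (Sup k) - g (Inf k)) + B * cmod (f (Sup k) - f (Inf k))"
        using k B by (intro add_mono mult_right_mono) auto
      finally show ?thesis .
    qed
    then have "(\<Sum>k\<in>\<D>. cmod (f (Sup k) * g (Sup k) - f (Inf k) * g (Inf k)))
        \<le> (\<Sum>k\<in>\<D>. B * cmod (g (Sup k) - g (Inf k)) + B * cmod (f (Sup k) - f (Inf k)))"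
      by (rule sum_mono)
    also have "\<dots> = B * (\<Sum>k\<in>\<D>. cmod (g (Sup k) - g (Inf k))) + B * (\<Sum>k\<in>\<D>. cmod (f (Sup k) - f (Inf k)))"
      by (simp add: sum.distrib sum_distrib_left)
    also have "\<dots> < B * e' + B * e'"
      using * d1(2)[of \<D> S] d2(2)[of \<D> S] B(1) by (intro add_strict_mono mult_strict_left_mono) auto
    also have "\<dots> = e" using B(1) by (simp add: e'_def)
    finally show "(\<Sum>k\<in>\<D>. cmod (f (Sup k) * g (Sup k) - f (Inf k) * g (Inf k))) < e" .
  qed
qed

lemma abs_cont_on_lipschitz:
  assumes L: "\<And>x y. x \<in> {a..b} \<Longrightarrow> y \<in> {a..b} \<Longrightarrow> cmod (f x - f y) \<le> L * \<bar>x - y\<bar>"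
  shows "abs_cont_on a b f"
  unfolding abs_cont_on_def
proof (intro allI impI)
  fix e :: real assume "e > 0"
  show "\<exists>d>0. \<forall>\<D> S. \<D> division_of S \<and> S \<subseteq> {a..b} \<and> (\<Sum>k\<in>\<D>. Sup k - Inf k) < d \<longrightarrow>
      (\<Sum>k\<in>\<D>. cmod (f (Sup k) - f (Inf k))) < e"
  proof (intro exI[of _ "e / (1 + \<bar>L\<bar>)"] conjI allI impI)
    show "e / (1 + \<bar>L\<bar>) > 0" using \<open>e > 0\<close> by simp
    fix \<D> S assume *: "\<D> division_of S \<and> S \<subseteq> {a..b} \<and> (\<Sum>k\<in>\<D>. Sup k - Inf k) < e / (1 + \<bar>L\<bar>)"
    have "cmod (f (Sup k) - f (Inf k)) \<le> (1 + \<bar>L\<bar>) * (Sup k - Inf k)" if "k \<in> \<D>" for k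
    proof -
      have k: "Inf k \<in> {a..b}" "Sup k \<in> {a..b}" "Inf k \<le> Sup k"
        using division_of_real_member(2,3,4,5)[of \<D> S k] * that by auto
      have "cmod (f (Sup k) - f (Inf k)) \<le> L * (Sup k - Inf k)"
        using L[OF k(2,1)] k(3) by simp
      also have "\<dots> \<le> (1 + \<bar>L\<bar>) * (Sup k - Inf k)"
        using k(3) by (intro mult_right_mono) auto
      finally show ?thesis .
    qed
    then have "(\<Sum>k\<in>\<D>. cmod (f (Sup k) - f (Inf k))) \<le> (1 + \<bar>L\<bar>) * (\<Sum>k\<in>\<D>. Sup k - Inf k)"
      unfolding sum_distrib_left by (rule sum_mono)
    also have "\<dots> < e"
      using * by (simp add: field_simps)
    finally show "(\<Sum>k\<in>\<D>. cmod (f (Sup k) - f (Inf k))) < e" .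
  qed
qed

lemma abs_cont_on_add:
  assumes "abs_cont_on a b f" "abs_cont_on a b g"
  shows "abs_cont_on a b (\<lambda>x. f x + g x)"
  unfolding abs_cont_on_def
proof (intro allI impI)
  fix e :: real assume "e > 0"
  then have "e / 2 > 0" by simp
  obtain d1 where d1: "d1 > 0" "\<And>\<D> S. \<D> division_of S \<Longrightarrow> S \<subseteq> {a..b} \<Longrightarrow>
      (\<Sum>k\<in>\<D>. Sup k - Inf k) < d1 \<Longrightarrow> (\<Sum>k\<in>\<D>. cmod (f (Sup k) - f (Inf k))) < e / 2"
    by (rule abs_cont_onE[OF assms(1) \<open>e / 2 > 0\<close>]) (rule that; blast)
  obtain d2 where d2: "d2 > 0" "\<And>\<D> S. \<D> division_of S \<Longrightarrow> S \<subseteq> {a..b} \<Longrightarrow>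
      (\<Sum>k\<in>\<D>. Sup k - Inf k) < d2 \<Longrightarrow> (\<Sum>k\<in>\<D>. cmod (g (Sup k) - g (Inf k))) < e / 2"
    by (rule abs_cont_onE[OF assms(2) \<open>e / 2 > 0\<close>]) (rule that; blast)
  show "\<exists>d>0. \<forall>\<D> S. \<D> division_of S \<and> S \<subseteq> {a..b} \<and> (\<Sum>k\<in>\<D>. Sup k - Inf k) < d \<longrightarrow>
      (\<Sum>k\<in>\<D>. cmod (f (Sup k) + g (Sup k) - (f (Inf k) + g (Inf k)))) < e"
  proof (intro exI[of _ "min d1 d2"] conjI allI impI)
    show "min d1 d2 > 0" using d1 d2 by simp
    fix \<D> S assume *: "\<D> division_of S \<and> S \<subseteq> {a..b} \<and> (\<Sum>k\<in>\<D>. Sup k - Inf k) < min d1 d2"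
    have "(\<Sum>k\<in>\<D>. cmod (f (Sup k) + g (Sup k) - (f (Inf k) + g (Inf k))))
        \<le> (\<Sum>k\<in>\<D>. cmod (f (Sup k) - f (Inf k)) + cmod (g (Sup k) - g (Inf k)))"
      by (intro sum_mono) (metis add_diff_add norm_triangle_ineq)
    also have "\<dots> < e"
      using * d1(2)[of \<D> S] d2(2)[of \<D> S] by (simp add: sum.distrib)
    finally show "(\<Sum>k\<in>\<D>. cmod (f (Sup k) + g (Sup k) - (f (Inf k) + g (Inf k)))) < e" .
  qed
qed

lemma abs_cont_on_C1:
  assumes d: "\<And>x. x \<in> {a..b} \<Longrightarrow> (f has_vector_derivative f' x) (at x within {a..b})"
    and c: "continuous_on {a..b} f'"
  shows "abs_cont_on a b f"
proof -
  have "bounded (f' ` {a..b})"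
    using c by (auto intro!: compact_imp_bounded compact_continuous_image)
  then obtain L where L: "\<forall>x\<in>{a..b}. cmod (f' x) \<le> L"
    unfolding bounded_iff by auto
  have "cmod (f x - f y) \<le> L * norm (x - y)" if "x \<in> {a..b}" "y \<in> {a..b}" for x y
  proof (rule differentiable_bound)
    show "convex {a..b}" by simp
    show "(f has_derivative (\<lambda>t. t *\<^sub>R f' x)) (at x within {a..b})" if "x \<in> {a..b}" for x
      using d[OF that] by (simp add: has_vector_derivative_def)
    show "onorm (\<lambda>t. t *\<^sub>R f' x) \<le> L" if "x \<in> {a..b}" for x
      using L that by (intro onorm_le) (auto simp: mult.commute[of L] intro!: mult_left_mono)
  qed (use that in auto)
  then show ?thesis
    by (intro abs_cont_on_lipschitz[where L=L]) auto
qed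

text \<open>
  The gauge treats two kinds of tags differently.  At a point of differentiability it bounds the
  error by a small multiple of the length.  At a point of \<open>N\<close> it keeps the interval inside an open
  set of small measure around \<open>N\<close>, so that absolute continuity makes the sum of the increments of \<open>f\<close>
  over these intervals small.
\<close>

lemma fundamental_theorem_of_calculus_abs_cont:
  fixes f :: "real \<Rightarrow> complex"
  assumes ac: "abs_cont_on a b f" and "a \<le> b" and N: "negligible N"
    and d: "\<And>x. x \<in> {a..b} - N \<Longrightarrow> (f has_vector_derivative f' x) (at x within {a..b})"
  shows "(f' has_integral (f b - f a)) {a..b}"
proof -
  \<comment> \<open>On \<open>N\<close> the integrand may be changed to zero.\<close>
  define g where "g x = (if x \<in> N then 0 else f' x)" for x
  have "(g has_integral (f b - f a)) (cbox a b)"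
    unfolding has_integral
  proof (intro allI impI)
    fix e :: real assume "e > 0"
    define e1 where "e1 = e / (2 * (b - a + 1))"
    have e1: "e1 > 0" "e1 * (b - a) < e / 2"
      using \<open>e > 0\<close> \<open>a \<le> b\<close> by (auto simp: e1_def field_simps)
    have "e / 2 > 0" using \<open>e > 0\<close> by simp
    obtain \<delta> where \<delta>: "\<delta> > 0" and D: "\<And>\<D> S. \<D> division_of S \<Longrightarrow> S \<subseteq> {a..b} \<Longrightarrow>
      (\<Sum>k\<in>\<D>. Sup k - Inf k) < \<delta> \<Longrightarrow> (\<Sum>k\<in>\<D>. cmod (f (Sup k) - f (Inf k))) < e / 2"
      by (rule abs_cont_onE[OF ac \<open>e / 2 > 0\<close>]) (rule that; blast)
    obtain U where U: "open U" "N \<subseteq> U" "U \<in> lmeasurable" "measure lebesgue U < \<delta>"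
    proof -
      have NS: "N \<in> sets lebesgue" "N \<in> lmeasurable" "measure lebesgue N = 0"
        using N negligible_iff_measure negligible_imp_sets by blast+
      obtain U where U: "open U" "N \<subseteq> U" "U - N \<in> lmeasurable" "emeasure lebesgue (U - N) < ennreal \<delta>"
        using sets_lebesgue_outer_open[OF NS(1) \<delta>] .
      have "U = (U - N) \<union> N" using U(2) by blast
      then have "U \<in> lmeasurable" using U(3) NS(2) by (metis fmeasurable.Un)
      moreover have "measure lebesgue (U - N) = measure lebesgue U"
        using measurable_measure_Diff[of U lebesgue N] NS U(2) \<open>U \<in> lmeasurable\<close> by simp
      moreover have "measure lebesgue (U - N) < \<delta>"
        using U(3,4) \<delta> by (simp add: emeasure_eq_measure2 ennreal_less_iff)
      ultimately show thesis using that U(1,2) by simp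
    qed
    have ex: "\<exists>r>0. (x \<in> N \<longrightarrow> ball x r \<subseteq> U) \<and> (x \<in> {a..b} - N \<longrightarrow> 
        (\<forall>y\<in>{a..b}. \<bar>y - x\<bar> < r \<longrightarrow> cmod (f y - f x - (y - x) *\<^sub>R f' x) \<le> e1 * \<bar>y - x\<bar>))" for x
    proof (cases "x \<in> N")
      case True
      then show ?thesis using U(1,2) open_contains_ball by (metis DiffD2 subsetD)
    next
      case False
      show ?thesis
      proof (cases "x \<in> {a..b}")
        case True
        then show ?thesis 
          using d[of x] False e1(1) unfolding has_vector_derivative_def has_derivative_within_alt
          by (auto simp: real_norm_def)
      next
        case F: False
        show ?thesis by (rule exI[of _ 1]) (use False F in auto)
      qed
    qed
    then obtain r where r: "\<And>x. r x > 0" "\<And>x. x \<in> N \<Longrightarrow> ball x (r x) \<subseteq> U"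
      "\<And>x y. x \<in> {a..b} - N \<Longrightarrow> y \<in> {a..b} \<Longrightarrow> \<bar>y - x\<bar> < r x \<Longrightarrow>
          cmod (f y - f x - (y - x) *\<^sub>R f' x) \<le> e1 * \<bar>y - x\<bar>"
      by metis
    show "\<exists>\<gamma>. gauge \<gamma> \<and> (\<forall>\<D>. \<D> tagged_division_of cbox a b \<and> \<gamma> fine \<D> \<longrightarrow>
        norm ((\<Sum>(x, k)\<in>\<D>. measure lborel k *\<^sub>R g x) - (f b - f a)) < e)"
    proof (intro exI[of _ "\<lambda>x. ball x (r x)"] conjI allI impI)
      show "gauge (\<lambda>x. ball x (r x))" using r(1) by (simp add: gauge_def)
      fix p assume "p tagged_division_of cbox a b \<and> (\<lambda>x. ball x (r x)) fine p"
      then have p: "p tagged_division_of {a..b}" "(\<lambda>x. ball x (r x)) fine p" by auto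
      have fin: "finite p" using p(1) by blast
      have mem: "x \<in> k \<and> k = {Inf k..Sup k} \<and> Inf k \<le> Sup k \<and> k \<subseteq> {a..b} \<and> k \<subseteq> ball x (r x) \<and> measure lborel k = Sup k - Inf k"
        if xk: "(x, k) \<in> p" for x k
      proof -
        obtain u v where "k = cbox u v"
          using tagged_division_ofD(4)[OF p(1) xk] by blast
        moreover have "x \<in> k" "k \<subseteq> {a..b}"
          using tagged_division_ofD(2,3)[OF p(1) xk] by auto
        ultimately show ?thesis using fineD[OF p(2) that] by auto
      qed
      have tel: "(\<Sum>(x, k)\<in>p. f (Sup k) - f (Inf k)) = f b - f a"
        by (rule additive_tagged_division_1[OF \<open>a \<le> b\<close> p(1)])
      define A where "A = {xk\<in>p. fst xk \<in> N}"
      define t where "t = (\<lambda>(x::real, k::real set). measure lborel k *\<^sub>R g x - (f (Sup k) - f (Inf k)))"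
      have "(\<Sum>(x, k)\<in>p. measure lborel k *\<^sub>R g x) - (f b - f a) = sum t p"
        unfolding tel[symmetric] t_def by (simp add: sum_subtractf case_prod_unfold)
      also have "\<dots> = sum t A + sum t (p - A)"
        using fin by (subst sum.subset_diff[of A p]) (auto simp: A_def add.commute)
      finally have eq: "(\<Sum>(x, k)\<in>p. measure lborel k *\<^sub>R g x) - (f b - f a) = sum t A + sum t (p - A)" .
      have "norm (sum t (p - A)) \<le> (\<Sum>xk\<in>p - A. e1 * measure lborel (snd xk))"
      proof (rule order_trans[OF norm_sum sum_mono])
        fix xk assume xk: "xk \<in> p - A"
        obtain x k where [simp]: "xk = (x, k)" by (cases xk)
        have xk': "(x, k) \<in> p" "x \<notin> N" using xk by (auto simp: A_def)
        note m = mem[OF xk'(1)]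
        have I: "Inf k \<in> k" "Sup k \<in> k" using m by (metis atLeastAtMost_iff order_refl)+
        have x: "x \<in> {a..b} - N" using m xk' by auto
        have b1: "cmod (f (Sup k) - f x - (Sup k - x) *\<^sub>R f' x) \<le> e1 * (Sup k - x)"
        proof -
          have "\<bar>Sup k - x\<bar> < r x" using m I(2) by (auto simp: dist_real_def)
          moreover have "Sup k \<in> {a..b}" using m I(2) by auto
          moreover have "x \<le> Sup k" using m by (metis atLeastAtMost_iff)
          ultimately show ?thesis using r(3)[OF x, of "Sup k"] by simp
        qed
        have b2: "cmod (f (Inf k) - f x - (Inf k - x) *\<^sub>R f' x) \<le> e1 * (x - Inf k)"
        proof -
          have "\<bar>Inf k - x\<bar> < r x" using m I(1) by (auto simp: dist_real_def)
          moreover have "Inf k \<in> {a..b}" using m I(1) by auto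
          moreover have "Inf k \<le> x" using m by (metis atLeastAtMost_iff)
          ultimately show ?thesis using r(3)[OF x, of "Inf k"] by simp
        qed
        have "t xk = (f (Inf k) - f x - (Inf k - x) *\<^sub>R f' x) - (f (Sup k) - f x - (Sup k - x) *\<^sub>R f' x)"
        proof -
          have "measure lborel k = Sup k - Inf k" using m by blast
          then show ?thesis using xk'(2) by (simp add: t_def g_def scaleR_left_diff_distrib)
        qed
        then have "norm (t xk) \<le> e1 * (x - Inf k) + e1 * (Sup k - x)"
          using b1 b2 norm_triangle_ineq4 by (metis add_mono order_trans)
        also have "\<dots> = e1 * measure lborel (snd xk)"
        proof -
          have "measure lborel k = Sup k - Inf k" using m by blast
          then show ?thesis by (simp add: right_diff_distrib)
        qed
        finally show "norm (t xk) \<le> e1 * measure lborel (snd xk)" .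
      qed
      also have "\<dots> \<le> (\<Sum>xk\<in>p. e1 * measure lborel (snd xk))"
        using fin e1(1) by (intro sum_mono2) auto
      also have "\<dots> = e1 * (b - a)"
        using additive_content_tagged_division[of p a b] p(1) \<open>a \<le> b\<close>
        by (simp add: sum_distrib_left[symmetric] case_prod_unfold)
      finally have s1: "norm (sum t (p - A)) < e / 2" using e1(2) by simp
      have Ap: "A tagged_partial_division_of {a..b}"
        by (rule tagged_partial_division_subset[of p]) (use p(1) in \<open>auto simp: A_def tagged_division_of_def\<close>)
      have div: "(snd ` A) division_of \<Union>(snd ` A)"
        by (rule partial_division_of_tagged_division[OF Ap])
      have inS: "\<Union>(snd ` A) \<subseteq> {a..b}" using mem by (force simp: A_def)
      have inU: "\<Union>(snd ` A) \<subseteq> U" 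
      proof
        fix y assume "y \<in> \<Union>(snd ` A)"
        then obtain x k where "(x, k) \<in> p" "x \<in> N" "y \<in> k" by (auto simp: A_def)
        then show "y \<in> U" using mem[of x k] r(2)[of x] by auto
      qed
      have len: "(\<Sum>k\<in>snd ` A. Sup k - Inf k) < \<delta>"
      proof -
        have "measure lebesgue k = Sup k - Inf k" if kA: "k \<in> snd ` A" for k
        proof -
          obtain x where "(x, k) \<in> p" using kA by (auto simp: A_def)
          then have "k = {Inf k..Sup k}" "Inf k \<le> Sup k" using mem by blast+
          then show ?thesis by (metis atLeastAtMost_borel measure_completion measure_lborel_Icc sets_lborel)
        qed
        then have "(\<Sum>k\<in>snd ` A. Sup k - Inf k) = (\<Sum>k\<in>snd ` A. measure lebesgue k)"
          by simp
        also have "\<dots> = measure lebesgue (\<Union>(snd ` A))"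
          using content_division[OF div] by simp
        also have "\<dots> \<le> measure lebesgue U"
          using U(3) inU lmeasurable_division[OF div] by (intro measure_mono_fmeasurable) auto
        finally show ?thesis using U(4) by simp
      qed
      have "norm (sum t A) \<le> (\<Sum>xk\<in>A. (\<lambda>k. cmod (f (Sup k) - f (Inf k))) (snd xk))"
        by (rule order_trans[OF norm_sum sum_mono]) (auto simp: A_def t_def g_def norm_minus_commute)
      also have "\<dots> = (\<Sum>k\<in>snd ` A. cmod (f (Sup k) - f (Inf k)))"
      proof -
        \<comment> \<open>\<open>Sup\<close> and \<open>Inf\<close> of the empty set are unspecified, so the summand is made zero there.\<close>
        define d where "d k = (if k = {} then 0 else cmod (f (Sup k) - f (Inf k)))" for k :: "real set"
        have ne: "k \<noteq> {}" if "(x, k) \<in> p" for x k using mem[OF that] by auto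
        have "(\<Sum>(x,k)\<in>A. d k) = (\<Sum>k\<in>snd ` A. d k)"
        proof (rule sum.over_tagged_division_lemma)
          show "A tagged_division_of (\<Union>(snd ` A))"
            using Ap by (simp add: tagged_partial_division_of_Union_self)
          fix u v :: real assume "box u v = {}"
          then show "d (cbox u v) = 0"
            by (cases "u = v") (auto simp: not_less d_def)
        qed
        moreover have "(\<Sum>(x,k)\<in>A. d k) = (\<Sum>xk\<in>A. cmod (f (Sup (snd xk)) - f (Inf (snd xk))))"
          by (rule sum.cong) (use ne in \<open>auto simp: A_def d_def\<close>)
        moreover have "(\<Sum>k\<in>snd ` A. d k) = (\<Sum>k\<in>snd ` A. cmod (f (Sup k) - f (Inf k)))"
          by (rule sum.cong) (use ne in \<open>auto simp: A_def d_def\<close>)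
        ultimately show ?thesis by simp
      qed
      also have "\<dots> < e / 2" using D[OF div inS len] .
      finally have s2: "norm (sum t A) < e / 2" .
      show "norm ((\<Sum>(x, k)\<in>p. measure lborel k *\<^sub>R g x) - (f b - f a)) < e"
        unfolding eq using norm_triangle_lt[of "sum t A" "sum t (p - A)" e] s1 s2 by simp
    qed
  qed
  then show ?thesis
    using has_integral_spike[OF N, of "{a..b}" f' g] by (simp add: g_def)
qed

section \<open>The calculus of the differential expression\<close>

lemma at_within_atLeast_neq_bot:
  fixes l :: real
  assumes "l \<le> x"
  shows "at x within {l..} \<noteq> bot"
proof -
  have "x islimpt {x..x+1}" by (simp add: islimpt_Icc)
  then have "x islimpt {l..}" by (rule islimpt_subset) (use assms in auto)
  then show ?thesis by (simp add: trivial_limit_within)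
qed

lemma D1_eqI:
  assumes "(y has_vector_derivative d) (at x within {l..})" "l \<le> x"
  shows "D1 l y x = d"
  unfolding D1_def by (rule vector_derivative_within[OF at_within_atLeast_neq_bot[OF assms(2)] assms(1)])

lemma sl_regular_D1:
  assumes "sl_regular l y" "l \<le> x"
  shows "(y has_vector_derivative D1 l y x) (at x within {l..})"
  using assms unfolding sl_regular_def D1_def by (simp add: vector_derivative_works)

lemma sl_regular_D2:
  assumes "sl_regular l y"
  shows "AE x in lebesgue. x \<ge> l \<longrightarrow> (D1 l y has_vector_derivative D1 l (D1 l y) x) (at x within {l..})"
proof -
  have "AE x in lebesgue. x \<ge> l \<longrightarrow> D1 l y differentiable (at x within {l..})"
    using assms unfolding sl_regular_def by blast
  then show ?thesis
    by eventually_elim (auto simp: vector_derivative_works D1_def[of l "D1 l y"])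
qed

lemma continuous_on_atLeastI:
  fixes f :: "real \<Rightarrow> 'a::topological_space"
  assumes "\<And>b. b \<ge> l \<Longrightarrow> continuous_on {l..b} f"
  shows "continuous_on {l..} f"
  unfolding continuous_on_eq_continuous_within
proof
  fix x assume x: "x \<in> {l..}"
  have "at x within {l..} = at x within {l..x+1}"
    by (rule at_within_nhd[of _ "{..<x+1}"]) auto
  then show "continuous (at x within {l..}) f"
    using assms[of "x+1"] x by (auto simp: continuous_on_eq_continuous_within continuous_within)
qed

lemma sl_regular_continuous:
  assumes "sl_regular l y"
  shows "continuous_on {l..} y" "continuous_on {l..} (D1 l y)"
  using assms unfolding sl_regular_def loc_abs_cont_def
  by (auto intro!: continuous_on_atLeastI abs_cont_on_imp_continuous_on)

text \<open>
  Only the derivatives matter for regularity: a function that has a locally absolutely continuous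
  derivative is itself locally Lipschitz.
\<close>

lemma sl_regularI:
  assumes y: "\<forall>x\<ge>l. (y has_vector_derivative y1 x) (at x within {l..})"
    and ac: "loc_abs_cont l y1"
    and y2: "AE x in lebesgue. x \<ge> l \<longrightarrow> (y1 has_vector_derivative y2 x) (at x within {l..})"
  shows "sl_regular l y" "\<And>x. x \<ge> l \<Longrightarrow> D1 l y x = y1 x"
    "AE x in lebesgue. x \<ge> l \<longrightarrow> sl_expr l q y x = - y2 x + complex_of_real (q x) * y x"
proof -
  show D: "D1 l y x = y1 x" if "x \<ge> l" for x
    using D1_eqI y that by blast
  have tr: "(D1 l y has_vector_derivative d) (at x within {l..})"
    if "(y1 has_vector_derivative d) (at x within {l..})" "x \<ge> l" for x d
    by (rule has_vector_derivative_transform[OF _ _ that(1)]) (use that(2) D in auto)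
  have c: "continuous_on {l..b} y1" if "b \<ge> l" for b
    using ac that unfolding loc_abs_cont_def by (auto intro: abs_cont_on_imp_continuous_on)
  have "abs_cont_on l b y" if "b \<ge> l" for b
    by (rule abs_cont_on_C1[OF _ c[OF that]])
      (use y in \<open>auto intro: has_vector_derivative_within_subset\<close>)
  moreover have "abs_cont_on l b (D1 l y)" if "b \<ge> l" for b
  proof -
    have "abs_cont_on l b y1" using ac that unfolding loc_abs_cont_def by blast
    show ?thesis
      unfolding abs_cont_on_def
    proof (intro allI impI)
      fix e :: real assume "e > 0"
      obtain \<delta> where \<delta>: "\<delta> > 0" "\<And>\<D> S. \<D> division_of S \<Longrightarrow> S \<subseteq> {l..b} \<Longrightarrow>
          (\<Sum>k\<in>\<D>. Sup k - Inf k) < \<delta> \<Longrightarrow> (\<Sum>k\<in>\<D>. cmod (y1 (Sup k) - y1 (Inf k))) < e"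
        by (rule abs_cont_onE[OF \<open>abs_cont_on l b y1\<close> \<open>e > 0\<close>]) (rule that; blast)
      have "(\<Sum>k\<in>\<D>. cmod (D1 l y (Sup k) - D1 l y (Inf k))) = (\<Sum>k\<in>\<D>. cmod (y1 (Sup k) - y1 (Inf k)))"
        if dv: "\<D> division_of S" "S \<subseteq> {l..b}" for \<D> S
      proof (rule sum.cong[OF refl])
        fix k assume "k \<in> \<D>"
        then have "Sup k \<in> {l..b}" "Inf k \<in> {l..b}"
          using division_of_real_member(3,4,5)[OF dv(1)] dv(2) by blast+
        then show "cmod (D1 l y (Sup k) - D1 l y (Inf k)) = cmod (y1 (Sup k) - y1 (Inf k))"
          using D by simp
      qed
      then show "\<exists>\<delta>>0. \<forall>\<D> S. \<D> division_of S \<and> S \<subseteq> {l..b} \<and> (\<Sum>k\<in>\<D>. Sup k - Inf k) < \<delta> \<longrightarrow>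
          (\<Sum>k\<in>\<D>. cmod (D1 l y (Sup k) - D1 l y (Inf k))) < e"
        using \<delta> by (intro exI[of _ \<delta>] conjI allI impI) auto
    qed
  qed
  moreover have "AE x in lebesgue. x \<ge> l \<longrightarrow> D1 l y differentiable (at x within {l..})"
    using y2 by eventually_elim (auto intro!: differentiableI_vector tr)
  ultimately show "sl_regular l y"
    unfolding sl_regular_def loc_abs_cont_def
    using y by (auto intro!: differentiableI_vector)
  show "AE x in lebesgue. x \<ge> l \<longrightarrow> sl_expr l q y x = - y2 x + complex_of_real (q x) * y x"
    using y2 by eventually_elim (auto simp: sl_expr_def D1_eqI[OF tr])
qed

lemma loc_abs_cont_mult_C1:
  assumes "loc_abs_cont l f"
    and "\<And>x. (\<eta> has_vector_derivative d\<eta> x) (at x)" "continuous_on UNIV d\<eta>"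
  shows "loc_abs_cont l (\<lambda>x. \<eta> x * f x)"
proof -
  have "abs_cont_on l b (\<lambda>x. \<eta> x * f x)" if "b \<ge> l" for b
  proof (rule abs_cont_on_mult)
    show "abs_cont_on l b \<eta>"
      by (rule abs_cont_on_C1[of _ _ _ d\<eta>])
        (auto intro: has_vector_derivative_at_within assms(2) continuous_on_subset[OF assms(3)])
    show "abs_cont_on l b f" using assms(1) that unfolding loc_abs_cont_def by blast
  qed
  then show ?thesis unfolding loc_abs_cont_def by blast
qed

lemma loc_abs_cont_add:
  "loc_abs_cont l f \<Longrightarrow> loc_abs_cont l g \<Longrightarrow> loc_abs_cont l (\<lambda>x. f x + g x)"
  unfolding loc_abs_cont_def by (auto intro: abs_cont_on_add)

lemma sl_regular_loc_abs_cont: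
  assumes "sl_regular l y"
  shows "loc_abs_cont l y" "loc_abs_cont l (D1 l y)"
  using assms unfolding sl_regular_def by blast+

lemma sl_regular_linear:
  assumes y: "sl_regular l y" and w: "sl_regular l w"
  shows "sl_regular l (\<lambda>x. c * y x + d * w x)"
    "\<And>x. x \<ge> l \<Longrightarrow> D1 l (\<lambda>x. c * y x + d * w x) x = c * D1 l y x + d * D1 l w x"
    "AE x in lebesgue. x \<ge> l \<longrightarrow>
       sl_expr l q (\<lambda>x. c * y x + d * w x) x = c * sl_expr l q y x + d * sl_expr l q w x"
proof -
  have 1: "\<forall>x\<ge>l. ((\<lambda>x. c * y x + d * w x) has_vector_derivative c * D1 l y x + d * D1 l w x) (at x within {l..})"
    by (intro allI impI has_vector_derivative_add has_vector_derivative_mult_right sl_regular_D1 y w)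
  have 2: "loc_abs_cont l (\<lambda>x. c * D1 l y x + d * D1 l w x)"
    by (intro loc_abs_cont_add loc_abs_cont_mult_C1[where d\<eta>="\<lambda>_. 0"] sl_regular_loc_abs_cont y w)
      auto
  have 3: "AE x in lebesgue. x \<ge> l \<longrightarrow> ((\<lambda>x. c * D1 l y x + d * D1 l w x) has_vector_derivative
      c * D1 l (D1 l y) x + d * D1 l (D1 l w) x) (at x within {l..})"
    using sl_regular_D2[OF y] sl_regular_D2[OF w]
    by eventually_elim (auto intro!: derivative_intros has_vector_derivative_mult_right)
  note * = sl_regularI[OF 1 2 3]
  show "sl_regular l (\<lambda>x. c * y x + d * w x)"
    "\<And>x. x \<ge> l \<Longrightarrow> D1 l (\<lambda>x. c * y x + d * w x) x = c * D1 l y x + d * D1 l w x"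
    using * by blast+
  show "AE x in lebesgue. x \<ge> l \<longrightarrow>
       sl_expr l q (\<lambda>x. c * y x + d * w x) x = c * sl_expr l q y x + d * sl_expr l q w x"
    using *(3)[of q] by eventually_elim (auto simp: sl_expr_def algebra_simps)
qed

lemma sl_regular_cnj:
  assumes y: "sl_regular l y"
  shows "sl_regular l (\<lambda>x. cnj (y x))"
    "\<And>x. x \<ge> l \<Longrightarrow> D1 l (\<lambda>x. cnj (y x)) x = cnj (D1 l y x)"
    "AE x in lebesgue. x \<ge> l \<longrightarrow> sl_expr l q (\<lambda>x. cnj (y x)) x = cnj (sl_expr l q y x)"
proof -
  have 1: "\<forall>x\<ge>l. ((\<lambda>x. cnj (y x)) has_vector_derivative cnj (D1 l y x)) (at x within {l..})"
    by (intro allI impI has_vector_derivative_cnj sl_regular_D1 y)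
  have 2: "loc_abs_cont l (\<lambda>x. cnj (D1 l y x))"
    using sl_regular_loc_abs_cont(2)[OF y]
    unfolding loc_abs_cont_def abs_cont_on_def complex_cnj_diff[symmetric] complex_mod_cnj .
  have 3: "AE x in lebesgue. x \<ge> l \<longrightarrow> ((\<lambda>x. cnj (D1 l y x)) has_vector_derivative
      cnj (D1 l (D1 l y) x)) (at x within {l..})"
    using sl_regular_D2[OF y]
    by eventually_elim (auto intro!: has_vector_derivative_cnj)
  note * = sl_regularI[OF 1 2 3]
  show "sl_regular l (\<lambda>x. cnj (y x))" "\<And>x. x \<ge> l \<Longrightarrow> D1 l (\<lambda>x. cnj (y x)) x = cnj (D1 l y x)"
    using * by blast+
  show "AE x in lebesgue. x \<ge> l \<longrightarrow> sl_expr l q (\<lambda>x. cnj (y x)) x = cnj (sl_expr l q y x)"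
    using *(3)[of q] by eventually_elim (auto simp: sl_expr_def)
qed

lemma sl_regular_mult_C2:
  assumes y: "sl_regular l y"
    and e1: "\<And>x. (\<eta> has_vector_derivative \<eta>1 x) (at x)"
    and e2: "\<And>x. (\<eta>1 has_vector_derivative \<eta>2 x) (at x)"
    and c: "continuous_on UNIV \<eta>2"
  shows "sl_regular l (\<lambda>x. \<eta> x * y x)"
    "\<And>x. x \<ge> l \<Longrightarrow> D1 l (\<lambda>x. \<eta> x * y x) x = \<eta> x * D1 l y x + \<eta>1 x * y x"
    "AE x in lebesgue. x \<ge> l \<longrightarrow> sl_expr l q (\<lambda>x. \<eta> x * y x) x
        = \<eta> x * sl_expr l q y x - 2 * \<eta>1 x * D1 l y x - \<eta>2 x * y x"
proof -
  have 1: "\<forall>x\<ge>l. ((\<lambda>x. \<eta> x * y x) has_vector_derivative \<eta> x * D1 l y x + \<eta>1 x * y x) (at x within {l..})"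
    by (intro allI impI has_vector_derivative_mult has_vector_derivative_at_within[OF e1] sl_regular_D1 y)
  have c1: "continuous_on UNIV \<eta>1"
    using e2 by (meson continuous_at_imp_continuous_on has_vector_derivative_continuous)
  have 2: "loc_abs_cont l (\<lambda>x. \<eta> x * D1 l y x + \<eta>1 x * y x)"
    by (intro loc_abs_cont_add loc_abs_cont_mult_C1[OF _ e1] loc_abs_cont_mult_C1[OF _ e2]
        sl_regular_loc_abs_cont y c c1)
  have 3: "AE x in lebesgue. x \<ge> l \<longrightarrow> ((\<lambda>x. \<eta> x * D1 l y x + \<eta>1 x * y x) has_vector_derivative
      (\<eta> x * D1 l (D1 l y) x + \<eta>1 x * D1 l y x) + (\<eta>1 x * D1 l y x + \<eta>2 x * y x)) (at x within {l..})"
    using sl_regular_D2[OF y]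
    by eventually_elim (intro impI has_vector_derivative_add has_vector_derivative_mult
        has_vector_derivative_at_within[OF e1] has_vector_derivative_at_within[OF e2] sl_regular_D1[OF y]; blast)
  note * = sl_regularI[OF 1 2 3]
  show "sl_regular l (\<lambda>x. \<eta> x * y x)"
    "\<And>x. x \<ge> l \<Longrightarrow> D1 l (\<lambda>x. \<eta> x * y x) x = \<eta> x * D1 l y x + \<eta>1 x * y x"
    using * by blast+
  show "AE x in lebesgue. x \<ge> l \<longrightarrow> sl_expr l q (\<lambda>x. \<eta> x * y x) x
        = \<eta> x * sl_expr l q y x - 2 * \<eta>1 x * D1 l y x - \<eta>2 x * y x"
    using *(3)[of q] by eventually_elim (auto simp: sl_expr_def algebra_simps)
qed

definition wronskian :: "real \<Rightarrow> (real \<Rightarrow> complex) \<Rightarrow> (real \<Rightarrow> complex) \<Rightarrow> real \<Rightarrow> complex" where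
  "wronskian l y w x = y x * D1 l w x - D1 l y x * w x"

text \<open>
  The derivative of \<open>y w' - y' w\<close> is \<open>y w'' - y'' w\<close>; on inserting \<open>y'' = q y - l(y)\<close> and
  \<open>w'' = q w - l(w)\<close> the terms with \<open>q\<close> cancel.
\<close>

lemma Lagrange_identity_has_integral:
  assumes y: "sl_regular l y" and w: "sl_regular l w" and "l \<le> a" "a \<le> b"
  shows "((\<lambda>x. sl_expr l q y x * w x - y x * sl_expr l q w x) has_integral
      (wronskian l y w b - wronskian l y w a)) {a..b}"
proof -
  have "AE x in lebesgue. x \<ge> l \<longrightarrow> 
      (wronskian l y w has_vector_derivative sl_expr l q y x * w x - y x * sl_expr l q w x) (at x within {l..})"
    using sl_regular_D2[OF y] sl_regular_D2[OF w]
  proof eventually_elim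
    case (elim x)
    show ?case
    proof
      assume x: "x \<ge> l"
      have "(wronskian l y w has_vector_derivative
          (y x * D1 l (D1 l w) x + D1 l y x * D1 l w x) - (D1 l y x * D1 l w x + D1 l (D1 l y) x * w x)) (at x within {l..})"
        unfolding wronskian_def[abs_def] using elim x
        by (intro has_vector_derivative_diff has_vector_derivative_mult) (use sl_regular_D1 y w x in auto)
      then show "(wronskian l y w has_vector_derivative sl_expr l q y x * w x - y x * sl_expr l q w x) (at x within {l..})"
        by (simp add: sl_expr_def algebra_simps)
    qed
  qed
  then obtain N where N: "N \<in> null_sets lebesgue" "\<And>x. x \<notin> N \<Longrightarrow> x \<ge> l \<Longrightarrow>
      (wronskian l y w has_vector_derivative sl_expr l q y x * w x - y x * sl_expr l q w x) (at x within {l..})"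
    by (auto elim!: AE_E3)
  have ac: "abs_cont_on l b (wronskian l y w)"
  proof -
    have 1: "abs_cont_on l b f" if "loc_abs_cont l f" for f
      using that assms(3,4) unfolding loc_abs_cont_def by auto
    have 2: "abs_cont_on l b (\<lambda>x. -1 :: complex)"
      by (rule abs_cont_on_lipschitz[where L=0]) auto
    have "abs_cont_on l b (\<lambda>x. y x * D1 l w x + (-1) * (D1 l y x * w x))"
      by (intro abs_cont_on_add abs_cont_on_mult 1 2 sl_regular_loc_abs_cont y w)
    then show ?thesis by (simp add: wronskian_def[abs_def])
  qed
  show ?thesis
  proof (rule fundamental_theorem_of_calculus_abs_cont)
    show "abs_cont_on a b (wronskian l y w)"
      by (rule abs_cont_on_subset[OF ac]) (use assms in auto)
    show "negligible N" using N(1) by (simp add: negligible_iff_null_sets)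
    show "(wronskian l y w has_vector_derivative sl_expr l q y x * w x - y x * sl_expr l q w x) (at x within {a..b})"
      if "x \<in> {a..b} - N" for x
      by (rule has_vector_derivative_within_subset[OF N(2)]) (use that assms in auto)
  qed fact
qed

lemma Lagrange_identity:
  assumes y: "sl_regular l y" and w: "sl_regular l w" and "l \<le> a" "a \<le> b"
    and int: "integrable (lebesgue_on {a..b}) (\<lambda>x. sl_expr l q y x * w x - y x * sl_expr l q w x)"
  shows "(LINT x|lebesgue_on {a..b}. sl_expr l q y x * w x - y x * sl_expr l q w x)
      = wronskian l y w b - wronskian l y w a"
proof -
  have "((\<lambda>x. sl_expr l q y x * w x - y x * sl_expr l q w x) has_integral
      (LINT x|lebesgue_on {a..b}. sl_expr l q y x * w x - y x * sl_expr l q w x)) {a..b}"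
    by (rule has_integral_integral_lebesgue_on[OF int]) auto
  then show ?thesis
    using Lagrange_identity_has_integral[OF y w assms(3,4), of q] has_integral_unique by blast
qed

section \<open>Square-integrable functions\<close>

definition sq_integrable :: "'a measure \<Rightarrow> ('a \<Rightarrow> complex) \<Rightarrow> bool" where
  "sq_integrable M f \<longleftrightarrow> f \<in> borel_measurable M \<and> integrable M (\<lambda>x. (cmod (f x))\<^sup>2)"

definition L2norm :: "'a measure \<Rightarrow> ('a \<Rightarrow> complex) \<Rightarrow> real" where
  "L2norm M f = sqrt (LINT x|M. (cmod (f x))\<^sup>2)"

lemma L2norm_nonneg [simp]: "L2norm M f \<ge> 0"
  by (simp add: L2norm_def)

lemma L2norm_sq: "(L2norm M f)\<^sup>2 = (LINT x|M. (cmod (f x))\<^sup>2)"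
  by (simp add: L2norm_def)

lemma L2norm_cnj [simp]: "L2norm M (\<lambda>x. cnj (f x)) = L2norm M f"
  by (simp add: L2norm_def)

lemma sq_integrable_cnj [simp]: "sq_integrable M (\<lambda>x. cnj (f x)) \<longleftrightarrow> sq_integrable M f"
  by (simp add: sq_integrable_def borel_measurable_complex_iff)

lemma sq_integrable_mult:
  assumes "sq_integrable M f" "sq_integrable M g"
  shows "integrable M (\<lambda>x. f x * g x)"
proof (rule Bochner_Integration.integrable_bound)
  show "integrable M (\<lambda>x. (cmod (f x))\<^sup>2 + (cmod (g x))\<^sup>2)"
    using assms by (auto simp: sq_integrable_def)
  show "(\<lambda>x. f x * g x) \<in> borel_measurable M"
    using assms by (auto simp: sq_integrable_def)
  have "a * b \<le> a\<^sup>2 + b\<^sup>2" if "a \<ge> 0" "b \<ge> 0" for a b :: real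
    using sum_squares_bound[of a b] mult_nonneg_nonneg[OF that] by linarith
  then show "AE x in M. norm (f x * g x) \<le> norm ((cmod (f x))\<^sup>2 + (cmod (g x))\<^sup>2)"
    by (intro AE_I2) (simp add: norm_mult)
qed

lemma sq_integrable_linear:
  assumes "sq_integrable M f" "sq_integrable M g"
  shows "sq_integrable M (\<lambda>x. c * f x + d * g x)"
  unfolding sq_integrable_def
proof
  show [measurable]: "(\<lambda>x. c * f x + d * g x) \<in> borel_measurable M"
    using assms by (auto simp: sq_integrable_def)
  show "integrable M (\<lambda>x. (cmod (c * f x + d * g x))\<^sup>2)"
  proof (rule Bochner_Integration.integrable_bound)
    show "integrable M (\<lambda>x. 2 * (cmod c)\<^sup>2 * (cmod (f x))\<^sup>2 + 2 * (cmod d)\<^sup>2 * (cmod (g x))\<^sup>2)"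
      using assms by (auto simp: sq_integrable_def)
    have "(cmod (a + b))\<^sup>2 \<le> 2 * (cmod a)\<^sup>2 + 2 * (cmod b)\<^sup>2" for a b
    proof -
      have "(cmod (a + b))\<^sup>2 \<le> (cmod a + cmod b)\<^sup>2"
        by (intro power_mono norm_triangle_ineq) auto
      also have "\<dots> \<le> 2 * (cmod a)\<^sup>2 + 2 * (cmod b)\<^sup>2"
        using sum_squares_bound[of "cmod a" "cmod b"] by (simp add: power2_sum)
      finally show ?thesis .
    qed
    from this[of "c * f x" "d * g x" for x]
    show "AE x in M. norm ((cmod (c * f x + d * g x))\<^sup>2) \<le>
        norm (2 * (cmod c)\<^sup>2 * (cmod (f x))\<^sup>2 + 2 * (cmod d)\<^sup>2 * (cmod (g x))\<^sup>2)"
      by (intro AE_I2) (simp add: norm_mult power_mult_distrib mult.assoc)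
  qed simp
qed

lemma sq_integrable_cmult: "sq_integrable M f \<Longrightarrow> sq_integrable M (\<lambda>x. c * f x)"
  using sq_integrable_linear[of M f f c 0] by simp

lemma sq_integrable_diff: "sq_integrable M f \<Longrightarrow> sq_integrable M g \<Longrightarrow> sq_integrable M (\<lambda>x. f x - g x)"
  using sq_integrable_linear[of M f g 1 "-1"] by simp

lemma Cauchy_Schwarz_L2:
  assumes f: "sq_integrable M f" and g: "sq_integrable M g"
  shows "cmod (LINT x|M. f x * g x) \<le> L2norm M f * L2norm M g"
proof -
  define a b c where "a = (LINT x|M. (cmod (f x))\<^sup>2)" and "b = (LINT x|M. (cmod (g x))\<^sup>2)"
    and "c = (LINT x|M. cmod (f x) * cmod (g x))"
  have ab: "a \<ge> 0" "b \<ge> 0" by (auto simp: a_def b_def)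
  have int: "integrable M (\<lambda>x. (cmod (f x))\<^sup>2)" "integrable M (\<lambda>x. (cmod (g x))\<^sup>2)"
    using f g by (auto simp: sq_integrable_def)
  have intc: "integrable M (\<lambda>x. cmod (f x) * cmod (g x))"
    using integrable_norm[OF sq_integrable_mult[OF f g]] by (simp add: norm_mult)
  \<comment> \<open>The classical argument: the quadratic \<open>\<integral> (t \<bar>f\<bar> - \<bar>g\<bar>)\<^sup>2\<close> in \<open>t\<close> is nonnegative.\<close>
  have quad: "0 \<le> t\<^sup>2 * a - 2 * t * c + b" for t
  proof -
    have "0 \<le> (LINT x|M. (t * cmod (f x) - cmod (g x))\<^sup>2)" by simp
    also have "\<dots> = (LINT x|M. t\<^sup>2 * (cmod (f x))\<^sup>2 - 2 * t * (cmod (f x) * cmod (g x)) + (cmod (g x))\<^sup>2)"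
      by (rule Bochner_Integration.integral_cong) (auto simp: power2_diff power_mult_distrib)
    also have "\<dots> = t\<^sup>2 * a - 2 * t * c + b"
      using int intc by (simp add: a_def b_def c_def)
    finally show ?thesis .
  qed
  have "c\<^sup>2 \<le> a * b"
  proof (cases "a = 0")
    case True
    have "c = 0"
    proof (rule ccontr)
      assume "c \<noteq> 0"
      then show False using quad[of "(b + 1) / (2 * c)"] True by (simp add: field_simps)
    qed
    then show ?thesis using True by simp
  next
    case False
    then show ?thesis using quad[of "c / a"] ab by (simp add: field_simps power2_eq_square)
  qed
  then have "\<bar>c\<bar> \<le> sqrt (a * b)" by (simp add: real_le_rsqrt)
  then have "c \<le> L2norm M f * L2norm M g" by (simp add: L2norm_def real_sqrt_mult a_def b_def)
  moreover have "cmod (LINT x|M. f x * g x) \<le> c"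
    unfolding c_def norm_mult[symmetric] by (rule integral_norm_bound)
  ultimately show ?thesis by simp
qed

lemma L2norm_eq_0_iff:
  assumes "sq_integrable M f"
  shows "L2norm M f = 0 \<longleftrightarrow> (AE x in M. f x = 0)"
  using assms integral_nonneg_eq_0_iff_AE[of M "\<lambda>x. (cmod (f x))\<^sup>2"]
  by (auto simp: L2norm_def sq_integrable_def)

lemma integral_mult_cnj:
  assumes "sq_integrable M f"
  shows "(LINT x|M. f x * cnj (f x)) = of_real ((L2norm M f)\<^sup>2)"
  by (simp only: L2norm_sq complex_norm_square[symmetric] integral_complex_of_real)

abbreviation half_line :: "real \<Rightarrow> real measure" where
  "half_line l \<equiv> lebesgue_on {l..}"

lemma L2_iff: "f \<in> L2 l \<longleftrightarrow> sq_integrable (half_line l) f"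
  by (simp add: L2_def sq_integrable_def set_borel_measurable_def set_integrable_def
      borel_measurable_restrict_space_iff integrable_restrict_space)

lemma inner_L2_eq: "inner_L2 l f g = (LINT x|half_line l. f x * cnj (g x))"
  by (simp add: inner_L2_def set_lebesgue_integral_def integral_restrict_space)

lemma AE_half_line: "(AE x in half_line l. P x) \<longleftrightarrow> (AE x in lebesgue. x \<ge> l \<longrightarrow> P x)"
  by (simp add: AE_restrict_space_iff)

lemma borel_measurable_half_line_cong_AE:
  fixes f g :: "real \<Rightarrow> complex"
  assumes "f \<in> borel_measurable (half_line l)" "AE x in half_line l. f x = g x"
  shows "g \<in> borel_measurable (half_line l)"
proof -
  have "(\<lambda>x. indicat_real {l..} x *\<^sub>R f x) \<in> borel_measurable lebesgue"
    by (intro borel_measurable_restrict_space_iff[THEN iffD1] assms(1)) auto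
  moreover have "AE x in lebesgue. indicat_real {l..} x *\<^sub>R f x = indicat_real {l..} x *\<^sub>R g x"
    using assms(2) unfolding AE_half_line by eventually_elim (auto simp: indicator_def)
  ultimately have "(\<lambda>x. indicat_real {l..} x *\<^sub>R g x) \<in> borel_measurable lebesgue"
    by (rule borel_measurable_AE)
  then show ?thesis
    by (intro borel_measurable_restrict_space_iff[THEN iffD2]) auto
qed

lemma sq_integrable_cong_AE:
  assumes f: "sq_integrable (half_line l) f" and ae: "AE x in half_line l. f x = g x"
  shows "sq_integrable (half_line l) g"
  unfolding sq_integrable_def
proof
  show g: "g \<in> borel_measurable (half_line l)"
    using borel_measurable_half_line_cong_AE[OF _ ae] f by (simp add: sq_integrable_def)
  show "integrable (half_line l) (\<lambda>x. (cmod (g x))\<^sup>2)"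
  proof (rule Bochner_Integration.integrable_cong_AE[THEN iffD1])
    show "integrable (half_line l) (\<lambda>x. (cmod (f x))\<^sup>2)"
      "(\<lambda>x. (cmod (f x))\<^sup>2) \<in> borel_measurable (half_line l)"
      using f by (auto simp: sq_integrable_def)
    show "(\<lambda>x. (cmod (g x))\<^sup>2) \<in> borel_measurable (half_line l)"
      using g by auto
    show "AE x in half_line l. (cmod (f x))\<^sup>2 = (cmod (g x))\<^sup>2"
      using ae by (rule eventually_mono) simp
  qed
qed

lemma integral_subinterval:
  fixes f :: "real \<Rightarrow> 'b::{banach, second_countable_topology}"
  assumes "l \<le> a"
  shows "(LINT x|lebesgue_on {a..b}. f x) = (LINT x|half_line l. indicat_real {a..b} x *\<^sub>R f x)"
    "integrable (half_line l) f \<Longrightarrow> integrable (lebesgue_on {a..b}) f"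
proof -
  have eq: "indicat_real {l..} x *\<^sub>R indicat_real {a..b} x *\<^sub>R f x = indicat_real {a..b} x *\<^sub>R f x" for x
    using assms by (auto simp: indicator_def)
  show "(LINT x|lebesgue_on {a..b}. f x) = (LINT x|half_line l. indicat_real {a..b} x *\<^sub>R f x)"
    by (simp add: integral_restrict_space eq del: scaleR_scaleR)
  assume "integrable (half_line l) f"
  then have "integrable (half_line l) (\<lambda>x. indicat_real {a..b} x *\<^sub>R f x)"
    by (intro integrable_mult_indicator) (use assms in \<open>auto simp: sets_restrict_space_iff\<close>)
  then show "integrable (lebesgue_on {a..b}) f"
    by (simp add: integrable_restrict_space eq del: scaleR_scaleR)
qed

lemma sq_integrable_subinterval:
  assumes "sq_integrable (half_line l) f" "l \<le> a"
  shows "sq_integrable (lebesgue_on {a..b}) f"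
  unfolding sq_integrable_def
proof
  show "f \<in> borel_measurable (lebesgue_on {a..b})"
    by (rule measurable_restrict_mono[of f lebesgue "{l..}"])
      (use assms in \<open>auto simp: sq_integrable_def\<close>)
  show "integrable (lebesgue_on {a..b}) (\<lambda>x. (cmod (f x))\<^sup>2)"
    using assms by (intro integral_subinterval(2)[OF assms(2)]) (simp add: sq_integrable_def)
qed

lemma integral_subinterval_tendsto:
  fixes f :: "real \<Rightarrow> 'b::{banach, second_countable_topology}"
  assumes "integrable (half_line l) f"
  shows "((\<lambda>b. LINT x|lebesgue_on {l..b}. f x) \<longlongrightarrow> (LINT x|half_line l. f x)) at_top"
  using tendsto_set_lebesgue_integral_at_top[of l lebesgue f] assms
  by (simp add: set_lebesgue_integral_def integral_restrict_space set_integrable_def integrable_restrict_space)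

lemma integral_subinterval_split:
  fixes f :: "real \<Rightarrow> 'b::{banach, second_countable_topology}"
  assumes "integrable (lebesgue_on {l..b}) f" "l \<le> a" "a \<le> b"
  shows "(LINT x|lebesgue_on {l..b}. f x) = (LINT x|lebesgue_on {l..a}. f x) + (LINT x|lebesgue_on {a..b}. f x)"
proof -
  have i: "integrable lebesgue (\<lambda>x. indicat_real {l..b} x *\<^sub>R f x)"
    using assms by (simp add: integrable_restrict_space)
  have i1: "integrable lebesgue (\<lambda>x. indicat_real {l..a} x *\<^sub>R f x)"
  proof -
    have eq: "indicat_real {l..a} x *\<^sub>R indicat_real {l..b} x *\<^sub>R f x = indicat_real {l..a} x *\<^sub>R f x" for x
      using assms(2,3) by (auto simp: indicator_def)
    show ?thesis using integrable_mult_indicator[OF _ i, of "{l..a}"] unfolding eq by simp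
  qed
  have i2: "integrable lebesgue (\<lambda>x. indicat_real {a..b} x *\<^sub>R f x)"
  proof -
    have eq: "indicat_real {a..b} x *\<^sub>R indicat_real {l..b} x *\<^sub>R f x = indicat_real {a..b} x *\<^sub>R f x" for x
      using assms(2,3) by (auto simp: indicator_def)
    show ?thesis using integrable_mult_indicator[OF _ i, of "{a..b}"] unfolding eq by simp
  qed
  have "(LINT x|lebesgue. indicat_real {l..b} x *\<^sub>R f x)
      = (LINT x|lebesgue. indicat_real {l..a} x *\<^sub>R f x + indicat_real {a..b} x *\<^sub>R f x)"
  proof (rule integral_cong_AE)
    show "AE x in lebesgue. indicat_real {l..b} x *\<^sub>R f x = indicat_real {l..a} x *\<^sub>R f x + indicat_real {a..b} x *\<^sub>R f x"
    proof (rule AE_I[of _ _ "{a}"])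
      show "{x \<in> space lebesgue. \<not> indicat_real {l..b} x *\<^sub>R f x = indicat_real {l..a} x *\<^sub>R f x + indicat_real {a..b} x *\<^sub>R f x} \<subseteq> {a}"
        using assms by (auto simp: indicator_def split: if_splits)
    qed auto
  qed (use i i1 i2 in auto)
  then show ?thesis using i1 i2 by (simp add: integral_restrict_space)
qed

lemma sq_integrable_continuous:
  fixes f :: "real \<Rightarrow> complex"
  assumes "continuous_on {a..b} f"
  shows "sq_integrable (lebesgue_on {a..b}) f"
  unfolding sq_integrable_def
proof
  show "f \<in> borel_measurable (lebesgue_on {a..b})"
    by (rule continuous_imp_measurable_on_sets_lebesgue[OF assms]) simp
  have "(\<lambda>x. (cmod (f x))\<^sup>2) absolutely_integrable_on {a..b}"
    by (intro absolutely_integrable_continuous_real continuous_intros assms)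
  then show "integrable (lebesgue_on {a..b}) (\<lambda>x. (cmod (f x))\<^sup>2)"
    by (simp add: set_integrable_def integrable_restrict_space)
qed

lemma sq_integrable_compact_support:
  assumes f: "continuous_on {l..} f" and supp: "\<And>x. x > c \<Longrightarrow> f x = 0" and "l \<le> c"
    and B: "\<And>x. l \<le> x \<Longrightarrow> x \<le> c \<Longrightarrow> cmod (f x) \<le> B"
  shows "sq_integrable (half_line l) f" "(L2norm (half_line l) f)\<^sup>2 \<le> (c - l) * B\<^sup>2"
proof -
  have eq: "indicat_real {l..} x *\<^sub>R (cmod (f x))\<^sup>2 = indicat_real {l..c} x *\<^sub>R (cmod (f x))\<^sup>2" for x
    using supp[of x] by (auto simp: indicator_def)
  have sq: "sq_integrable (lebesgue_on {l..c}) f"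
    by (rule sq_integrable_continuous[OF continuous_on_subset[OF f]]) auto
  then show "sq_integrable (half_line l) f"
    using continuous_imp_measurable_on_sets_lebesgue[OF f]
    by (simp add: sq_integrable_def integrable_restrict_space eq[unfolded real_scaleR_def])
  have "(L2norm (half_line l) f)\<^sup>2 = (LINT x|lebesgue_on {l..c}. (cmod (f x))\<^sup>2)"
    by (simp add: L2norm_sq integral_restrict_space eq[unfolded real_scaleR_def])
  also have "\<dots> \<le> (LINT x|lebesgue_on {l..c}. B\<^sup>2)"
    by (rule integral_mono)
      (use sq B in \<open>auto simp: sq_integrable_def intro!: power_mono\<close>)
  also have "\<dots> = (c - l) * B\<^sup>2"
    using \<open>l \<le> c\<close> by (simp add: measure_restrict_space)
  finally show "(L2norm (half_line l) f)\<^sup>2 \<le> (c - l) * B\<^sup>2" .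
qed

lemma sigma_finite_lebesgue: "sigma_finite_measure (lebesgue :: real measure)"
proof
  show "\<exists>A. countable A \<and> A \<subseteq> sets (lebesgue :: real measure) \<and> \<Union>A = space lebesgue \<and> (\<forall>a\<in>A. emeasure lebesgue a \<noteq> \<infinity>)"
    using lborel.sigma_finite_countable by (force simp: sets_completionI_sets)
qed

text \<open>
  Half-open intervals are stable under intersection and generate the Borel sets, so the integral
  vanishes over every Borel set; a Lebesgue set differs from a Borel set by a null set.
\<close>

lemma AE_zero_if_interval_integrals_zero:
  fixes G :: "real \<Rightarrow> complex"
  assumes int: "integrable lebesgue G"
    and zero: "\<And>a b. (LINT x|lebesgue. indicat_real {a<..b} x *\<^sub>R G x) = 0"
  shows "AE x in lebesgue. G x = 0"
proof (rule sigma_finite_measure.density_zero[OF sigma_finite_lebesgue int])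
  have si: "set_integrable lebesgue A G" if "A \<in> sets lebesgue" for A
    unfolding set_integrable_def by (rule integrable_mult_indicator[OF that int])
  have tot: "(LINT x|lebesgue. G x) = 0"
  proof -
    have "(\<lambda>n. LINT x|lebesgue. indicat_real {-real n<..real n} x *\<^sub>R G x) \<longlonglongrightarrow> (LINT x|lebesgue. G x)"
    proof (rule integral_dominated_convergence)
      show "integrable lebesgue (\<lambda>x. cmod (G x))" using int by simp
      show "AE x in lebesgue. (\<lambda>n. indicat_real {-real n<..real n} x *\<^sub>R G x) \<longlonglongrightarrow> G x"
      proof (rule AE_I2)
        fix x :: real
        have "\<forall>\<^sub>F n in sequentially. indicat_real {-real n<..real n} x *\<^sub>R G x = G x"
          using eventually_gt_at_top[of "nat \<lceil>\<bar>x\<bar>\<rceil>"]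
          by eventually_elim (auto simp: indicator_def, linarith+)
        then show "(\<lambda>n. indicat_real {-real n<..real n} x *\<^sub>R G x) \<longlonglongrightarrow> G x"
          by (rule tendsto_eventually)
      qed
      show "(\<lambda>x. indicat_real {-real n<..real n} x *\<^sub>R G x) \<in> borel_measurable lebesgue" for n
        using si[of "{-real n<..real n}"] by (auto simp: set_integrable_def)
      show "AE x in lebesgue. norm (indicat_real {-real n<..real n} x *\<^sub>R G x) \<le> cmod (G x)" for n
        by (intro AE_I2) (auto simp: indicator_def)
    qed (use int in auto)
    then show ?thesis by (simp add: zero LIMSEQ_const_iff)
  qed
  have borel: "set_lebesgue_integral lebesgue A G = 0" if "A \<in> sets borel" for A
  proof -
    have "Int_stable (range (\<lambda>(a, b). {a<..b::real}))"
      by (auto simp: Int_stable_def)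
    moreover have "range (\<lambda>(a, b). {a<..b::real}) \<subseteq> Pow UNIV" by simp
    moreover have "A \<in> sigma_sets UNIV (range (\<lambda>(a, b). {a<..b::real}))"
      using that by (subst (asm) borel_sigma_sets_Ioc) auto
    ultimately show ?thesis
    proof (induction A rule: sigma_sets_induct_disjoint)
      case (basic A)
      then show ?case by (auto simp: set_lebesgue_integral_def zero)
    next
      case empty
      show ?case by (simp add: set_lebesgue_integral_def)
    next
      case (compl A)
      have A: "A \<in> sets lebesgue"
        using compl(1) by (intro sets_completionI_sets) (simp add: borel_sigma_sets_Ioc)
      have "(LINT x|lebesgue. G x) = set_lebesgue_integral lebesgue (A \<union> (UNIV - A)) G"
        by (simp add: set_lebesgue_integral_def)
      also have "\<dots> = set_lebesgue_integral lebesgue A G + set_lebesgue_integral lebesgue (UNIV - A) G"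
        by (rule set_integral_Un) (use A sets.compl_sets[OF A] in \<open>auto intro!: si\<close>)
      finally show ?case using compl(2) tot by simp
    next
      case (union A)
      have A: "A i \<in> sets lebesgue" for i
        using union(2) by (intro sets_completionI_sets) (auto simp: borel_sigma_sets_Ioc)
      have "set_lebesgue_integral lebesgue (\<Union>i. A i) G = (\<Sum>i. set_lebesgue_integral lebesgue (A i) G)"
        by (rule lebesgue_integral_countable_add)
          (use A si union(1) in \<open>auto simp: disjoint_family_on_def\<close>)
      then show ?case using union(3) by simp
    qed
  qed
  fix A :: "real set" assume A: "A \<in> sets lebesgue"
  obtain S N N' where S: "A = S \<union> N" "N \<subseteq> N'" "N' \<in> null_sets lborel" "S \<in> sets lborel"
    using sets_completionE[OF A] .
  have "set_lebesgue_integral lebesgue A G = set_lebesgue_integral lebesgue S G"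
  proof (rule set_integral_cong_set)
    show "set_borel_measurable lebesgue A G" "set_borel_measurable lebesgue S G"
      using si[OF A] si[of S] S(4) by (auto simp: set_integrable_def set_borel_measurable_def)
    have "AE x in lebesgue. x \<notin> N'"
      using S(3) by (intro AE_not_in) (simp add: null_sets_completionI)
    then show "AE x in lebesgue. (x \<in> S) = (x \<in> A)"
      by (rule eventually_mono) (use S(1,2) in auto)
  qed
  then show "set_lebesgue_integral lebesgue A G = 0"
    using borel[of S] S(4) by simp
qed

section \<open>The maximal domain\<close>

lemma DstarI:
  assumes "sl_regular l y" "sq_integrable (half_line l) y"
    and "AE x in lebesgue. x \<ge> l \<longrightarrow> sl_expr l q y x = g x" "sq_integrable (half_line l) g"
  shows "y \<in> Dstar l q"
proof -
  have "sq_integrable (half_line l) (sl_expr l q y)"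
    by (rule sq_integrable_cong_AE[OF assms(4)])
      (use assms(3) in \<open>auto simp: AE_half_line elim!: eventually_mono\<close>)
  then show ?thesis using assms by (simp add: Dstar_def L2_iff)
qed

lemma DstarD:
  assumes "y \<in> Dstar l q"
  shows "sl_regular l y" "sq_integrable (half_line l) y" "sq_integrable (half_line l) (sl_expr l q y)"
  using assms by (auto simp: Dstar_def L2_iff)

lemma Dstar_linear:
  assumes "y \<in> Dstar l q" "w \<in> Dstar l q"
  shows "(\<lambda>x. c * y x + d * w x) \<in> Dstar l q"
  by (rule DstarI[OF _ _ sl_regular_linear(3)])
    (intro sl_regular_linear sq_integrable_linear DstarD[OF assms(1)] DstarD[OF assms(2)])+

lemma Dstar_cnj:
  assumes "y \<in> Dstar l q"
  shows "(\<lambda>x. cnj (y x)) \<in> Dstar l q"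
  by (rule DstarI[OF _ _ sl_regular_cnj(3)])
    (auto intro: sl_regular_cnj DstarD[OF assms])

lemma sl_solutionD:
  assumes "sl_solution l q z y"
  shows "sl_regular l y" "AE x in lebesgue. x \<ge> l \<longrightarrow> sl_expr l q y x = z * y x"
  using assms by (auto simp: sl_solution_def)

lemma sl_solution_Dstar:
  assumes "sl_solution l q z y" "sq_integrable (half_line l) y"
  shows "y \<in> Dstar l q"
  by (rule DstarI[OF sl_solutionD(1)[OF assms(1)] assms(2) sl_solutionD(2)[OF assms(1)]])
    (intro sq_integrable_cmult assms)

lemma sl_solution_linear:
  assumes "sl_solution l q z y" "sl_solution l q z w"
  shows "sl_solution l q z (\<lambda>x. c * y x + d * w x)"
  unfolding sl_solution_def
proof
  show "AE x in lebesgue. x \<ge> l \<longrightarrow> sl_expr l q (\<lambda>x. c * y x + d * w x) x = z * (c * y x + d * w x)"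
    using sl_regular_linear(3)[OF sl_solutionD(1)[OF assms(1)] sl_solutionD(1)[OF assms(2)], of q c d]
      sl_solutionD(2)[OF assms(1)] sl_solutionD(2)[OF assms(2)]
    by eventually_elim (auto simp: algebra_simps)
qed (intro sl_regular_linear sl_solutionD[OF assms(1)] sl_solutionD[OF assms(2)])

lemma sl_solution_cnj:
  assumes "sl_solution l q z y"
  shows "sl_solution l q (cnj z) (\<lambda>x. cnj (y x))"
  unfolding sl_solution_def
proof
  show "AE x in lebesgue. x \<ge> l \<longrightarrow> sl_expr l q (\<lambda>x. cnj (y x)) x = cnj z * cnj (y x)"
    using sl_regular_cnj(3)[OF sl_solutionD(1)[OF assms(1)], of q] sl_solutionD(2)[OF assms(1)]
    by eventually_elim auto
qed (intro sl_regular_cnj sl_solutionD[OF assms(1)])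

definition Lagrange_form :: "real \<Rightarrow> (real \<Rightarrow> real) \<Rightarrow> func \<Rightarrow> func \<Rightarrow> real \<Rightarrow> complex" where
  "Lagrange_form l q y w x = sl_expr l q y x * w x - y x * sl_expr l q w x"

lemma integrable_Lagrange_form:
  assumes "y \<in> Dstar l q" "w \<in> Dstar l q"
  shows "integrable (half_line l) (Lagrange_form l q y w)"
  unfolding Lagrange_form_def[abs_def]
  by (intro Bochner_Integration.integrable_diff sq_integrable_mult DstarD[OF assms(1)] DstarD[OF assms(2)])

lemma Dstar_Lagrange:
  assumes y: "y \<in> Dstar l q" and w: "w \<in> Dstar l q" and "l \<le> a" "a \<le> b"
  shows "(LINT x|lebesgue_on {a..b}. Lagrange_form l q y w x) = wronskian l y w b - wronskian l y w a"
  unfolding Lagrange_form_def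
  by (intro Lagrange_identity DstarD[OF y] DstarD[OF w] assms(3,4)
     integral_subinterval(2)[OF assms(3)] integrable_Lagrange_form[OF y w, unfolded Lagrange_form_def[abs_def]])

lemma wronskian_tendsto:
  assumes y: "y \<in> Dstar l q" and w: "w \<in> Dstar l q"
  shows "(wronskian l y w \<longlongrightarrow> wronskian l y w l + (LINT x|half_line l. Lagrange_form l q y w x)) at_top"
proof -
  have "((\<lambda>b. wronskian l y w l + (LINT x|lebesgue_on {l..b}. Lagrange_form l q y w x))
      \<longlongrightarrow> wronskian l y w l + (LINT x|half_line l. Lagrange_form l q y w x)) at_top"
    by (intro tendsto_intros integral_subinterval_tendsto integrable_Lagrange_form y w)
  moreover have "\<forall>\<^sub>F b in at_top. wronskian l y w l + (LINT x|lebesgue_on {l..b}. Lagrange_form l q y w x) = wronskian l y w b"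
    using eventually_ge_at_top[of l] by eventually_elim (simp add: Dstar_Lagrange[OF y w])
  ultimately show ?thesis by (rule Lim_transform_eventually)
qed

section \<open>Cutting off solutions\<close>

definition pos_pow :: "nat \<Rightarrow> real \<Rightarrow> real" where
  "pos_pow n s = (max 0 s) ^ n"

lemma has_field_derivative_pos_pow [derivative_intros]:
  "(pos_pow (Suc (Suc n)) has_field_derivative real (Suc (Suc n)) * pos_pow (Suc n) s) (at s)"
proof -
  consider "s < 0" | "s = 0" | "s > 0" by linarith
  then show ?thesis
  proof cases
    case 1
    have "((\<lambda>_. 0) has_field_derivative 0) (at s)" by simp
    then have "(pos_pow (Suc (Suc n)) has_field_derivative 0) (at s)"
      by (rule DERIV_cong_ev[THEN iffD1, rotated 3])
        (use 1 eventually_nhds_in_open[of "{..<0}" s] in \<open>auto simp: pos_pow_def elim!: eventually_mono\<close>)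
    then show ?thesis using 1 by (simp add: pos_pow_def)
  next
    case 2
    have "isCont (\<lambda>t::real. max 0 t ^ Suc n) 0" by (intro continuous_intros)
    then have "(pos_pow (Suc (Suc n)) has_field_derivative 0) (at 0)"
      unfolding CARAT_DERIV
      by (intro exI[of _ "\<lambda>t. max 0 t ^ Suc n"]) (auto simp: pos_pow_def max_def)
    then show ?thesis using 2 by (simp add: pos_pow_def)
  next
    case 3
    have "((\<lambda>t. t ^ Suc (Suc n)) has_field_derivative real (Suc (Suc n)) * s ^ Suc n) (at s)"
      using DERIV_pow[of "Suc (Suc n)" s] by simp
    then have "(pos_pow (Suc (Suc n)) has_field_derivative real (Suc (Suc n)) * s ^ Suc n) (at s)"
      by (rule DERIV_cong_ev[THEN iffD1, rotated 3])
        (use 3 eventually_nhds_in_open[of "{0<..}" s] in \<open>auto simp: pos_pow_def elim!: eventually_mono\<close>)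
    then show ?thesis using 3 by (simp add: pos_pow_def)
  qed
qed

lemma continuous_on_pos_pow [continuous_intros]:
  "continuous_on A f \<Longrightarrow> continuous_on A (\<lambda>x. pos_pow n (f x))"
  unfolding pos_pow_def by (intro continuous_intros)

text \<open>
  The cube makes this bump on \<open>[a, b]\<close> twice continuously differentiable also at the ends of its
  support; \<open>hump'\<close> and \<open>hump''\<close> are its derivatives.
\<close>

definition hump :: "real \<Rightarrow> real \<Rightarrow> real \<Rightarrow> real" where
  "hump a b x = pos_pow 3 ((x - a) * (b - x))"

definition hump' :: "real \<Rightarrow> real \<Rightarrow> real \<Rightarrow> real" where
  "hump' a b x = 3 * pos_pow 2 ((x - a) * (b - x)) * (a + b - 2 * x)"

definition hump'' :: "real \<Rightarrow> real \<Rightarrow> real \<Rightarrow> real" where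
  "hump'' a b x = 6 * pos_pow 1 ((x - a) * (b - x)) * (a + b - 2 * x)\<^sup>2 - 6 * pos_pow 2 ((x - a) * (b - x))"

lemma hump_derivs:
  "(hump a b has_field_derivative hump' a b x) (at x)"
  "(hump' a b has_field_derivative hump'' a b x) (at x)"
proof -
  have p: "((\<lambda>x. (x - a) * (b - x)) has_field_derivative (a + b - 2 * x)) (at x)"
    by (auto intro!: derivative_eq_intros)
  have 3: "(pos_pow 3 has_field_derivative 3 * pos_pow 2 s) (at s)" for s
    using has_field_derivative_pos_pow[of 1 s] by (simp add: numeral_3_eq_3 numeral_2_eq_2)
  have 2: "(pos_pow 2 has_field_derivative 2 * pos_pow 1 s) (at s)" for s
    using has_field_derivative_pos_pow[of 0 s] by (simp add: numeral_2_eq_2)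
  show "(hump a b has_field_derivative hump' a b x) (at x)"
    unfolding hump_def[abs_def] hump'_def by (rule DERIV_chain2[OF 3 p])
  have q: "((\<lambda>x. pos_pow 2 ((x - a) * (b - x))) has_field_derivative
      2 * pos_pow 1 ((x - a) * (b - x)) * (a + b - 2 * x)) (at x)"
    by (rule DERIV_chain2[OF 2 p])
  show "(hump' a b has_field_derivative hump'' a b x) (at x)"
    unfolding hump'_def[abs_def] hump''_def
    by (rule derivative_eq_intros q refl)+ (simp add: algebra_simps power2_eq_square)
qed

lemma continuous_on_hump [continuous_intros]:
  "continuous_on A (hump a b)" "continuous_on A (hump' a b)" "continuous_on A (hump'' a b)"
  unfolding hump_def[abs_def] hump'_def[abs_def] hump''_def[abs_def] by (intro continuous_intros)+

lemma hump_outside: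
  assumes "a \<le> b" "x \<le> a \<or> x \<ge> b"
  shows "hump a b x = 0" "hump' a b x = 0" "hump'' a b x = 0"
proof -
  have "(x - a) * (b - x) \<le> 0"
    using assms by (auto simp: mult_le_0_iff)
  then show "hump a b x = 0" "hump' a b x = 0" "hump'' a b x = 0"
    by (auto simp: hump_def hump'_def hump''_def pos_pow_def)
qed

lemma hump_pos: "a < x \<Longrightarrow> x < b \<Longrightarrow> hump a b x > 0"
  by (simp add: hump_def pos_pow_def)

lemma hump_nonneg: "hump a b x \<ge> 0"
  by (simp add: hump_def pos_pow_def)

text \<open>
  Differentiating a product with a \<open>C\<^sup>2\<close> factor only produces terms with \<open>u\<close> and \<open>u'\<close>
  besides \<open>l(u)\<close>.  For a solution \<open>u\<close> these are continuous, so that cutting \<open>u\<close> off stays in the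
  maximal domain although \<open>q\<close> is merely locally summable, and smooth functions need not lie in it.
\<close>

lemma cutoff_Dstar:
  assumes u: "sl_solution l q z u"
    and e1: "\<And>x. (\<eta> has_field_derivative \<eta>1 x) (at x)"
    and e2: "\<And>x. (\<eta>1 has_field_derivative \<eta>2 x) (at x)"
    and c2: "continuous_on UNIV \<eta>2"
    and supp: "\<And>x. x \<ge> c \<Longrightarrow> \<eta> x = 0 \<and> \<eta>1 x = 0 \<and> \<eta>2 x = 0" and "l \<le> c"
  shows "(\<lambda>x. complex_of_real (\<eta> x) * u x) \<in> Dstar l q"
    "\<And>x. x \<ge> l \<Longrightarrow> D1 l (\<lambda>x. complex_of_real (\<eta> x) * u x) x = \<eta> x * D1 l u x + \<eta>1 x * u x"
proof -
  have cv: "((\<lambda>x. complex_of_real (f x)) has_vector_derivative complex_of_real (f' x)) (at x)"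
    if "\<And>x. (f has_field_derivative f' x) (at x)" for f f' :: "real \<Rightarrow> real" and x
    using that by (intro has_vector_derivative_of_real) (simp add: has_real_derivative_iff_has_vector_derivative)
  have c1: "continuous_on UNIV \<eta>1" "continuous_on UNIV \<eta>"
    using e1 e2 by (meson DERIV_isCont continuous_at_imp_continuous_on)+
  note r = sl_solutionD(1)[OF u]
  note * = sl_regular_mult_C2[OF r cv[OF e1] cv[OF e2] continuous_on_of_real[OF c2]]
  show "\<And>x. x \<ge> l \<Longrightarrow> D1 l (\<lambda>x. complex_of_real (\<eta> x) * u x) x = \<eta> x * D1 l u x + \<eta>1 x * u x"
    by (rule *(2))
  let ?g = "\<lambda>x. \<eta> x * (z * u x) - 2 * \<eta>1 x * D1 l u x - \<eta>2 x * u x"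
  note cu = sl_regular_continuous[OF r]
  have bd: "sq_integrable (half_line l) f" if f: "continuous_on {l..} f" and s: "\<And>x. x > c \<Longrightarrow> f x = 0" for f
  proof -
    have "bounded (f ` {l..c})"
      by (intro compact_imp_bounded compact_continuous_image continuous_on_subset[OF f]) auto
    then obtain B where "\<forall>x\<in>{l..c}. cmod (f x) \<le> B" unfolding bounded_iff by auto
    then show ?thesis
      by (intro sq_integrable_compact_support(1)[OF f s \<open>l \<le> c\<close>, of B]) auto
  qed
  show "(\<lambda>x. complex_of_real (\<eta> x) * u x) \<in> Dstar l q"
  proof (rule DstarI[where g="?g"])
    show "sl_regular l (\<lambda>x. complex_of_real (\<eta> x) * u x)" by (rule *(1))
    show "sq_integrable (half_line l) (\<lambda>x. complex_of_real (\<eta> x) * u x)"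
      by (rule bd) (auto intro!: continuous_intros cu continuous_on_subset[OF c1(2)] simp: supp)
    show "sq_integrable (half_line l) ?g"
      by (rule bd) (auto intro!: continuous_intros cu continuous_on_subset[OF c1(1)] continuous_on_subset[OF c1(2)]
        continuous_on_subset[OF c2] simp: supp)
    show "AE x in lebesgue. x \<ge> l \<longrightarrow> sl_expr l q (\<lambda>x. complex_of_real (\<eta> x) * u x) x = ?g x"
      using *(3)[of q] sl_solutionD(2)[OF u] by eventually_elim auto
  qed
qed

text \<open>
  The boundary values at \<open>l\<close> are not controlled by the \<open>L\<^sub>2\<close> norm: a solution with the prescribed
  values is cut off very close to \<open>l\<close>.
\<close>

lemma small_with_boundary_values:
  assumes u: "sl_solution l q z u" and "\<delta> > 0"
  obtains w where "w \<in> Dstar l q" "w l = u l" "D1 l w l = D1 l u l" "L2norm (half_line l) w \<le> \<delta>"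
proof -
  note cu = sl_regular_continuous(1)[OF sl_solutionD(1)[OF u]]
  have "bounded (u ` {l..l+1})"
    by (intro compact_imp_bounded compact_continuous_image continuous_on_subset[OF cu]) auto
  then obtain B' where B': "\<forall>x\<in>{l..l+1}. cmod (u x) \<le> B'" unfolding bounded_iff by auto
  define B where "B = \<bar>B'\<bar> + 1"
  have B: "cmod (u x) \<le> B" if "l \<le> x" "x \<le> l + 1" for x
    using B' that by (force simp: B_def)
  have "B > 0" by (simp add: B_def)
  define \<epsilon> where "\<epsilon> = min 1 (\<delta>\<^sup>2 / B\<^sup>2)"
  have \<epsilon>: "\<epsilon> > 0" "\<epsilon> \<le> 1" "\<epsilon> * B\<^sup>2 \<le> \<delta>\<^sup>2"
    using \<open>\<delta> > 0\<close> \<open>B > 0\<close> by (auto simp: \<epsilon>_def min_def field_simps)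
  \<comment> \<open>The bump is centred at \<open>l\<close>, where it has its maximum \<open>\<epsilon> ^ 6\<close>; hence \<open>\<eta> l = 1\<close> and the derivative vanishes at \<open>l\<close>.\<close>
  define \<eta> \<eta>1 \<eta>2 where "\<eta> x = hump (l - \<epsilon>) (l + \<epsilon>) x / \<epsilon> ^ 6" and "\<eta>1 x = hump' (l - \<epsilon>) (l + \<epsilon>) x / \<epsilon> ^ 6"
    and "\<eta>2 x = hump'' (l - \<epsilon>) (l + \<epsilon>) x / \<epsilon> ^ 6" for x
  have d: "(\<eta> has_field_derivative \<eta>1 x) (at x)" "(\<eta>1 has_field_derivative \<eta>2 x) (at x)" for x
    unfolding \<eta>_def[abs_def] \<eta>1_def[abs_def] \<eta>2_def by (intro DERIV_cdivide hump_derivs)+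
  have c: "continuous_on UNIV \<eta>2" "continuous_on UNIV \<eta>"
    unfolding \<eta>2_def[abs_def] \<eta>_def[abs_def] by (intro continuous_intros; use \<epsilon> in auto)+
  have s: "\<eta> x = 0 \<and> \<eta>1 x = 0 \<and> \<eta>2 x = 0" if "x \<ge> l + \<epsilon>" for x
    using hump_outside[of "l - \<epsilon>" "l + \<epsilon>" x] that \<epsilon>(1) by (simp add: \<eta>_def \<eta>1_def \<eta>2_def)
  have at_l: "\<eta> l = 1" "\<eta>1 l = 0"
    using \<epsilon>(1) by (auto simp: \<eta>_def \<eta>1_def hump_def hump'_def pos_pow_def power_mult_distrib[symmetric] max_def
        power2_eq_square[symmetric] power_mult[symmetric])
  have le1: "\<bar>\<eta> x\<bar> \<le> 1" for x
  proof -
    have "(x - (l - \<epsilon>)) * (l + \<epsilon> - x) = \<epsilon>\<^sup>2 - (x - l)\<^sup>2"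
      by (simp add: power2_eq_square algebra_simps)
    then have "max 0 ((x - (l - \<epsilon>)) * (l + \<epsilon> - x)) \<le> \<epsilon>\<^sup>2" by simp
    then have "pos_pow 3 ((x - (l - \<epsilon>)) * (l + \<epsilon> - x)) \<le> (\<epsilon>\<^sup>2) ^ 3"
      unfolding pos_pow_def by (rule power_mono) simp
    then show ?thesis
      using \<epsilon>(1) hump_nonneg by (simp add: \<eta>_def hump_def power_mult[symmetric] pos_pow_def)
  qed
  have "l \<le> l + \<epsilon>" using \<epsilon>(1) by simp
  note * = cutoff_Dstar[OF u d c(1) s \<open>l \<le> l + \<epsilon>\<close>]
  let ?w = "\<lambda>x. complex_of_real (\<eta> x) * u x"
  have "(L2norm (half_line l) ?w)\<^sup>2 \<le> (l + \<epsilon> - l) * B\<^sup>2"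
  proof (rule sq_integrable_compact_support(2))
    show "continuous_on {l..} ?w"
      by (intro continuous_intros cu continuous_on_subset[OF c(2)]) auto
    show "cmod (?w x) \<le> B" if "l \<le> x" "x \<le> l + \<epsilon>" for x
    proof -
      have "cmod (?w x) = \<bar>\<eta> x\<bar> * cmod (u x)" by (simp add: norm_mult)
      also have "\<dots> \<le> 1 * B"
        using le1 B[of x] that \<epsilon>(2) by (intro mult_mono) auto
      finally show ?thesis by simp
    qed
  qed (use s \<epsilon>(1) in auto)
  also have "\<dots> \<le> \<delta>\<^sup>2" using \<epsilon>(3) by simp
  finally have "L2norm (half_line l) ?w \<le> \<delta>"
    using \<open>\<delta> > 0\<close> by (simp add: power2_le_iff_abs_le)
  then show thesis
    by (intro that[of ?w]) (use * at_l in auto)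
qed

section \<open>Functions orthogonal to the minimal domain\<close>

definition minimal_domain :: "real \<Rightarrow> (real \<Rightarrow> real) \<Rightarrow> (real \<Rightarrow> complex) set" where
  "minimal_domain l q = {w \<in> Dstar l q. w l = 0 \<and> D1 l w l = 0}"

text \<open>
  As \<open>n\<close> grows, \<open>1 - exp (- n P)\<close> with a bump \<open>P\<close> on \<open>[a, b]\<close> increases to the indicator of the open
  interval, and it stays a \<open>C\<^sup>2\<close> bump.  By dominated convergence \<open>g\<close> has integral zero over every
  interval.
\<close>

lemma fundamental_lemma_bumps:
  assumes int: "\<And>b. b \<ge> l \<Longrightarrow> integrable (lebesgue_on {l..b}) g"
    and zero: "\<And>a b n. l \<le> a \<Longrightarrow> a < b \<Longrightarrow>
        (LINT x|half_line l. complex_of_real (1 - exp (- real n * hump a b x)) * g x) = 0"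
  shows "AE x in half_line l. g x = 0"
proof -
  have zero': "(LINT x|lebesgue. indicat_real {a<..<b} x *\<^sub>R g x) = 0" if "l \<le> a" "a < b" for a b
  proof -
    have i: "integrable lebesgue (\<lambda>x. indicat_real {l..b} x *\<^sub>R g x)"
      using int[of b] that by (simp add: integrable_restrict_space)
    let ?f = "\<lambda>n x. (1 - exp (- real n * hump a b x)) *\<^sub>R (indicat_real {l..b} x *\<^sub>R g x)"
    have eq: "?f n x = indicat_real {l..} x *\<^sub>R (complex_of_real (1 - exp (- real n * hump a b x)) * g x)" for n x
      using hump_outside(1)[of a b x] that by (auto simp: indicator_def scaleR_conv_of_real)
    have f: "?f n \<in> borel_measurable lebesgue" for n
    proof (rule borel_measurable_scaleR)
      show "(\<lambda>x. indicat_real {l..b} x *\<^sub>R g x) \<in> borel_measurable lebesgue" using i by auto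
      have "continuous_on UNIV (\<lambda>x. 1 - exp (- real n * hump a b x))"
        by (intro continuous_intros)
      then show "(\<lambda>x. 1 - exp (- real n * hump a b x)) \<in> borel_measurable lebesgue"
        by (intro measurable_completion) (auto dest: borel_measurable_continuous_onI)
    qed
    have "(\<lambda>n. LINT x|lebesgue. ?f n x) \<longlonglongrightarrow> (LINT x|lebesgue. indicat_real {a<..<b} x *\<^sub>R g x)"
    proof (rule integral_dominated_convergence)
      show "integrable lebesgue (\<lambda>x. norm (indicat_real {l..b} x *\<^sub>R g x))" using i by (rule integrable_norm)
      show "(\<lambda>x. indicat_real {a<..<b} x *\<^sub>R g x) \<in> borel_measurable lebesgue"
      proof -
        have eq: "indicat_real {a<..<b} x *\<^sub>R (indicat_real {l..b} x *\<^sub>R g x) = indicat_real {a<..<b} x *\<^sub>R g x" for x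
          using that by (auto simp: indicator_def)
        show ?thesis
          using integrable_mult_indicator[OF _ i, of "{a<..<b}"] unfolding eq by auto
      qed
      show "AE x in lebesgue. (\<lambda>n. ?f n x) \<longlonglongrightarrow> indicat_real {a<..<b} x *\<^sub>R g x"
      proof (rule AE_I2)
        fix x :: real
        show "(\<lambda>n. ?f n x) \<longlonglongrightarrow> indicat_real {a<..<b} x *\<^sub>R g x"
        proof (cases "x \<in> {a<..<b}")
          case True
          then have h: "hump a b x > 0" by (auto intro: hump_pos)
          have "(\<lambda>n. exp (- real n * hump a b x)) \<longlonglongrightarrow> 0"
          proof -
            have "filterlim (\<lambda>n. - (hump a b x * real n)) at_bot sequentially"
              unfolding filterlim_uminus_at_bot[symmetric]
              by (auto intro!: filterlim_tendsto_pos_mult_at_top[OF tendsto_const h] filterlim_real_sequentially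
                simp: filterlim_uminus_at_bot)
            then show ?thesis
              using filterlim_compose[OF exp_at_bot] by (simp add: mult.commute)
          qed
          then have "(\<lambda>n. ?f n x) \<longlonglongrightarrow> (1 - 0) *\<^sub>R (indicat_real {l..b} x *\<^sub>R g x)"
            by (intro tendsto_intros)
          then show ?thesis using True that by (simp add: indicator_def)
        next
          case False
          then show ?thesis using hump_outside(1)[of a b x] that by (auto simp: indicator_def)
        qed
      qed
      show "AE x in lebesgue. norm (?f n x) \<le> norm (indicat_real {l..b} x *\<^sub>R g x)" for n
      proof (rule AE_I2)
        fix x
        have "\<bar>1 - exp (- real n * hump a b x)\<bar> \<le> 1"
        proof -
          have "0 \<le> real n * hump a b x" using hump_nonneg[of a b x] by simp
          then show ?thesis by (simp add: abs_if)
        qed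
        then show "norm (?f n x) \<le> norm (indicat_real {l..b} x *\<^sub>R g x)"
          unfolding norm_scaleR by (intro mult_left_le_one_le) auto
      qed
    qed (rule f)
    moreover have "(LINT x|lebesgue. ?f n x) = 0" for n
      unfolding eq using zero[OF that, of n] by (simp add: integral_restrict_space)
    ultimately show ?thesis by (simp add: LIMSEQ_const_iff)
  qed
  have "AE x in lebesgue. indicat_real {l..c} x *\<^sub>R g x = 0" if "c \<ge> l" for c
  proof (rule AE_zero_if_interval_integrals_zero)
    show i: "integrable lebesgue (\<lambda>x. indicat_real {l..c} x *\<^sub>R g x)"
      using int[of c] that by (simp add: integrable_restrict_space)
    fix a b :: real
    define a' b' where "a' = max a l" and "b' = min b c"
    have "(LINT x|lebesgue. indicat_real {a<..b} x *\<^sub>R indicat_real {l..c} x *\<^sub>R g x)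
        = (LINT x|lebesgue. indicat_real {a'<..<b'} x *\<^sub>R indicat_real {l..c} x *\<^sub>R g x)"
    proof (rule integral_cong_AE)
      show "(\<lambda>x. indicat_real {a<..b} x *\<^sub>R indicat_real {l..c} x *\<^sub>R g x) \<in> borel_measurable lebesgue"
        using integrable_mult_indicator[OF _ i, of "{a<..b}"] by (auto simp del: scaleR_scaleR)
      show "(\<lambda>x. indicat_real {a'<..<b'} x *\<^sub>R indicat_real {l..c} x *\<^sub>R g x) \<in> borel_measurable lebesgue"
        using integrable_mult_indicator[OF _ i, of "{a'<..<b'}"] by (auto simp del: scaleR_scaleR)
      show "AE x in lebesgue. indicat_real {a<..b} x *\<^sub>R indicat_real {l..c} x *\<^sub>R g x
          = indicat_real {a'<..<b'} x *\<^sub>R indicat_real {l..c} x *\<^sub>R g x"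
      proof (rule AE_I[of _ _ "{a', b', l}"])
        show "emeasure lebesgue {a', b', l} = 0"
          using negligible_iff_emeasure0[of "{a', b', l}"] by (simp add: negligible_finite)
      qed (auto simp: indicator_def a'_def b'_def split: if_splits)
    qed
    also have "\<dots> = (LINT x|lebesgue. indicat_real {a'<..<b'} x *\<^sub>R g x)"
      by (rule Bochner_Integration.integral_cong) (auto simp: indicator_def a'_def b'_def)
    also have "\<dots> = 0"
    proof (cases "a' < b'")
      case True
      then show ?thesis by (intro zero') (auto simp: a'_def)
    qed auto
    finally show "(LINT x|lebesgue. indicat_real {a<..b} x *\<^sub>R indicat_real {l..c} x *\<^sub>R g x) = 0" .
  qed
  then have "AE x in lebesgue. \<forall>n. indicat_real {l..l + real n} x *\<^sub>R g x = 0"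
    unfolding AE_all_countable by simp
  then show ?thesis
    unfolding AE_half_line
  proof (rule eventually_mono, intro impI)
    fix x assume *: "\<forall>n. indicat_real {l..l + real n} x *\<^sub>R g x = 0" and x: "x \<ge> l"
    obtain n :: nat where "x - l \<le> real n" using real_arch_simple by blast
    then show "g x = 0" using *[rule_format, of n] x by (simp add: indicator_def)
  qed
qed

text \<open>
  The minimal domain contains \<open>\<eta> u\<close> for every solution \<open>u\<close> and every bump \<open>\<eta>\<close>; this forces
  \<open>f \<cdot> cnj u = 0\<close>, and two linearly independent solutions have no common zero.
\<close>

lemma orthogonal_minimal_domain:
  assumes f: "sq_integrable (half_line l) f"
    and u1: "sl_solution l q z u1" and u2: "sl_solution l q z u2"
    and indep: "\<And>x. x \<ge> l \<Longrightarrow> u1 x \<noteq> 0 \<or> u2 x \<noteq> 0"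
    and orth: "\<And>w. w \<in> minimal_domain l q \<Longrightarrow> inner_L2 l f w = 0"
  shows "AE x in half_line l. f x = 0"
proof -
  have ae: "AE x in half_line l. f x * cnj (u x) = 0" if u: "sl_solution l q z u" for u
  proof (rule fundamental_lemma_bumps)
    note cu = sl_regular_continuous(1)[OF sl_solutionD(1)[OF u]]
    show "integrable (lebesgue_on {l..b}) (\<lambda>x. f x * cnj (u x))" if "b \<ge> l" for b
      by (intro sq_integrable_mult sq_integrable_subinterval[OF f] sq_integrable_continuous
          continuous_intros continuous_on_subset[OF cu]) auto
    fix a b :: real and n :: nat assume ab: "l \<le> a" "a < b"
    define N where "N = real n"
    define \<eta> where "\<eta> x = 1 - exp (- N * hump a b x)" for x
    define \<eta>1 where "\<eta>1 x = N * hump' a b x * exp (- N * hump a b x)" for x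
    define \<eta>2 where "\<eta>2 x = (N * hump'' a b x - (N * hump' a b x)\<^sup>2) * exp (- N * hump a b x)" for x
    have d1: "(\<eta> has_field_derivative \<eta>1 x) (at x)" for x
      unfolding \<eta>_def[abs_def] \<eta>1_def
      by (rule derivative_eq_intros hump_derivs refl)+ simp
    have d2: "(\<eta>1 has_field_derivative \<eta>2 x) (at x)" for x
      unfolding \<eta>1_def[abs_def] \<eta>2_def
      by (rule derivative_eq_intros hump_derivs refl)+ (simp add: algebra_simps power2_eq_square)
    have c2: "continuous_on UNIV \<eta>2"
      unfolding \<eta>2_def[abs_def] by (intro continuous_intros)
    have out: "\<eta> x = 0 \<and> \<eta>1 x = 0 \<and> \<eta>2 x = 0" if "x \<ge> b \<or> x \<le> a" for x
      using hump_outside[of a b x] that ab by (auto simp: \<eta>_def \<eta>1_def \<eta>2_def)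
    have "l \<le> b" using ab by simp
    note * = cutoff_Dstar[OF u d1 d2 c2 out \<open>l \<le> b\<close>, simplified]
    have "(\<lambda>x. complex_of_real (\<eta> x) * u x) \<in> minimal_domain l q"
      unfolding minimal_domain_def using * out[of l] ab by simp
    from orth[OF this]
    show "(LINT x|half_line l. complex_of_real (1 - exp (- real n * hump a b x)) * (f x * cnj (u x))) = 0"
      by (simp add: inner_L2_eq \<eta>_def N_def mult.commute mult.left_commute mult.assoc)
  qed
  have "AE x in half_line l. x \<in> {l..}"
    by (simp add: AE_half_line)
  with ae[OF u1] ae[OF u2] show ?thesis
    by eventually_elim (use indep in auto)
qed

section \<open>From bounded intervals to the half-line\<close>

lemma AE_lebesgue_on_subinterval:
  fixes l a b :: real
  assumes "AE x in lebesgue. x \<ge> l \<longrightarrow> P x" "l \<le> a"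
  shows "AE x in lebesgue_on {a..b}. P x"
proof -
  have "AE x in lebesgue. x \<in> {a..b} \<longrightarrow> P x"
    using assms(1) by (rule eventually_mono) (use assms(2) in auto)
  then show ?thesis by (subst AE_restrict_space_iff) auto
qed

text \<open>
  In applications \<open>l(y)\<close> is known only almost everywhere, for instance \<open>l(y) = z y\<close> for a solution.
\<close>

lemma Lagrange_identity_AE:
  assumes y: "sl_regular l y" and w: "sl_regular l w" and "l \<le> a" "a \<le> b"
    and gy: "AE x in lebesgue. x \<ge> l \<longrightarrow> sl_expr l q y x = gy x"
    and gw: "AE x in lebesgue. x \<ge> l \<longrightarrow> sl_expr l q w x = gw x"
    and int: "integrable (lebesgue_on {a..b}) (\<lambda>x. gy x * w x - y x * gw x)"
  shows "(LINT x|lebesgue_on {a..b}. gy x * w x - y x * gw x) = wronskian l y w b - wronskian l y w a"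
proof -
  obtain N where N: "N \<in> null_sets lebesgue" "\<forall>x. x \<notin> N \<longrightarrow> x \<ge> l \<longrightarrow> sl_expr l q y x = gy x \<and> sl_expr l q w x = gw x"
  proof -
    have "AE x in lebesgue. x \<ge> l \<longrightarrow> sl_expr l q y x = gy x \<and> sl_expr l q w x = gw x"
      using gy gw by eventually_elim auto
    then show thesis by (elim AE_E3) (rule that, auto)
  qed
  have "((\<lambda>x. gy x * w x - y x * gw x) has_integral (wronskian l y w b - wronskian l y w a)) {a..b}"
  proof (rule has_integral_spike[OF _ _ Lagrange_identity_has_integral[OF y w assms(3,4), of q]])
    show "negligible N" using N(1) by (simp add: negligible_iff_null_sets)
    show "gy x * w x - y x * gw x = sl_expr l q y x * w x - y x * sl_expr l q w x" if "x \<in> {a..b} - N" for x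
      using N(2) that assms(3) by simp
  qed
  moreover have "((\<lambda>x. gy x * w x - y x * gw x) has_integral
      (LINT x|lebesgue_on {a..b}. gy x * w x - y x * gw x)) {a..b}"
    by (rule has_integral_integral_lebesgue_on[OF int]) auto
  ultimately show ?thesis using has_integral_unique by blast
qed

lemma solution_sq_integrable:
  assumes "sl_solution l q z y" "l \<le> a"
  shows "sq_integrable (lebesgue_on {a..b}) y"
  by (rule sq_integrable_continuous[OF continuous_on_subset[OF sl_regular_continuous(1)[OF sl_solutionD(1)[OF assms(1)]]]])
    (use assms in auto)

lemma solution_wronskian:
  assumes y: "sl_solution l q z y" and w: "sl_solution l q z' w" and "l \<le> a" "a \<le> b"
  shows "wronskian l y w b = wronskian l y w a + (z - z') * (LINT x|lebesgue_on {a..b}. y x * w x)"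
proof -
  have int: "integrable (lebesgue_on {a..b}) (\<lambda>x. y x * w x)"
    using solution_sq_integrable[OF y assms(3)] solution_sq_integrable[OF w assms(3)]
    by (rule sq_integrable_mult)
  have eq: "z * y x * w x - y x * (z' * w x) = (z - z') * (y x * w x)" for x
    by (simp add: algebra_simps)
  have "(LINT x|lebesgue_on {a..b}. z * y x * w x - y x * (z' * w x)) = wronskian l y w b - wronskian l y w a"
    by (rule Lagrange_identity_AE[OF sl_solutionD(1)[OF y] sl_solutionD(1)[OF w] assms(3,4) sl_solutionD(2)[OF y] sl_solutionD(2)[OF w]])
      (unfold eq, use int in auto)
  then show ?thesis unfolding eq by simp
qed

lemma D1_zero:
  assumes "\<And>x. x \<ge> l \<Longrightarrow> x \<le> b \<Longrightarrow> y x = 0" "l < b"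
  shows "D1 l y l = 0"
proof (rule D1_eqI)
  have "((\<lambda>_. 0) has_vector_derivative 0) (at l within {l..})" by simp
  then show "(y has_vector_derivative 0) (at l within {l..})"
    by (rule has_vector_derivative_transform_within[where d="b - l"])
      (use assms in \<open>auto simp: dist_real_def\<close>)
qed simp

lemma L2_zero_imp_zero:
  fixes f :: "real \<Rightarrow> complex"
  assumes "continuous_on {a..b} f" "a < b" "(LINT x|lebesgue_on {a..b}. (cmod (f x))\<^sup>2) = 0" "x \<in> {a..b}"
  shows "f x = 0"
proof -
  have c: "continuous_on {a..b} (\<lambda>x. (cmod (f x))\<^sup>2)" by (intro continuous_intros assms)
  have "integrable (lebesgue_on {a..b}) (\<lambda>x. (cmod (f x))\<^sup>2)"
    using sq_integrable_continuous[OF assms(1)] by (simp add: sq_integrable_def)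
  then have "((\<lambda>x. (cmod (f x))\<^sup>2) has_integral 0) {a..b}"
    using has_integral_integral_lebesgue_on[of "{a..b}" "\<lambda>x. (cmod (f x))\<^sup>2"] assms(3) by auto
  then have "integral {a..b} (\<lambda>x. (cmod (f x))\<^sup>2) = 0" by blast
  then have "\<forall>x\<in>{a..b}. (cmod (f x))\<^sup>2 = 0"
    using integral_eq_0_iff[OF c assms(2)] by auto
  then show ?thesis using assms(4) by auto
qed

lemma continuous_AE_zero:
  fixes f :: "real \<Rightarrow> complex"
  assumes "continuous_on {l..} f" "AE x in half_line l. f x = 0" "l \<le> x"
  shows "f x = 0"
proof -
  have "AE t in lebesgue_on {l..x + 1}. f t = 0"
    using assms(2) by (intro AE_lebesgue_on_subinterval[of l]) (simp_all add: AE_half_line)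
  then have "(LINT t|lebesgue_on {l..x + 1}. (cmod (f t))\<^sup>2) = 0"
    by (intro integral_eq_zero_AE) (auto elim!: eventually_mono)
  then show ?thesis
    using L2_zero_imp_zero[of l "x + 1" f x] assms(1,3) continuous_on_subset[of "{l..}" f "{l..x+1}"] by auto
qed

lemma L2norm_subinterval_le:
  assumes "sq_integrable (half_line l) f" "l \<le> a"
  shows "L2norm (lebesgue_on {a..b}) f \<le> L2norm (half_line l) f"
proof -
  have i: "integrable (half_line l) (\<lambda>x. (cmod (f x))\<^sup>2)"
    using assms by (simp add: sq_integrable_def)
  have "(LINT x|lebesgue_on {a..b}. (cmod (f x))\<^sup>2) \<le> (LINT x|half_line l. (cmod (f x))\<^sup>2)"
    unfolding integral_subinterval(1)[OF assms(2)]
    by (intro integral_mono integrable_mult_indicator i)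
      (use assms in \<open>auto simp: sets_restrict_space_iff indicator_def\<close>)
  then show ?thesis by (simp add: L2norm_def)
qed

lemma L2norm_interval_mono:
  fixes f :: "real \<Rightarrow> complex"
  assumes "sq_integrable (lebesgue_on {l..b}) f" "l \<le> a" "a \<le> b"
  shows "L2norm (lebesgue_on {l..a}) f \<le> L2norm (lebesgue_on {l..b}) f"
    "L2norm (lebesgue_on {a..b}) f \<le> L2norm (lebesgue_on {l..b}) f"
proof -
  have "(LINT x|lebesgue_on {l..b}. (cmod (f x))\<^sup>2)
      = (LINT x|lebesgue_on {l..a}. (cmod (f x))\<^sup>2) + (LINT x|lebesgue_on {a..b}. (cmod (f x))\<^sup>2)"
    by (rule integral_subinterval_split) (use assms in \<open>simp_all add: sq_integrable_def\<close>)
  then show "L2norm (lebesgue_on {l..a}) f \<le> L2norm (lebesgue_on {l..b}) f"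
    "L2norm (lebesgue_on {a..b}) f \<le> L2norm (lebesgue_on {l..b}) f"
    by (simp_all add: L2norm_def)
qed

lemma half_line_split:
  fixes f :: "real \<Rightarrow> 'b::{banach, second_countable_topology}"
  assumes "integrable (half_line l) f" "l \<le> a"
  shows "integrable (half_line a) f"
    "(LINT x|half_line l. f x) = (LINT x|lebesgue_on {l..a}. f x) + (LINT x|half_line a. f x)"
proof -
  have i: "integrable lebesgue (\<lambda>x. indicat_real {l..} x *\<^sub>R f x)"
    using assms by (simp add: integrable_restrict_space)
  have eq: "indicat_real {a..} x *\<^sub>R (indicat_real {l..} x *\<^sub>R f x) = indicat_real {a..} x *\<^sub>R f x" for x
    using assms(2) by (auto simp: indicator_def)
  show ia: "integrable (half_line a) f"
    using integrable_mult_indicator[OF _ i, of "{a..}"] unfolding eq by (simp add: integrable_restrict_space)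
  have "((\<lambda>b. (LINT x|lebesgue_on {l..a}. f x) + (LINT x|lebesgue_on {a..b}. f x))
      \<longlongrightarrow> (LINT x|lebesgue_on {l..a}. f x) + (LINT x|half_line a. f x)) at_top"
    by (intro tendsto_intros integral_subinterval_tendsto ia)
  moreover have "\<forall>\<^sub>F b in at_top. (LINT x|lebesgue_on {l..a}. f x) + (LINT x|lebesgue_on {a..b}. f x) = (LINT x|lebesgue_on {l..b}. f x)"
    using eventually_ge_at_top[of a]
    by eventually_elim
      (rule integral_subinterval_split[OF integral_subinterval(2)[OF order_refl assms(1)] assms(2), symmetric])
  ultimately have "((\<lambda>b. LINT x|lebesgue_on {l..b}. f x) \<longlongrightarrow> (LINT x|lebesgue_on {l..a}. f x) + (LINT x|half_line a. f x)) at_top"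
    by (rule Lim_transform_eventually)
  then show "(LINT x|half_line l. f x) = (LINT x|lebesgue_on {l..a}. f x) + (LINT x|half_line a. f x)"
    using integral_subinterval_tendsto[OF assms(1)] tendsto_unique trivial_limit_at_top_linorder by blast
qed

lemma sq_integrable_half_line:
  assumes "sq_integrable (half_line l) f" "l \<le> a"
  shows "sq_integrable (half_line a) f"
  unfolding sq_integrable_def
proof
  show "f \<in> borel_measurable (half_line a)"
    by (rule measurable_restrict_mono[of f lebesgue "{l..}"])
      (use assms in \<open>auto simp: sq_integrable_def\<close>)
  show "integrable (half_line a) (\<lambda>x. (cmod (f x))\<^sup>2)"
    by (rule half_line_split(1)[of l]) (use assms in \<open>auto simp: sq_integrable_def\<close>)
qed

lemma L2norm_tail_tendsto_0:
  assumes "sq_integrable (half_line l) f"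
  shows "((\<lambda>a. L2norm (half_line a) f) \<longlongrightarrow> 0) at_top"
proof -
  have i: "integrable (half_line l) (\<lambda>x. (cmod (f x))\<^sup>2)" using assms by (simp add: sq_integrable_def)
  let ?I = "LINT x|half_line l. (cmod (f x))\<^sup>2"
  have "((\<lambda>a. sqrt (?I - (LINT x|lebesgue_on {l..a}. (cmod (f x))\<^sup>2))) \<longlongrightarrow> sqrt (?I - ?I)) at_top"
    by (intro tendsto_intros integral_subinterval_tendsto i)
  moreover have "\<forall>\<^sub>F a in at_top. sqrt (?I - (LINT x|lebesgue_on {l..a}. (cmod (f x))\<^sup>2)) = L2norm (half_line a) f"
    using eventually_ge_at_top[of l] by eventually_elim (simp add: L2norm_def half_line_split(2)[OF i])
  ultimately show ?thesis by (auto intro: Lim_transform_eventually)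
qed

text \<open>Monotone convergence along the intervals \<open>[l, l + n]\<close>.\<close>

lemma sq_integrable_if_bounded:
  assumes f: "continuous_on {l..} f"
    and C: "\<And>b. b \<ge> l \<Longrightarrow> (LINT x|lebesgue_on {l..b}. (cmod (f x))\<^sup>2) \<le> C"
  shows "sq_integrable (half_line l) f"
  unfolding sq_integrable_def
proof
  show m: "f \<in> borel_measurable (half_line l)"
    by (rule continuous_imp_measurable_on_sets_lebesgue[OF f]) simp
  let ?F = "\<lambda>n::nat. \<lambda>x. indicat_real {l..l + real n} x *\<^sub>R (cmod (f x))\<^sup>2"
  let ?J = "\<lambda>n::nat. LINT x|lebesgue_on {l..l + real n}. (cmod (f x))\<^sup>2"
  have sq: "sq_integrable (lebesgue_on {l..b}) f" for b
    by (rule sq_integrable_continuous[OF continuous_on_subset[OF f]]) auto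
  have "mono ?J"
  proof (rule monoI)
    fix n k :: nat assume "n \<le> k"
    have "L2norm (lebesgue_on {l..l + real n}) f \<le> L2norm (lebesgue_on {l..l + real k}) f"
      by (rule L2norm_interval_mono(1)[OF sq]) (use \<open>n \<le> k\<close> in auto)
    then show "?J n \<le> ?J k" by (simp add: L2norm_def)
  qed
  then obtain J where J: "?J \<longlonglongrightarrow> J"
    by (rule incseq_convergent[of ?J C]) (use C in auto)
  show "integrable (half_line l) (\<lambda>x. (cmod (f x))\<^sup>2)"
  proof (rule integrable_monotone_convergence[where f="?F"])
    have eq: "indicat_real {l..} x *\<^sub>R ?F n x = indicat_real {l..l + real n} x *\<^sub>R (cmod (f x))\<^sup>2" for n x
      by (auto simp: indicator_def)
    show "integrable (half_line l) (?F n)" for n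
      using sq[of "l + real n"] by (simp add: integrable_restrict_space sq_integrable_def eq del: real_scaleR_def scaleR_scaleR)
    show "AE x in half_line l. mono (\<lambda>n. ?F n x)"
      by (intro AE_I2 monoI) (auto simp: indicator_def)
    show "AE x in half_line l. (\<lambda>n. ?F n x) \<longlonglongrightarrow> (cmod (f x))\<^sup>2"
    proof (rule AE_I2)
      fix x assume "x \<in> space (half_line l)"
      then have "?F n x = (cmod (f x))\<^sup>2" if "n \<ge> nat \<lceil>x - l\<rceil>" for n
        using that by (auto simp: indicator_def)
      then have "\<forall>\<^sub>F n in sequentially. ?F n x = (cmod (f x))\<^sup>2"
        using eventually_ge_at_top[of "nat \<lceil>x - l\<rceil>"] by (rule eventually_mono[rotated])
      then show "(\<lambda>n. ?F n x) \<longlonglongrightarrow> (cmod (f x))\<^sup>2" by (rule tendsto_eventually)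
    qed
    show "(\<lambda>n. LINT x|half_line l. ?F n x) \<longlonglongrightarrow> J"
      using J by (simp only: integral_subinterval(1)[OF order_refl])
    show "(\<lambda>x. (cmod (f x))\<^sup>2) \<in> borel_measurable (half_line l)" using m by simp
  qed
qed

lemma integral_quadratic:
  assumes g: "sq_integrable M g" and h: "sq_integrable M h"
  shows "(LINT x|M. (cmod (g x + c * h x))\<^sup>2) = (LINT x|M. (cmod (g x))\<^sup>2)
      + 2 * Re (cnj c * (LINT x|M. g x * cnj (h x))) + (cmod c)\<^sup>2 * (LINT x|M. (cmod (h x))\<^sup>2)"
proof -
  have i: "integrable M (\<lambda>x. g x * cnj (h x))" using g h by (intro sq_integrable_mult) auto
  have i1: "integrable M (\<lambda>x. (cmod (g x))\<^sup>2)" "integrable M (\<lambda>x. (cmod (h x))\<^sup>2)"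
    using g h by (auto simp: sq_integrable_def)
  have i2: "integrable M (\<lambda>x. Re (cnj c * (g x * cnj (h x))))"
    by (intro integrable_Re Bochner_Integration.integrable_mult_right i)
  have "(cmod (g x + c * h x))\<^sup>2 = (cmod (g x))\<^sup>2 + 2 * Re (cnj c * (g x * cnj (h x))) + (cmod c)\<^sup>2 * (cmod (h x))\<^sup>2" for x
    unfolding cmod_power2 by (simp add: power2_eq_square algebra_simps)
  then have "(LINT x|M. (cmod (g x + c * h x))\<^sup>2) = (LINT x|M. (cmod (g x))\<^sup>2 + 2 * Re (cnj c * (g x * cnj (h x))) + (cmod c)\<^sup>2 * (cmod (h x))\<^sup>2)"
    by simp
  also have "\<dots> = (LINT x|M. (cmod (g x))\<^sup>2)
      + 2 * (LINT x|M. Re (cnj c * (g x * cnj (h x)))) + (cmod c)\<^sup>2 * (LINT x|M. (cmod (h x))\<^sup>2)"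
    using i1 i2 by (simp del: complex_cnj_cnj times_complex.sel cnj.sel)
  also have "(LINT x|M. Re (cnj c * (g x * cnj (h x)))) = Re (cnj c * (LINT x|M. g x * cnj (h x)))"
    using i by (simp only: integral_Re[OF Bochner_Integration.integrable_mult_right[OF i]] Bochner_Integration.integral_mult_right_zero)
  finally show ?thesis .
qed

lemma wronskian_linear:
  assumes "sl_regular l y" "sl_regular l v" "l \<le> x"
  shows "wronskian l (\<lambda>x. c * y x + d * v x) w x = c * wronskian l y w x + d * wronskian l v w x"
  using sl_regular_linear(2)[OF assms(1,2,3)] by (simp add: wronskian_def algebra_simps)

lemma wronskian_swap: "wronskian l w y x = - wronskian l y w x"
  by (simp add: wronskian_def)

section \<open>The limit-point case\<close>

locale limit_point_problem =
  fixes l :: real and q :: "real \<Rightarrow> real" and \<phi>1 \<phi>2 :: "complex \<Rightarrow> real \<Rightarrow> complex"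
    and m :: "complex \<Rightarrow> complex"
  assumes deficiency: "deficiency_indices_1_1 l q"
    and weyl: "weyl_function l q \<phi>1 \<phi>2 m"
begin

text \<open>
  The Weyl solution: square-integrable, and normalized by the value \<open>-1\<close> at \<open>l\<close>.
\<close>

definition \<psi> :: "complex \<Rightarrow> real \<Rightarrow> complex" where
  "\<psi> z x = \<phi>2 z x + m z * \<phi>1 z x"

lemma phi1: "sl_solution l q z (\<phi>1 z)" "\<phi>1 z l = 0" "D1 l (\<phi>1 z) l = 1"
  and phi2: "sl_solution l q z (\<phi>2 z)" "\<phi>2 z l = -1" "D1 l (\<phi>2 z) l = 0"
  using weyl unfolding weyl_function_def by blast+

lemma combination:
  "sl_solution l q z (\<lambda>x. \<phi>2 z x + c * \<phi>1 z x)"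
  "D1 l (\<lambda>x. \<phi>2 z x + c * \<phi>1 z x) l = c"
proof -
  have eq: "(\<lambda>x. \<phi>2 z x + c * \<phi>1 z x) = (\<lambda>x. 1 * \<phi>2 z x + c * \<phi>1 z x)" by simp
  show "sl_solution l q z (\<lambda>x. \<phi>2 z x + c * \<phi>1 z x)"
    unfolding eq by (rule sl_solution_linear[OF phi2(1) phi1(1)])
  show "D1 l (\<lambda>x. \<phi>2 z x + c * \<phi>1 z x) l = c"
    unfolding eq sl_regular_linear(2)[OF sl_solutionD(1)[OF phi2(1)] sl_solutionD(1)[OF phi1(1)] order_refl]
    using phi1(3) phi2(3) by simp
qed

lemma psi: "sl_solution l q z (\<psi> z)" "\<psi> z l = -1" "D1 l (\<psi> z) l = m z"
  using combination[of z "m z"] phi1(2) phi2(2) by (simp_all add: \<psi>_def[abs_def])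

lemma psi_Dstar: "Im z \<noteq> 0 \<Longrightarrow> \<psi> z \<in> Dstar l q"
  using weyl psi(1)[of z] unfolding weyl_function_def
  by (auto intro!: sl_solution_Dstar simp: \<psi>_def[abs_def] L2_iff[symmetric])

lemma psi_sq_integrable: "Im z \<noteq> 0 \<Longrightarrow> sq_integrable (half_line l) (\<psi> z)"
  using psi_Dstar DstarD(2) by blast

lemma deficiency_space_iff:
  "y \<in> deficiency_space l q z \<longleftrightarrow> sl_solution l q z y \<and> sq_integrable (half_line l) y"
proof
  assume "y \<in> deficiency_space l q z"
  then have y: "y \<in> Dstar l q" "AE x in lebesgue. x \<ge> l \<longrightarrow> sl_expr l q y x = z * y x"
    unfolding deficiency_space_def by blast+
  show "sl_solution l q z y \<and> sq_integrable (half_line l) y"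
    unfolding sl_solution_def using DstarD(1,2)[OF y(1)] y(2) by blast
next
  assume y: "sl_solution l q z y \<and> sq_integrable (half_line l) y"
  then have "y \<in> Dstar l q" by (intro sl_solution_Dstar) blast+
  then show "y \<in> deficiency_space l q z"
    unfolding deficiency_space_def using y sl_solutionD(2) by blast
qed

text \<open>The deficiency space at \<open>\<i>\<close> is one-dimensional and contains \<open>\<psi> \<i>\<close>, whose value at \<open>l\<close> is \<open>-1\<close>.\<close>

lemma L2_solution_at_i:
  assumes "sl_solution l q \<i> y" "sq_integrable (half_line l) y" "x \<ge> l"
  shows "y x = - y l * \<psi> \<i> x"
proof -
  obtain u where u: "\<forall>y\<in>deficiency_space l q \<i>. \<exists>c. \<forall>x\<ge>l. y x = c * u x"
    using deficiency unfolding deficiency_indices_1_1_def one_dimensional_def by blast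
  have "y \<in> deficiency_space l q \<i>" "\<psi> \<i> \<in> deficiency_space l q \<i>"
    using assms psi(1) psi_sq_integrable[of \<i>] by (auto simp: deficiency_space_iff)
  then obtain c d where c: "\<forall>x\<ge>l. y x = c * u x" and d: "\<forall>x\<ge>l. \<psi> \<i> x = d * u x"
    using u by meson
  have "d * u l = -1" using d psi(2)[of \<i>] by simp
  have "- y l * \<psi> \<i> x = - (c * u l) * (d * u x)" using c d assms(3) by simp
  also have "\<dots> = - (d * u l) * (c * u x)" by (simp add: algebra_simps)
  also have "\<dots> = y x" using \<open>d * u l = -1\<close> c assms(3) by simp
  finally show ?thesis by simp
qed

abbreviation "\<phi> \<equiv> \<phi>1 \<i>"
abbreviation "\<psi>i \<equiv> \<psi> \<i>"

lemma regs: "sl_regular l \<phi>" "sl_regular l \<psi>i"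
  using sl_solutionD(1)[OF phi1(1)] sl_solutionD(1)[OF psi(1)] by blast+

text \<open>
  Otherwise \<open>\<phi>\<close> would be a multiple of \<open>\<psi> \<i>\<close>, by its value at \<open>l\<close> the zero multiple.
\<close>

lemma phi_not_sq_integrable: "\<not> sq_integrable (half_line l) \<phi>"
proof
  assume "sq_integrable (half_line l) \<phi>"
  then have "\<phi> x = 0" if "x \<ge> l" for x
    using L2_solution_at_i[OF phi1(1) _ that] phi1(2) by simp
  then have "D1 l \<phi> l = 0" by (intro D1_zero[of l "l + 1"]) auto
  then show False using phi1(3)[of \<i>] by simp
qed

lemma phi_norm_pos:
  assumes "b > l"
  shows "(LINT x|lebesgue_on {l..b}. (cmod (\<phi> x))\<^sup>2) > 0"
proof -
  have "(LINT x|lebesgue_on {l..b}. (cmod (\<phi> x))\<^sup>2) \<noteq> 0"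
  proof
    assume 0: "(LINT x|lebesgue_on {l..b}. (cmod (\<phi> x))\<^sup>2) = 0"
    have "\<phi> x = 0" if "x \<in> {l..b}" for x
      by (rule L2_zero_imp_zero[OF continuous_on_subset[OF sl_regular_continuous(1)[OF regs(1)]] assms 0 that]) auto
    then have "D1 l \<phi> l = 0" by (intro D1_zero[of l b]) (use assms in auto)
    then show False using phi1(3)[of \<i>] by simp
  qed
  then show ?thesis by (simp add: order.strict_iff_order integral_nonneg_AE)
qed

text \<open>Lagrange's identity for \<open>y\<close> and \<open>cnj y\<close>, which solves the equation at \<open>- \<i>\<close>.\<close>

lemma solution_energy:
  assumes y: "sl_solution l q \<i> y" and "l \<le> b"
  shows "wronskian l y (\<lambda>x. cnj (y x)) b = wronskian l y (\<lambda>x. cnj (y x)) l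
     + 2 * \<i> * complex_of_real (LINT x|lebesgue_on {l..b}. (cmod (y x))\<^sup>2)"
proof -
  have "wronskian l y (\<lambda>x. cnj (y x)) b = wronskian l y (\<lambda>x. cnj (y x)) l
     + (\<i> - cnj \<i>) * (LINT x|lebesgue_on {l..b}. y x * cnj (y x))"
    by (rule solution_wronskian[OF y sl_solution_cnj[OF y] order_refl assms(2)])
  then show ?thesis
    using integral_mult_cnj[OF solution_sq_integrable[OF y order_refl, of b]] by (simp add: L2norm_sq)
qed

text \<open>
  Weyl's disc.  For \<open>\<theta> = \<phi>2 + c \<phi>\<close> the energy identity turns the inequality into
  \<open>Im (W(\<theta>, cnj \<theta>)(b)) \<le> 0\<close>; as the integral increases with \<open>b\<close>, the discs shrink.
\<close>

definition disc :: "real \<Rightarrow> complex set" where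
  "disc b = {c. (LINT x|lebesgue_on {l..b}. (cmod (\<phi>2 \<i> x + c * \<phi> x))\<^sup>2) \<le> - Im c}"

lemma disc_sq [simp]: 
  "sq_integrable (lebesgue_on {l..b}) (\<lambda>x. \<phi>2 \<i> x + c * \<phi> x)"
  "sq_integrable (lebesgue_on {l..b}) (\<phi>2 \<i>)" "sq_integrable (lebesgue_on {l..b}) \<phi>"
  using solution_sq_integrable combination phi1(1) phi2(1) by blast+

lemma disc_mono: "l \<le> b \<Longrightarrow> b \<le> b' \<Longrightarrow> disc b' \<subseteq> disc b"
proof
  fix c assume "l \<le> b" "b \<le> b'" "c \<in> disc b'"
  then show "c \<in> disc b"
    using L2norm_interval_mono(1)[OF disc_sq(1)[of b' c], of b] by (simp add: disc_def L2norm_def)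
qed

lemma wronskian_combination:
  "wronskian l (\<lambda>x. \<phi>2 z x + c * \<phi>1 z x) (\<lambda>x. cnj (\<phi>2 z x + c * \<phi>1 z x)) l = 2 * \<i> * complex_of_real (Im c)"
  using sl_regular_cnj(2)[OF sl_solutionD(1)[OF combination(1)[of z c]] order_refl] combination(2)[of z c]
  by (simp add: wronskian_def phi1(2) phi2(2) complex_eq_iff)

text \<open>
  The solution that vanishes at \<open>b\<close> has \<open>W(\<theta>, cnj \<theta>)(b) = 0\<close> and thus lies on the boundary circle.
\<close>

lemma disc_nonempty:
  assumes "b > l"
  shows "disc b \<noteq> {}"
proof -
  have "\<phi> b \<noteq> 0"
  proof
    assume "\<phi> b = 0"
    then show False
      using solution_energy[OF phi1(1), of b] phi_norm_pos[OF assms] assms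
      by (simp add: wronskian_def phi1(2))
  qed
  define c where "c = - \<phi>2 \<i> b / \<phi> b"
  let ?\<theta> = "\<lambda>x. \<phi>2 \<i> x + c * \<phi> x"
  have "?\<theta> b = 0" using \<open>\<phi> b \<noteq> 0\<close> by (simp add: c_def)
  then have W0: "wronskian l ?\<theta> (\<lambda>x. cnj (?\<theta> x)) b = 0"
    by (simp add: wronskian_def del: complex_cnj_add complex_cnj_mult)
  have "0 = 2 * \<i> * complex_of_real (Im c) + 2 * \<i> * complex_of_real (LINT x|lebesgue_on {l..b}. (cmod (?\<theta> x))\<^sup>2)"
    using solution_energy[OF combination(1)[of \<i> c], of b] assms
    unfolding wronskian_combination W0 by simp
  then have "2 * \<i> * complex_of_real (Im c + (LINT x|lebesgue_on {l..b}. (cmod (?\<theta> x))\<^sup>2)) = 0"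
    by (simp add: algebra_simps)
  then have "Im c + (LINT x|lebesgue_on {l..b}. (cmod (?\<theta> x))\<^sup>2) = 0"
    by (simp only: mult_eq_0_iff of_real_eq_0_iff) simp
  then have "c \<in> disc b" by (simp add: disc_def)
  then show ?thesis by blast
qed

lemma disc_compact:
  assumes "b > l"
  shows "compact (disc b)"
  unfolding compact_eq_bounded_closed
proof
  let ?A = "LINT x|lebesgue_on {l..b}. (cmod (\<phi> x))\<^sup>2"
  let ?B = "LINT x|lebesgue_on {l..b}. (cmod (\<phi>2 \<i> x))\<^sup>2"
  have A: "?A > 0" by (rule phi_norm_pos[OF assms])
  have B: "?B \<ge> 0" by simp
  have "cmod c \<le> max 1 ((2 + 2 * ?B) / ?A)" if "c \<in> disc b" for c
  proof (cases "cmod c \<le> 1")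
    case False
    let ?\<theta> = "\<lambda>x. \<phi>2 \<i> x + c * \<phi> x"
    have "(cmod c)\<^sup>2 * ?A = (LINT x|lebesgue_on {l..b}. (cmod (c * \<phi> x))\<^sup>2)"
      by (simp add: norm_mult power_mult_distrib)
    also have "\<dots> \<le> (LINT x|lebesgue_on {l..b}. 2 * (cmod (?\<theta> x))\<^sup>2 + 2 * (cmod (\<phi>2 \<i> x))\<^sup>2)"
    proof (rule integral_mono)
      show "integrable (lebesgue_on {l..b}) (\<lambda>x. (cmod (c * \<phi> x))\<^sup>2)"
        using sq_integrable_cmult[OF disc_sq(3)] by (simp add: sq_integrable_def)
      show "integrable (lebesgue_on {l..b}) (\<lambda>x. 2 * (cmod (?\<theta> x))\<^sup>2 + 2 * (cmod (\<phi>2 \<i> x))\<^sup>2)"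
        using disc_sq(1)[of b c] disc_sq(2)[of b] by (simp add: sq_integrable_def)
      fix x
      have "(cmod (c * \<phi> x))\<^sup>2 = (cmod (?\<theta> x - \<phi>2 \<i> x))\<^sup>2" by simp
      also have "\<dots> \<le> (cmod (?\<theta> x) + cmod (\<phi>2 \<i> x))\<^sup>2"
        by (intro power_mono norm_triangle_ineq4) auto
      also have "\<dots> \<le> 2 * (cmod (?\<theta> x))\<^sup>2 + 2 * (cmod (\<phi>2 \<i> x))\<^sup>2"
        using sum_squares_bound[of "cmod (?\<theta> x)" "cmod (\<phi>2 \<i> x)"] by (simp add: power2_sum)
      finally show "(cmod (c * \<phi> x))\<^sup>2 \<le> 2 * (cmod (?\<theta> x))\<^sup>2 + 2 * (cmod (\<phi>2 \<i> x))\<^sup>2" .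
    qed
    also have "\<dots> = 2 * (LINT x|lebesgue_on {l..b}. (cmod (?\<theta> x))\<^sup>2) + 2 * ?B"
      using disc_sq(1)[of b c] disc_sq(2)[of b] by (simp add: sq_integrable_def)
    also have "\<dots> \<le> 2 * cmod c + 2 * ?B"
      using that abs_Im_le_cmod[of c] by (simp add: disc_def)
    also have "\<dots> \<le> 2 * cmod c + 2 * ?B * cmod c"
      using False B mult_left_mono[of 1 "cmod c" "2 * ?B"] by simp
    finally have "cmod c * (cmod c * ?A) \<le> cmod c * (2 + 2 * ?B)"
      by (simp add: power2_eq_square algebra_simps)
    then have "cmod c * ?A \<le> 2 + 2 * ?B"
      using False by (subst (asm) mult_le_cancel_left_pos) auto
    then show ?thesis using A by (simp add: le_max_iff_disj field_simps)
  qed simp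
  then show "bounded (disc b)" unfolding bounded_iff by blast
  have "closed {c. ?B + 2 * Re (cnj c * (LINT x|lebesgue_on {l..b}. \<phi>2 \<i> x * cnj (\<phi> x))) + (cmod c)\<^sup>2 * ?A \<le> - Im c}"
    by (intro closed_Collect_le continuous_intros)
  then show "closed (disc b)"
    unfolding disc_def integral_quadratic[OF disc_sq(2,3)] .
qed

text \<open>
  Weyl's nested discs have a common point, which yields a square-integrable solution; since there
  is only one up to scalars, the point is \<open>m \<i>\<close>.
\<close>

lemma m_i_in_disc:
  assumes "b \<ge> l"
  shows "m \<i> \<in> disc b"
proof -
  define F where "F n = disc (l + 1 + real n)" for n
  have "\<Inter> (range F) \<noteq> {}"
  proof (rule compact_nest)
    show "compact (F n)" "F n \<noteq> {}" for n
      unfolding F_def by (intro disc_compact disc_nonempty; simp)+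
    show "m \<le> n \<Longrightarrow> F n \<subseteq> F m" for m n
      unfolding F_def by (intro disc_mono) auto
  qed
  then obtain c where c: "\<And>n. c \<in> F n" by auto
  have c': "c \<in> disc b" if "b \<ge> l" for b
  proof -
    obtain n :: nat where "b \<le> l + 1 + real n" using real_arch_simple[of "b - l - 1"] by (auto simp: algebra_simps)
    then show ?thesis using disc_mono[OF that] c[of n] unfolding F_def by blast
  qed
  let ?\<theta> = "\<lambda>x. \<phi>2 \<i> x + c * \<phi> x"
  have "sq_integrable (half_line l) ?\<theta>"
  proof (rule sq_integrable_if_bounded)
    show "continuous_on {l..} ?\<theta>"
      by (rule sl_regular_continuous(1)[OF sl_solutionD(1)[OF combination(1)]])
    show "(LINT x|lebesgue_on {l..b}. (cmod (?\<theta> x))\<^sup>2) \<le> - Im c" if "b \<ge> l" for b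
      using c'[OF that] by (simp add: disc_def)
  qed
  then have "?\<theta> x = \<psi>i x" if "x \<ge> l" for x
    using L2_solution_at_i[OF combination(1) _ that, of c] by (simp add: phi1(2) phi2(2))
  then have *: "(c - m \<i>) * \<phi> x = 0" if "x \<ge> l" for x
    using that by (simp add: \<psi>_def algebra_simps)
  have "c = m \<i>"
  proof (rule ccontr)
    assume "c \<noteq> m \<i>"
    then have "\<phi> x = 0" if "x \<ge> l" for x using *[OF that] by simp
    then have "D1 l \<phi> l = 0" by (intro D1_zero[of l "l + 1"]) auto
    then show False using phi1(3)[of \<i>] by simp
  qed
  then show ?thesis using c'[OF assms] by simp
qed

text \<open>
  The boundary term of \<open>\<psi> \<i>\<close> at \<open>b\<close> has a definite sign and outweighs the energy of \<open>\<psi> \<i>\<close> beyond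
  \<open>b\<close>, because \<open>m \<i>\<close> lies in all discs.
\<close>

lemma wronskian_psi_i:
  assumes "b \<ge> l"
  shows "Im (wronskian l \<psi>i (\<lambda>x. cnj (\<psi>i x)) b) \<le> - 2 * (L2norm (half_line b) \<psi>i)\<^sup>2"
proof -
  let ?E = "\<lambda>b. LINT x|lebesgue_on {l..b}. (cmod (\<psi>i x))\<^sup>2"
  have i: "integrable (half_line l) (\<lambda>x. (cmod (\<psi>i x))\<^sup>2)"
    using psi_sq_integrable[of \<i>] by (simp add: sq_integrable_def)
  have W: "wronskian l \<psi>i (\<lambda>x. cnj (\<psi>i x)) b = 2 * \<i> * complex_of_real (Im (m \<i>) + ?E b)"
    using solution_energy[OF psi(1) assms] wronskian_combination[of \<i> "m \<i>"]
    by (simp add: \<psi>_def[abs_def] algebra_simps)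
  have "(LINT x|half_line l. (cmod (\<psi>i x))\<^sup>2) \<le> - Im (m \<i>)"
  proof (rule tendsto_upperbound[OF integral_subinterval_tendsto[OF i]])
    show "\<forall>\<^sub>F b in at_top. ?E b \<le> - Im (m \<i>)"
      using eventually_ge_at_top[of l]
      by eventually_elim (use m_i_in_disc in \<open>auto simp: disc_def \<psi>_def\<close>)
  qed simp
  then show "Im (wronskian l \<psi>i (\<lambda>x. cnj (\<psi>i x)) b) \<le> - 2 * (L2norm (half_line b) \<psi>i)\<^sup>2"
    using half_line_split(2)[OF i assms] unfolding W L2norm_sq by auto
qed

lemma wronskian_phi_psi: "b \<ge> l \<Longrightarrow> wronskian l \<phi> \<psi>i b = 1"
  using solution_wronskian[OF phi1(1) psi(1) order_refl, of b \<i>] by (simp add: wronskian_def phi1(2,3) psi(2,3))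

text \<open>
  Subtracting a multiple of \<open>\<phi>\<close> from \<open>y\<close> gives a function \<open>u\<close> on \<open>[l, b]\<close> that matches \<open>k \<psi>\<close> at \<open>b\<close>
  together with its derivative; so \<open>u\<close>, continued by \<open>k \<psi>\<close>, solves \<open>l(u) - \<i> u = f\<close> with \<open>f\<close> cut off at
  \<open>b\<close>.  The energy identity for \<open>u\<close> and the sign in \<open>wronskian_psi_i\<close> yield
  \<open>\<parallel>u\<parallel>\<^sup>2 + \<bar>k\<bar>\<^sup>2 \<parallel>\<psi>\<parallel>\<^sup>2 \<le> \<parallel>f\<parallel> \<parallel>u\<parallel>\<close>, with the norm of \<open>u\<close> over \<open>[l, b]\<close> and that of \<open>\<psi>\<close> over
  \<open>[b, \<infinity>)\<close>.
\<close>

lemma truncation: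
  fixes y :: "real \<Rightarrow> complex" and b :: real
  defines "Y \<equiv> wronskian l y \<psi>i b"
  defines "u \<equiv> \<lambda>x. y x - Y * \<phi> x"
  defines "k \<equiv> wronskian l \<phi> u b"
  defines "F \<equiv> L2norm (half_line l) (\<lambda>x. sl_expr l q y x - \<i> * y x)"
  assumes y: "y \<in> Dstar l q" and y0: "y l = 0" and b: "b \<ge> l"
  shows "wronskian l u w b = k * wronskian l \<psi>i w b"
    "L2norm (lebesgue_on {l..b}) u \<le> F"
    "cmod k * L2norm (half_line b) \<psi>i \<le> F"
proof -
  have u_eq: "u = (\<lambda>x. 1 * y x + (- Y) * \<phi> x)" by (simp add: u_def)
  note lin = sl_regular_linear[OF DstarD(1)[OF y] regs(1), where c=1 and d="-Y", folded u_eq]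
  have u: "sl_regular l u" by (rule lin)
  have one: "\<phi> b * D1 l \<psi>i b - D1 l \<phi> b * \<psi>i b = 1"
    using wronskian_phi_psi[OF b] by (simp add: wronskian_def)
  have "wronskian l u \<psi>i b = 0"
    using wronskian_linear[OF DstarD(1)[OF y] regs(1) b, of 1 "-Y" \<psi>i] wronskian_phi_psi[OF b]
    by (simp add: u_eq Y_def)
  then have zero: "u b * D1 l \<psi>i b = D1 l u b * \<psi>i b" by (simp add: wronskian_def)
  have k1: "u b = k * \<psi>i b" and k2: "D1 l u b = k * D1 l \<psi>i b"
  proof -
    have "k * \<psi>i b = \<phi> b * (D1 l u b * \<psi>i b) - D1 l \<phi> b * u b * \<psi>i b"
      by (simp add: k_def wronskian_def algebra_simps)
    also have "\<dots> = u b * (\<phi> b * D1 l \<psi>i b - D1 l \<phi> b * \<psi>i b)"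
      unfolding zero[symmetric] by (simp add: algebra_simps)
    finally show "u b = k * \<psi>i b" using one by simp
    have "k * D1 l \<psi>i b = \<phi> b * D1 l u b * D1 l \<psi>i b - D1 l \<phi> b * (u b * D1 l \<psi>i b)"
      by (simp add: k_def wronskian_def algebra_simps)
    also have "\<dots> = D1 l u b * (\<phi> b * D1 l \<psi>i b - D1 l \<phi> b * \<psi>i b)"
      unfolding zero by (simp add: algebra_simps)
    finally show "D1 l u b = k * D1 l \<psi>i b" using one by simp
  qed
  show W: "wronskian l u w b = k * wronskian l \<psi>i w b" for w
    by (simp add: wronskian_def k1 k2 algebra_simps)
  define f where "f x = sl_expr l q y x - \<i> * y x" for x
  have f: "sq_integrable (half_line l) f"
    unfolding f_def[abs_def] by (intro sq_integrable_diff sq_integrable_cmult DstarD[OF y])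
  have uc: "continuous_on {l..} u" using sl_regular_continuous[OF u] by blast
  have sqf: "sq_integrable (lebesgue_on {l..b}) f" by (rule sq_integrable_subinterval[OF f]) simp
  have squ: "sq_integrable (lebesgue_on {l..b}) u"
    by (rule sq_integrable_continuous[OF continuous_on_subset[OF uc]]) auto
  have gu: "AE x in lebesgue. x \<ge> l \<longrightarrow> sl_expr l q u x = f x + \<i> * u x"
    using lin(3)[of q] sl_solutionD(2)[OF phi1(1)[of \<i>]]
    by eventually_elim (auto simp: f_def u_def algebra_simps)
  have gu': "AE x in lebesgue. x \<ge> l \<longrightarrow> sl_expr l q (\<lambda>x. cnj (u x)) x = cnj (f x) - \<i> * cnj (u x)"
    using sl_regular_cnj(3)[OF u, of q] gu by eventually_elim auto
  define J where "J = (LINT x|lebesgue_on {l..b}. f x * cnj (u x))"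
  define U where "U = L2norm (lebesgue_on {l..b}) u"
  have i1: "integrable (lebesgue_on {l..b}) (\<lambda>x. f x * cnj (u x))"
    using sqf squ by (intro sq_integrable_mult) auto
  have i3: "integrable (lebesgue_on {l..b}) (\<lambda>x. cnj (f x * cnj (u x)))"
    using i1 by (rule integrable_cnj)
  have i2: "integrable (lebesgue_on {l..b}) (\<lambda>x. u x * cnj (u x))"
    using squ by (intro sq_integrable_mult) auto
  have eq: "(f x + \<i> * u x) * cnj (u x) - u x * (cnj (f x) - \<i> * cnj (u x))
      = f x * cnj (u x) - cnj (f x * cnj (u x)) + 2 * \<i> * (u x * cnj (u x))" for x
    by (simp add: algebra_simps)
  have "(LINT x|lebesgue_on {l..b}. (f x + \<i> * u x) * cnj (u x) - u x * (cnj (f x) - \<i> * cnj (u x)))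
      = wronskian l u (\<lambda>x. cnj (u x)) b - wronskian l u (\<lambda>x. cnj (u x)) l"
    by (rule Lagrange_identity_AE[OF u sl_regular_cnj(1)[OF u] order_refl b gu gu'])
      (unfold eq, intro Bochner_Integration.integrable_add Bochner_Integration.integrable_diff
        Bochner_Integration.integrable_mult_right i1 i2 i3)
  also have "(LINT x|lebesgue_on {l..b}. (f x + \<i> * u x) * cnj (u x) - u x * (cnj (f x) - \<i> * cnj (u x)))
      = J - cnj J + 2 * \<i> * complex_of_real (U\<^sup>2)"
    unfolding eq J_def U_def integral_mult_cnj[OF squ, symmetric]
    using i1 i2 i3 by (simp del: complex_cnj_mult)
  also have "wronskian l u (\<lambda>x. cnj (u x)) l = 0"
    by (simp add: wronskian_def u_def y0 phi1(2))
  also have "wronskian l u (\<lambda>x. cnj (u x)) b = k * cnj k * wronskian l \<psi>i (\<lambda>x. cnj (\<psi>i x)) b"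
    using sl_regular_cnj(2)[OF u b] sl_regular_cnj(2)[OF regs(2) b]
    by (simp add: wronskian_def k1 k2 algebra_simps)
  also have "k * cnj k = complex_of_real ((cmod k)\<^sup>2)"
    by (rule complex_norm_square[symmetric])
  finally have "Im (J - cnj J + 2 * \<i> * complex_of_real (U\<^sup>2))
      = Im (complex_of_real ((cmod k)\<^sup>2) * wronskian l \<psi>i (\<lambda>x. cnj (\<psi>i x)) b)"
    by simp
  then have "2 * Im J + 2 * U\<^sup>2 = (cmod k)\<^sup>2 * Im (wronskian l \<psi>i (\<lambda>x. cnj (\<psi>i x)) b)"
    by simp
  also have "\<dots> \<le> (cmod k)\<^sup>2 * (- 2 * (L2norm (half_line b) \<psi>i)\<^sup>2)"
    by (intro mult_left_mono wronskian_psi_i b) auto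
  finally have main: "U\<^sup>2 + (cmod k * L2norm (half_line b) \<psi>i)\<^sup>2 \<le> - Im J"
    by (simp add: power_mult_distrib)
  have "- Im J \<le> cmod J" using abs_Im_le_cmod[of J] by simp
  also have "\<dots> \<le> L2norm (lebesgue_on {l..b}) f * U"
    unfolding J_def U_def using Cauchy_Schwarz_L2[OF sqf, of "\<lambda>x. cnj (u x)"] squ by simp
  also have "\<dots> \<le> F * U"
    unfolding F_def f_def[symmetric] U_def by (intro mult_right_mono L2norm_subinterval_le f) auto
  finally have J: "- Im J \<le> F * U" .
  have "F \<ge> 0" "U \<ge> 0" by (simp_all add: F_def U_def)
  have "U * U \<le> F * U" using main J by (simp add: power2_eq_square) (smt (verit) mult_nonneg_nonneg zero_le_square)
  then show U: "L2norm (lebesgue_on {l..b}) u \<le> F"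
    unfolding U_def[symmetric] using \<open>U \<ge> 0\<close> \<open>F \<ge> 0\<close> by (cases "U = 0") auto
  have "(cmod k * L2norm (half_line b) \<psi>i)\<^sup>2 \<le> F * U" using main J zero_le_power2[of U] by linarith
  also have "\<dots> \<le> F\<^sup>2" unfolding power2_eq_square using U \<open>F \<ge> 0\<close> by (intro mult_left_mono) (auto simp: U_def)
  finally show "cmod k * L2norm (half_line b) \<psi>i \<le> F"
    using \<open>F \<ge> 0\<close> by (simp add: power2_le_iff_abs_le)
qed

text \<open>
  If the Wronskian tends to \<open>\<beta>\<close>, the bound on the truncated functions survives in the limit and puts
  \<open>y - \<beta> \<phi>\<close> into \<open>L\<^sub>2\<close>.  As \<open>\<phi>\<close> is not square-integrable, \<open>\<beta> = 0\<close>.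
\<close>

lemma wronskian_psi_i_tendsto_0_aux:
  assumes y: "y \<in> Dstar l q" and y0: "y l = 0"
  shows "(wronskian l y \<psi>i \<longlongrightarrow> 0) at_top"
proof -
  define \<beta> where "\<beta> = wronskian l y \<psi>i l + (LINT x|half_line l. Lagrange_form l q y \<psi>i x)"
  define F where "F = L2norm (half_line l) (\<lambda>x. sl_expr l q y x - \<i> * y x)"
  have lim: "(wronskian l y \<psi>i \<longlongrightarrow> \<beta>) at_top"
    unfolding \<beta>_def by (intro wronskian_tendsto y psi_Dstar) simp
  have cont: "continuous_on {l..} y" "continuous_on {l..} \<phi>"
    using sl_regular_continuous(1) DstarD(1)[OF y] regs by blast+
  have bound: "(LINT x|lebesgue_on {l..a}. (cmod (y x + (- \<beta>) * \<phi> x))\<^sup>2) \<le> F\<^sup>2" if a: "a \<ge> l" for a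
  proof -
    have sq: "sq_integrable (lebesgue_on {l..a}) y" "sq_integrable (lebesgue_on {l..a}) \<phi>"
      by (rule sq_integrable_continuous[OF continuous_on_subset[OF cont(1)]], force)
         (rule sq_integrable_continuous[OF continuous_on_subset[OF cont(2)]], force)
    have "((\<lambda>b. LINT x|lebesgue_on {l..a}. (cmod (y x + (- wronskian l y \<psi>i b) * \<phi> x))\<^sup>2)
        \<longlongrightarrow> (LINT x|lebesgue_on {l..a}. (cmod (y x + (- \<beta>) * \<phi> x))\<^sup>2)) at_top"
      unfolding integral_quadratic[OF sq] by (intro tendsto_intros lim)
    moreover have "\<forall>\<^sub>F b in at_top. (LINT x|lebesgue_on {l..a}. (cmod (y x + (- wronskian l y \<psi>i b) * \<phi> x))\<^sup>2) \<le> F\<^sup>2"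
      using eventually_ge_at_top[of a]
    proof eventually_elim
      case (elim b)
      let ?u = "\<lambda>x. y x - wronskian l y \<psi>i b * \<phi> x"
      have "continuous_on {l..} ?u" by (intro continuous_intros cont)
      then have "sq_integrable (lebesgue_on {l..b}) ?u"
        by (intro sq_integrable_continuous) (auto elim: continuous_on_subset)
      then have "L2norm (lebesgue_on {l..a}) ?u \<le> L2norm (lebesgue_on {l..b}) ?u"
        by (rule L2norm_interval_mono(1)[OF _ a elim])
      also have "\<dots> \<le> F" unfolding F_def by (rule truncation(2)[OF y y0]) (use a elim in simp)
      finally have "(L2norm (lebesgue_on {l..a}) ?u)\<^sup>2 \<le> F\<^sup>2" by (intro power_mono) auto
      then show ?case by (simp add: L2norm_sq)
    qed
    ultimately show ?thesis by (intro tendsto_upperbound[OF _ _ trivial_limit_at_top_linorder]) auto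
  qed
  have "\<beta> = 0"
  proof (rule ccontr)
    assume "\<beta> \<noteq> 0"
    have "sq_integrable (half_line l) (\<lambda>x. y x + (- \<beta>) * \<phi> x)"
      by (rule sq_integrable_if_bounded[OF _ bound]) (intro continuous_intros cont)
    then have "sq_integrable (half_line l) (\<lambda>x. (1 / \<beta>) * y x + (- 1 / \<beta>) * (y x + (- \<beta>) * \<phi> x))"
      by (intro sq_integrable_linear DstarD[OF y])
    moreover have "(\<lambda>x. (1 / \<beta>) * y x + (- 1 / \<beta>) * (y x + (- \<beta>) * \<phi> x)) = \<phi>"
      using \<open>\<beta> \<noteq> 0\<close> by (auto simp: field_simps)
    ultimately show False using phi_not_sq_integrable by simp
  qed
  then show ?thesis using lim by simp
qed

text \<open>
  Adding a multiple of \<open>\<psi> \<i>\<close> reduces statements on the Wronskian to functions that vanish at \<open>l\<close>.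
\<close>

lemma remove_boundary_value:
  assumes "y \<in> Dstar l q"
  defines "y0 \<equiv> \<lambda>x. 1 * y x + y l * \<psi>i x"
  shows "y0 \<in> Dstar l q" "y0 l = 0"
    "\<And>w b. b \<ge> l \<Longrightarrow> wronskian l y w b = wronskian l y0 w b - y l * wronskian l \<psi>i w b"
proof -
  show "y0 \<in> Dstar l q" unfolding y0_def by (intro Dstar_linear assms psi_Dstar) simp
  show "y0 l = 0" by (simp add: y0_def psi(2))
  show "wronskian l y w b = wronskian l y0 w b - y l * wronskian l \<psi>i w b" if "b \<ge> l" for w b
    using wronskian_linear[OF DstarD(1)[OF assms(1)] regs(2) that, of 1 "y l" w] by (simp add: y0_def)
qed

lemma wronskian_psi_i_tendsto_0:
  assumes y: "y \<in> Dstar l q"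
  shows "(wronskian l y \<psi>i \<longlongrightarrow> 0) at_top"
proof -
  note r = remove_boundary_value[OF y]
  have "\<forall>\<^sub>F b in at_top. wronskian l (\<lambda>x. 1 * y x + y l * \<psi>i x) \<psi>i b = wronskian l y \<psi>i b"
    using eventually_ge_at_top[of l]
    by eventually_elim (use r(3)[of _ \<psi>i] in \<open>simp add: wronskian_def[of l \<psi>i \<psi>i]\<close>)
  then show ?thesis
    using wronskian_psi_i_tendsto_0_aux[OF r(1,2)] by (rule Lim_transform_eventually[rotated])
qed

text \<open>
  With the truncation \<open>u = y - Y(b) \<phi>\<close>, the value \<open>W(y, w)(b)\<close> is the sum of \<open>k W(\<psi>, w)(b)\<close>, which the
  tails of \<open>\<psi>\<close> and of \<open>h = \<i> w - l(w)\<close> control, and of \<open>Y(b) W(\<phi>, w)(b) = Y(b) (\<integral> \<phi> h - w(l))\<close>.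
  Here \<open>\<integral> \<phi> h\<close> over \<open>[l, b]\<close> may grow.  But over \<open>[l, a]\<close> with a fixed \<open>a\<close> the factor \<open>Y(b)\<close>, which tends
  to zero, wins; and over \<open>[a, b]\<close> one has \<open>Y(b) \<phi> = y - u\<close>, which is bounded in \<open>L\<^sub>2\<close>, against the tail
  of \<open>h\<close>.
\<close>

lemma wronskian_tendsto_0_aux:
  assumes y: "y \<in> Dstar l q" and y0: "y l = 0" and w: "w \<in> Dstar l q"
  shows "(wronskian l y w \<longlongrightarrow> 0) at_top"
proof -
  define h where "h x = \<i> * w x - sl_expr l q w x" for x
  have h: "sq_integrable (half_line l) h"
    unfolding h_def[abs_def] by (intro sq_integrable_diff sq_integrable_cmult DstarD[OF w])
  define F where "F = L2norm (half_line l) (\<lambda>x. sl_expr l q y x - \<i> * y x)"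
  define N where "N = L2norm (half_line l) y"
  define T where "T a = L2norm (half_line a) h" for a
  define Y where "Y = wronskian l y \<psi>i"
  have Y0: "(Y \<longlongrightarrow> 0) at_top" unfolding Y_def by (rule wronskian_psi_i_tendsto_0[OF y])
  have T0: "(T \<longlongrightarrow> 0) at_top" unfolding T_def by (rule L2norm_tail_tendsto_0[OF h])
  have FN: "F \<ge> 0" "N \<ge> 0" by (simp_all add: F_def N_def)
  have cont: "continuous_on {l..} y" "continuous_on {l..} \<phi>"
    using sl_regular_continuous(1) DstarD(1)[OF y] regs by blast+
  have phih: "integrable (lebesgue_on {a..b}) (\<lambda>x. \<phi> x * h x)" if "a \<ge> l" for a b
    by (rule sq_integrable_mult[OF solution_sq_integrable[OF phi1(1) that] sq_integrable_subinterval[OF h that]])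
  have Wphi: "wronskian l \<phi> w b = (LINT x|lebesgue_on {l..b}. \<phi> x * h x) - w l" if b: "b \<ge> l" for b
  proof -
    have eq: "\<i> * \<phi> x * w x - \<phi> x * sl_expr l q w x = \<phi> x * h x" for x
      by (simp add: h_def algebra_simps)
    have "(LINT x|lebesgue_on {l..b}. \<i> * \<phi> x * w x - \<phi> x * sl_expr l q w x) = wronskian l \<phi> w b - wronskian l \<phi> w l"
      by (rule Lagrange_identity_AE[OF regs(1) DstarD(1)[OF w] order_refl b sl_solutionD(2)[OF phi1(1)]])
        (simp, unfold eq, rule phih, simp)
    then show ?thesis by (simp add: eq wronskian_def[of l \<phi> w l] phi1(2,3))
  qed
  have Wpsi: "cmod (wronskian l \<psi>i w b) \<le> L2norm (half_line b) \<psi>i * T b" if b: "b \<ge> l" for b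
  proof -
    have eq: "\<i> * \<psi>i x * w x - \<psi>i x * sl_expr l q w x = \<psi>i x * h x" for x
      by (simp add: h_def algebra_simps)
    have sq: "sq_integrable (half_line b) \<psi>i" "sq_integrable (half_line b) h"
      by (rule sq_integrable_half_line[OF _ b]; use h psi_sq_integrable[of \<i>] in simp)+
    have "(wronskian l \<psi>i w \<longlongrightarrow> wronskian l \<psi>i w b + (LINT x|half_line b. \<psi>i x * h x)) at_top"
    proof (rule Lim_transform_eventually)
      show "((\<lambda>c. wronskian l \<psi>i w b + (LINT x|lebesgue_on {b..c}. \<psi>i x * h x))
          \<longlongrightarrow> wronskian l \<psi>i w b + (LINT x|half_line b. \<psi>i x * h x)) at_top"
        by (intro tendsto_intros integral_subinterval_tendsto sq_integrable_mult sq)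
      show "\<forall>\<^sub>F c in at_top. wronskian l \<psi>i w b + (LINT x|lebesgue_on {b..c}. \<psi>i x * h x) = wronskian l \<psi>i w c"
        using eventually_ge_at_top[of b]
      proof eventually_elim
        case (elim c)
        have "(LINT x|lebesgue_on {b..c}. \<i> * \<psi>i x * w x - \<psi>i x * sl_expr l q w x) = wronskian l \<psi>i w c - wronskian l \<psi>i w b"
          by (rule Lagrange_identity_AE[OF regs(2) DstarD(1)[OF w] b elim sl_solutionD(2)[OF psi(1)]])
            (simp, unfold eq, intro sq_integrable_mult sq_integrable_subinterval[OF h b]
              sq_integrable_subinterval[OF psi_sq_integrable b], simp)
        then show ?case by (simp add: eq)
      qed
    qed
    moreover have "(wronskian l \<psi>i w \<longlongrightarrow> 0) at_top"
      unfolding wronskian_swap[of l \<psi>i w] using tendsto_minus[OF wronskian_psi_i_tendsto_0[OF w]] by simp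
    ultimately have "wronskian l \<psi>i w b + (LINT x|half_line b. \<psi>i x * h x) = 0"
      using tendsto_unique trivial_limit_at_top_linorder by blast
    then have "wronskian l \<psi>i w b = - (LINT x|half_line b. \<psi>i x * h x)"
      by (simp add: eq_neg_iff_add_eq_0)
    then show ?thesis using Cauchy_Schwarz_L2[OF sq] by (simp add: T_def)
  qed
  have bound: "cmod (wronskian l y w b) \<le> F * T b + cmod (Y b) * cmod (w l)
      + cmod (Y b) * cmod (LINT x|lebesgue_on {l..a}. \<phi> x * h x) + (F + N) * T a"
    if ab: "l \<le> a" "a \<le> b" for a b
  proof -
    have b: "b \<ge> l" using ab by simp
    let ?u = "\<lambda>x. y x - Y b * \<phi> x"
    define k where "k = wronskian l \<phi> ?u b"
    note tr = truncation[OF y y0 b, folded Y_def F_def, folded k_def]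
    have u_eq: "?u = (\<lambda>x. 1 * y x + (- Y b) * \<phi> x)" by simp
    have "wronskian l ?u w b = wronskian l y w b - Y b * wronskian l \<phi> w b"
      using wronskian_linear[OF DstarD(1)[OF y] regs(1) b, of 1 "- Y b" w] unfolding u_eq by simp
    then have W: "wronskian l y w b = k * wronskian l \<psi>i w b + Y b * (LINT x|lebesgue_on {l..b}. \<phi> x * h x) - Y b * w l"
      using tr(1)[of w] by (simp add: Wphi[OF b] algebra_simps)
    have split: "(LINT x|lebesgue_on {l..b}. \<phi> x * h x)
        = (LINT x|lebesgue_on {l..a}. \<phi> x * h x) + (LINT x|lebesgue_on {a..b}. \<phi> x * h x)"
      by (rule integral_subinterval_split[OF phih ab]) simp
    have h': "sq_integrable (half_line a) h" by (rule sq_integrable_half_line[OF h ab(1)])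
    have sqh: "sq_integrable (lebesgue_on {a..b}) h" by (rule sq_integrable_subinterval[OF h ab(1)])
    have hT: "L2norm (lebesgue_on {a..b}) h \<le> T a"
      unfolding T_def by (rule L2norm_subinterval_le[OF h']) simp
    have "continuous_on {l..} ?u" by (intro continuous_intros cont)
    then have squ': "sq_integrable (lebesgue_on {l..b}) ?u" and squ: "sq_integrable (lebesgue_on {a..b}) ?u"
      using ab by (auto intro!: sq_integrable_continuous elim!: continuous_on_subset)
    have uF: "L2norm (lebesgue_on {a..b}) ?u \<le> F"
      using L2norm_interval_mono(2)[OF squ' ab] tr(2) by simp
    have sqy: "sq_integrable (lebesgue_on {a..b}) y" by (rule sq_integrable_subinterval[OF DstarD(2)[OF y] ab(1)])
    have yN: "L2norm (lebesgue_on {a..b}) y \<le> N"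
      unfolding N_def by (rule L2norm_subinterval_le[OF DstarD(2)[OF y] ab(1)])
    have "Y b * (LINT x|lebesgue_on {a..b}. \<phi> x * h x) = (LINT x|lebesgue_on {a..b}. y x * h x - ?u x * h x)"
      by (simp add: algebra_simps)
    also have "\<dots> = (LINT x|lebesgue_on {a..b}. y x * h x) - (LINT x|lebesgue_on {a..b}. ?u x * h x)"
      by (rule Bochner_Integration.integral_diff[OF sq_integrable_mult[OF sqy sqh] sq_integrable_mult[OF squ sqh]])
    also have "cmod \<dots> \<le> cmod (LINT x|lebesgue_on {a..b}. y x * h x) + cmod (LINT x|lebesgue_on {a..b}. ?u x * h x)"
      by (rule norm_triangle_ineq4)
    also have "\<dots> \<le> N * T a + F * T a"
      using FN by (intro add_mono order_trans[OF Cauchy_Schwarz_L2[OF sqy sqh]] order_trans[OF Cauchy_Schwarz_L2[OF squ sqh]]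
          mult_mono yN uF hT) auto
    finally have t3: "cmod (Y b * (LINT x|lebesgue_on {a..b}. \<phi> x * h x)) \<le> (F + N) * T a"
      by (simp add: algebra_simps)
    have t1: "cmod (k * wronskian l \<psi>i w b) \<le> F * T b"
    proof -
      have "cmod (k * wronskian l \<psi>i w b) \<le> cmod k * (L2norm (half_line b) \<psi>i * T b)"
        unfolding norm_mult by (intro mult_left_mono Wpsi b) auto
      also have "\<dots> \<le> F * T b"
        unfolding mult.assoc[symmetric] by (intro mult_right_mono tr(3)) (simp add: T_def)
      finally show ?thesis .
    qed
    define A B C D where "A = k * wronskian l \<psi>i w b" and "B = Y b * (LINT x|lebesgue_on {l..a}. \<phi> x * h x)"
      and "C = Y b * (LINT x|lebesgue_on {a..b}. \<phi> x * h x)" and "D = Y b * w l"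
    have "wronskian l y w b = A + B + C - D"
      unfolding W split A_def B_def C_def D_def by (simp add: algebra_simps)
    moreover have "cmod (A + B + C - D) \<le> cmod A + cmod B + cmod C + cmod D"
      using norm_triangle_ineq4[of "A + B + C" D] norm_triangle_ineq[of "A + B" C] norm_triangle_ineq[of A B] by linarith
    moreover have "cmod A \<le> F * T b" "cmod C \<le> (F + N) * T a"
      using t1 t3 by (simp_all only: A_def C_def)
    ultimately show ?thesis by (simp add: B_def D_def norm_mult)
  qed
  show ?thesis
  proof (rule tendstoI)
    fix e :: real assume "e > 0"
    have "((\<lambda>a. (F + N) * T a) \<longlongrightarrow> (F + N) * 0) at_top" by (intro tendsto_intros T0)
    then have "\<forall>\<^sub>F a in at_top. (F + N) * T a < e / 2"
      using \<open>e > 0\<close> by (intro order_tendstoD(2)) auto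
    then have "\<forall>\<^sub>F a in at_top. (F + N) * T a < e / 2 \<and> a \<ge> l"
      using eventually_ge_at_top[of l] by eventually_elim auto
    then obtain a where a: "(F + N) * T a < e / 2" "a \<ge> l"
      by (metis (mono_tags, lifting) eventually_happens trivial_limit_at_top_linorder)
    let ?R = "\<lambda>b. F * T b + cmod (Y b) * cmod (w l) + cmod (Y b) * cmod (LINT x|lebesgue_on {l..a}. \<phi> x * h x)"
    have "(?R \<longlongrightarrow> F * 0 + cmod 0 * cmod (w l) + cmod 0 * cmod (LINT x|lebesgue_on {l..a}. \<phi> x * h x)) at_top"
      by (intro tendsto_intros T0 Y0)
    then have "\<forall>\<^sub>F b in at_top. ?R b < e / 2"
      using \<open>e > 0\<close> by (intro order_tendstoD(2)) auto
    then show "\<forall>\<^sub>F b in at_top. dist (wronskian l y w b) 0 < e"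
      using eventually_ge_at_top[of a]
    proof eventually_elim
      case (elim b)
      then show ?case using bound[OF a(2) elim(2)] a(1) by simp
    qed
  qed
qed

theorem limit_point:
  assumes y: "y \<in> Dstar l q" and w: "w \<in> Dstar l q"
  shows "(wronskian l y w \<longlongrightarrow> 0) at_top"
proof -
  note r = remove_boundary_value[OF y]
  have "((\<lambda>b. wronskian l (\<lambda>x. 1 * y x + y l * \<psi>i x) w b - y l * - wronskian l w \<psi>i b) \<longlongrightarrow> 0 - y l * - 0) at_top"
    by (intro tendsto_intros wronskian_tendsto_0_aux r(1,2) w wronskian_psi_i_tendsto_0)
  moreover have "\<forall>\<^sub>F b in at_top. wronskian l (\<lambda>x. 1 * y x + y l * \<psi>i x) w b - y l * - wronskian l w \<psi>i b = wronskian l y w b"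
    using eventually_ge_at_top[of l]
    by eventually_elim (use r(3)[of _ w] wronskian_swap[of l \<psi>i w] in simp)
  ultimately show ?thesis by (auto intro: Lim_transform_eventually)
qed

text \<open>Lagrange's identity on \<open>[l, b]\<close> in the limit, where the boundary term at \<open>b\<close> disappears.\<close>

corollary Green:
  assumes y: "y \<in> Dstar l q" and w: "w \<in> Dstar l q"
  shows "(LINT x|half_line l. sl_expr l q y x * w x) - (LINT x|half_line l. y x * sl_expr l q w x)
      = D1 l y l * w l - y l * D1 l w l"
proof -
  have "wronskian l y w l + (LINT x|half_line l. Lagrange_form l q y w x) = 0"
    using tendsto_unique[OF _ wronskian_tendsto[OF y w] limit_point[OF y w]] by simp
  moreover have "(LINT x|half_line l. Lagrange_form l q y w x)
      = (LINT x|half_line l. sl_expr l q y x * w x) - (LINT x|half_line l. y x * sl_expr l q w x)"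
    unfolding Lagrange_form_def
    by (intro Bochner_Integration.integral_diff sq_integrable_mult DstarD[OF y] DstarD[OF w])
  ultimately show ?thesis by (simp add: wronskian_def add_eq_0_iff)
qed

end

section \<open>The Weyl function\<close>

context limit_point_problem
begin

abbreviation "hl \<equiv> half_line l"

lemma Green_AE:
  assumes y: "y \<in> Dstar l q" and w: "w \<in> Dstar l q"
    and gy: "AE x in lebesgue. x \<ge> l \<longrightarrow> sl_expr l q y x = gy x"
    and gw: "AE x in lebesgue. x \<ge> l \<longrightarrow> sl_expr l q w x = gw x"
  shows "(LINT x|hl. gy x * w x) - (LINT x|hl. y x * gw x) = D1 l y l * w l - y l * D1 l w l"
proof -
  have gy': "AE x in hl. sl_expr l q y x = gy x" and gw': "AE x in hl. sl_expr l q w x = gw x"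
    using gy gw by (simp_all add: AE_half_line)
  have s: "sq_integrable hl gy" "sq_integrable hl gw"
    by (rule sq_integrable_cong_AE[OF DstarD(3)[OF y] gy'] sq_integrable_cong_AE[OF DstarD(3)[OF w] gw'])+
  have "(LINT x|hl. sl_expr l q y x * w x) = (LINT x|hl. gy x * w x)"
    by (rule integral_cong_AE)
      (use gy' sq_integrable_mult[OF DstarD(3)[OF y] DstarD(2)[OF w]] sq_integrable_mult[OF s(1) DstarD(2)[OF w]]
        in \<open>auto elim!: eventually_mono\<close>)
  moreover have "(LINT x|hl. y x * sl_expr l q w x) = (LINT x|hl. y x * gw x)"
    by (rule integral_cong_AE)
      (use gw' sq_integrable_mult[OF DstarD(2)[OF y] DstarD(3)[OF w]] sq_integrable_mult[OF DstarD(2)[OF y] s(2)]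
        in \<open>auto elim!: eventually_mono\<close>)
  ultimately show ?thesis using Green[OF y w] by simp
qed

text \<open>
  For \<open>u l = 0\<close> the boundary term of Green's formula with \<open>u\<close> and \<open>cnj u\<close> vanishes, that is, the
  Dirichlet operator is symmetric.
\<close>

lemma Dirichlet_resolvent_bound:
  assumes u: "u \<in> Dstar l q" and u0: "u l = 0" and f: "sq_integrable hl f"
    and eq: "AE x in lebesgue. x \<ge> l \<longrightarrow> sl_expr l q u x = z * u x + f x"
  shows "\<bar>Im z\<bar> * L2norm hl u \<le> L2norm hl f"
proof -
  define U J where "U = L2norm hl u" and "J = (LINT x|hl. f x * cnj (u x))"
  note squ = DstarD(2)[OF u]
  have eq': "AE x in lebesgue. x \<ge> l \<longrightarrow> sl_expr l q (\<lambda>x. cnj (u x)) x = cnj (z * u x + f x)"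
    using sl_regular_cnj(3)[OF DstarD(1)[OF u], of q] eq by eventually_elim auto
  have i1: "integrable hl (\<lambda>x. u x * cnj (u x))" "integrable hl (\<lambda>x. f x * cnj (u x))"
    using squ f by (auto intro!: sq_integrable_mult)
  have e1: "(LINT x|hl. (z * u x + f x) * cnj (u x)) = z * complex_of_real (U\<^sup>2) + J"
  proof -
    have "(LINT x|hl. (z * u x + f x) * cnj (u x)) = (LINT x|hl. z * (u x * cnj (u x)) + f x * cnj (u x))"
      by (simp add: algebra_simps)
    also have "\<dots> = z * (LINT x|hl. u x * cnj (u x)) + J"
      using i1 by (simp add: J_def)
    finally show ?thesis by (simp only: integral_mult_cnj[OF squ] U_def)
  qed
  have e2: "(LINT x|hl. u x * cnj (z * u x + f x)) = cnj (z * complex_of_real (U\<^sup>2) + J)"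
  proof -
    have "(LINT x|hl. u x * cnj (z * u x + f x)) = (LINT x|hl. cnj ((z * u x + f x) * cnj (u x)))"
      by (simp add: mult.commute)
    also have "\<dots> = cnj (LINT x|hl. (z * u x + f x) * cnj (u x))" by (rule Bochner_Integration.integral_cnj)
    finally show ?thesis unfolding e1 .
  qed
  have "z * complex_of_real (U\<^sup>2) + J - cnj (z * complex_of_real (U\<^sup>2) + J) = 0"
    using Green_AE[OF u Dstar_cnj[OF u] eq eq'] by (simp only: e1 e2 u0) simp
  then have "Im (z * complex_of_real (U\<^sup>2) + J) = 0" by (simp add: complex_eq_iff)
  then have "Im z * U\<^sup>2 = - Im J" by simp
  then have "\<bar>Im z\<bar> * U\<^sup>2 = \<bar>Im J\<bar>" by (metis abs_minus_cancel abs_mult abs_power2)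
  also have "\<dots> \<le> cmod J" by (rule abs_Im_le_cmod)
  also have "\<dots> \<le> L2norm hl f * U"
    unfolding J_def U_def using Cauchy_Schwarz_L2[OF f, of "\<lambda>x. cnj (u x)"] squ by simp
  finally have "(\<bar>Im z\<bar> * U) * U \<le> L2norm hl f * U" by (simp add: power2_eq_square mult.assoc)
  moreover have "U \<ge> 0" by (simp add: U_def)
  ultimately show ?thesis
    unfolding U_def[symmetric] by (cases "U = 0") (auto simp: mult_le_cancel_right)
qed

text \<open>
  The function \<open>y + y(l) \<psi>\<close> solves the same equation with boundary value zero, and the resolvent
  bound with \<open>f = 0\<close> makes it vanish.
\<close>

lemma L2_solution_multiple_of_psi:
  assumes z: "Im z \<noteq> 0" and y: "y \<in> Dstar l q" and eq: "AE x in lebesgue. x \<ge> l \<longrightarrow> sl_expr l q y x = z * y x"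
  shows "\<And>x. x \<ge> l \<Longrightarrow> y x = - y l * \<psi> z x" "D1 l y l = - y l * m z"
proof -
  define u where "u x = 1 * y x + y l * \<psi> z x" for x
  note r = DstarD(1)[OF y] sl_solutionD(1)[OF psi(1), of z]
  have u: "u \<in> Dstar l q" unfolding u_def[abs_def] by (intro Dstar_linear y psi_Dstar z)
  have u0: "u l = 0" by (simp add: u_def psi(2))
  have "AE x in lebesgue. x \<ge> l \<longrightarrow> sl_expr l q u x = z * u x + 0"
    using sl_regular_linear(3)[OF r, of q 1 "y l"] eq sl_solutionD(2)[OF psi(1)[of z]]
    unfolding u_def[abs_def] by eventually_elim (auto simp: algebra_simps)
  then have "\<bar>Im z\<bar> * L2norm hl u \<le> L2norm hl (\<lambda>_. 0)"
    by (rule Dirichlet_resolvent_bound[OF u u0, rotated]) (simp add: sq_integrable_def)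
  then have "\<bar>Im z\<bar> * L2norm hl u \<le> 0" by (simp add: L2norm_def)
  then have "L2norm hl u = 0" using z L2norm_nonneg[of hl u] by (simp add: mult_le_0_iff)
  then have "AE x in hl. u x = 0" using L2norm_eq_0_iff[OF DstarD(2)[OF u]] by blast
  then have zero: "u x = 0" if "x \<ge> l" for x
    using continuous_AE_zero[OF sl_regular_continuous(1)[OF DstarD(1)[OF u]]] that by blast
  then show "\<And>x. x \<ge> l \<Longrightarrow> y x = - y l * \<psi> z x" by (simp add: u_def eq_neg_iff_add_eq_0)
  have "D1 l u l = 0" by (rule D1_zero[of l "l + 1"]) (use zero in auto)
  then show "D1 l y l = - y l * m z"
    using sl_regular_linear(2)[OF r order_refl, of 1 "y l"] by (simp add: u_def[abs_def] psi(3) eq_neg_iff_add_eq_0)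
qed

text \<open>
  As \<open>q\<close> is real, \<open>cnj \<psi>\<close> is a square-integrable solution at \<open>cnj z\<close>.
\<close>

lemma m_cnj:
  assumes z: "Im z \<noteq> 0"
  shows "m (cnj z) = cnj (m z)"
proof -
  have y: "(\<lambda>x. cnj (\<psi> z x)) \<in> Dstar l q" by (intro Dstar_cnj psi_Dstar z)
  have "D1 l (\<lambda>x. cnj (\<psi> z x)) l = - cnj (\<psi> z l) * m (cnj z)"
    using L2_solution_multiple_of_psi(2)[of "cnj z", OF _ y sl_solutionD(2)[OF sl_solution_cnj[OF psi(1)]]] z by simp
  then show ?thesis
    using sl_regular_cnj(2)[OF sl_solutionD(1)[OF psi(1)] order_refl] by (simp add: psi(2,3))
qed

lemma Green_psi:
  assumes z: "Im z \<noteq> 0" and w: "w \<in> Dstar l q"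
    and gw: "AE x in lebesgue. x \<ge> l \<longrightarrow> sl_expr l q w x = gw x"
  shows "z * (LINT x|hl. \<psi> z x * w x) - (LINT x|hl. \<psi> z x * gw x) = m z * w l + D1 l w l"
  using Green_AE[OF psi_Dstar[OF z] w sl_solutionD(2)[OF psi(1)] gw]
  by (simp add: psi(2,3) mult.assoc)

lemma Im_m:
  assumes z: "Im z \<noteq> 0"
  shows "Im (m z) = - Im z * (L2norm hl (\<psi> z))\<^sup>2"
proof -
  have "z * (LINT x|hl. \<psi> z x * cnj (\<psi> z x)) - (LINT x|hl. \<psi> z x * (cnj z * cnj (\<psi> z x)))
      = m z * cnj (\<psi> z l) + D1 l (\<lambda>x. cnj (\<psi> z x)) l"
    by (rule Green_psi[OF z Dstar_cnj[OF psi_Dstar[OF z]] sl_solutionD(2)[OF sl_solution_cnj[OF psi(1)]]])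
  moreover have "(LINT x|hl. \<psi> z x * (cnj z * cnj (\<psi> z x))) = cnj z * (LINT x|hl. \<psi> z x * cnj (\<psi> z x))"
    by (simp add: mult.left_commute)
  moreover have "m z * cnj (\<psi> z l) + D1 l (\<lambda>x. cnj (\<psi> z x)) l = - m z + cnj (m z)"
    using sl_regular_cnj(2)[OF sl_solutionD(1)[OF psi(1)] order_refl] by (simp add: psi(2,3))
  ultimately have "z * complex_of_real ((L2norm hl (\<psi> z))\<^sup>2) - cnj z * complex_of_real ((L2norm hl (\<psi> z))\<^sup>2) = - m z + cnj (m z)"
    by (simp only: integral_mult_cnj[OF psi_sq_integrable[OF z]])
  then have "Im (z * complex_of_real ((L2norm hl (\<psi> z))\<^sup>2) - cnj z * complex_of_real ((L2norm hl (\<psi> z))\<^sup>2)) = Im (- m z + cnj (m z))"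
    by (rule arg_cong)
  then show ?thesis by simp
qed

lemma psi_norm_pos:
  assumes z: "Im z \<noteq> 0"
  shows "L2norm hl (\<psi> z) > 0"
proof -
  have "L2norm hl (\<psi> z) \<noteq> 0"
  proof
    assume "L2norm hl (\<psi> z) = 0"
    then have "AE x in hl. \<psi> z x = 0" using L2norm_eq_0_iff[OF psi_sq_integrable[OF z]] by blast
    then have "\<psi> z l = 0"
      using continuous_AE_zero[OF sl_regular_continuous(1)[OF sl_solutionD(1)[OF psi(1)]], of z l] by auto
    then show False by (simp add: psi(2))
  qed
  then show ?thesis using L2norm_nonneg[of hl "\<psi> z"] by linarith
qed

lemma Im_m_neg: "Im z > 0 \<Longrightarrow> Im (m z) < 0"
  using Im_m[of z] psi_norm_pos[of z] by simp

lemma Im_m_nonzero: "Im z \<noteq> 0 \<Longrightarrow> Im (m z) \<noteq> 0"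
  using Im_m[of z] psi_norm_pos[of z] by simp

lemma m_diff:
  assumes z: "Im z \<noteq> 0" and w: "Im w \<noteq> 0"
  shows "m z - m w = (w - z) * (LINT x|hl. \<psi> z x * \<psi> w x)"
proof -
  have "z * (LINT x|hl. \<psi> z x * \<psi> w x) - (LINT x|hl. \<psi> z x * (w * \<psi> w x)) = m z * \<psi> w l + D1 l (\<psi> w) l"
    by (rule Green_psi[OF z psi_Dstar[OF w] sl_solutionD(2)[OF psi(1)]])
  moreover have "(LINT x|hl. \<psi> z x * (w * \<psi> w x)) = w * (LINT x|hl. \<psi> z x * \<psi> w x)"
    by (simp add: mult.left_commute)
  ultimately show ?thesis by (simp add: psi(2,3) algebra_simps)
qed

text \<open>
  The difference vanishes at \<open>l\<close> and satisfies \<open>l(u) - z u = (z - w) \<psi>\<^sub>w\<close>.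
\<close>

lemma psi_diff_norm:
  assumes z: "Im z \<noteq> 0" and w: "Im w \<noteq> 0"
  shows "\<bar>Im z\<bar> * L2norm hl (\<lambda>x. \<psi> z x - \<psi> w x) \<le> cmod (z - w) * L2norm hl (\<psi> w)"
proof -
  have eq: "(\<lambda>x. \<psi> z x - \<psi> w x) = (\<lambda>x. 1 * \<psi> z x + (-1) * \<psi> w x)" by simp
  have u: "(\<lambda>x. \<psi> z x - \<psi> w x) \<in> Dstar l q"
    unfolding eq by (intro Dstar_linear psi_Dstar z w)
  have "AE x in lebesgue. x \<ge> l \<longrightarrow> sl_expr l q (\<lambda>x. \<psi> z x - \<psi> w x) x = z * (\<psi> z x - \<psi> w x) + (z - w) * \<psi> w x"
    using sl_regular_linear(3)[OF sl_solutionD(1)[OF psi(1)[of z]] sl_solutionD(1)[OF psi(1)[of w]], of q 1 "-1"]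
      sl_solutionD(2)[OF psi(1)[of z]] sl_solutionD(2)[OF psi(1)[of w]]
    unfolding eq by eventually_elim (auto simp: algebra_simps)
  from Dirichlet_resolvent_bound[OF u _ sq_integrable_cmult[OF psi_sq_integrable[OF w]] this]
  have "\<bar>Im z\<bar> * L2norm hl (\<lambda>x. \<psi> z x - \<psi> w x) \<le> L2norm hl (\<lambda>x. (z - w) * \<psi> w x)"
    by (simp add: psi(2))
  also have "\<dots> = cmod (z - w) * L2norm hl (\<psi> w)"
    by (simp add: L2norm_def norm_mult power_mult_distrib real_sqrt_mult)
  finally show ?thesis .
qed

text \<open>
  By \<open>m_diff\<close> the difference quotient is an integral of \<open>\<psi>\<^sub>z \<psi>\<^sub>w\<close>, and \<open>\<psi>\<^sub>z\<close> is continuous in \<open>z\<close> as an element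
  of \<open>L\<^sub>2\<close>.
\<close>

lemma m_has_field_derivative:
  assumes w: "Im w \<noteq> 0"
  shows "(m has_field_derivative - (LINT x|hl. \<psi> w x * \<psi> w x)) (at w)"
  unfolding has_field_derivative_iff
proof (rule Lim_transform_eventually)
  define C where "C = (L2norm hl (\<psi> w))\<^sup>2"
  have "((\<lambda>z. (LINT x|hl. \<psi> z x * \<psi> w x)) \<longlongrightarrow> (LINT x|hl. \<psi> w x * \<psi> w x)) (at w)"
  proof (rule Lim_null[THEN iffD2], rule Lim_null_comparison)
    have "\<forall>\<^sub>F z in at w. \<bar>Im z\<bar> > \<bar>Im w\<bar> / 2"
      by (rule order_tendstoD(1)[of _ "\<bar>Im w\<bar>"]) (use w in \<open>auto intro!: tendsto_intros\<close>)
    then show "\<forall>\<^sub>F z in at w. norm ((LINT x|hl. \<psi> z x * \<psi> w x) - (LINT x|hl. \<psi> w x * \<psi> w x)) \<le> cmod (z - w) * (2 / \<bar>Im w\<bar> * C)"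
    proof eventually_elim
      case (elim z)
      then have z: "Im z \<noteq> 0" by auto
      let ?d = "L2norm hl (\<lambda>x. \<psi> z x - \<psi> w x)"
      have sq: "sq_integrable hl (\<psi> z)" "sq_integrable hl (\<psi> w)" "sq_integrable hl (\<lambda>x. \<psi> z x - \<psi> w x)"
        using psi_sq_integrable z w sq_integrable_diff by blast+
      have e: "(LINT x|hl. \<psi> z x * \<psi> w x) - (LINT x|hl. \<psi> w x * \<psi> w x) = (LINT x|hl. (\<psi> z x - \<psi> w x) * \<psi> w x)"
        unfolding Bochner_Integration.integral_diff[OF sq_integrable_mult[OF sq(1,2)] sq_integrable_mult[OF sq(2,2)], symmetric]
        by (simp add: algebra_simps)
      have 1: "norm ((LINT x|hl. \<psi> z x * \<psi> w x) - (LINT x|hl. \<psi> w x * \<psi> w x)) \<le> ?d * L2norm hl (\<psi> w)"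
        unfolding e by (rule Cauchy_Schwarz_L2[OF sq(3,2)])
      have "\<bar>Im w\<bar> / 2 * ?d \<le> \<bar>Im z\<bar> * ?d" using elim by (intro mult_right_mono) auto
      also have "\<dots> \<le> cmod (z - w) * L2norm hl (\<psi> w)" by (rule psi_diff_norm[OF z w])
      finally have 2: "?d \<le> 2 / \<bar>Im w\<bar> * (cmod (z - w) * L2norm hl (\<psi> w))"
        using w by (simp add: field_simps)
      show ?case
        using order_trans[OF 1 mult_right_mono[OF 2 L2norm_nonneg[of hl "\<psi> w"]]]
        by (simp add: C_def power2_eq_square mult.assoc mult.left_commute)
    qed
    show "((\<lambda>z. cmod (z - w) * (2 / \<bar>Im w\<bar> * C)) \<longlongrightarrow> 0) (at w)"
      by (rule tendsto_eq_intros refl)+ simp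
  qed
  then show "((\<lambda>z. - (LINT x|hl. \<psi> z x * \<psi> w x)) \<longlongrightarrow> - (LINT x|hl. \<psi> w x * \<psi> w x)) (at w)"
    by (intro tendsto_intros)
  have "\<forall>\<^sub>F z in at w. Im z \<noteq> 0"
    by (rule tendsto_imp_eventually_ne[of _ "Im w"]) (use w in \<open>auto intro!: tendsto_intros\<close>)
  moreover have "\<forall>\<^sub>F z in at w. z \<noteq> w" by (simp add: eventually_at_filter)
  ultimately show "\<forall>\<^sub>F z in at w. - (LINT x|hl. \<psi> z x * \<psi> w x) = (m z - m w) / (z - w)"
  proof eventually_elim
    case (elim z)
    then have "(m z - m w) / (z - w) = (w - z) * (LINT x|hl. \<psi> z x * \<psi> w x) / (z - w)"
      using m_diff[of z w] w by simp
    also have "(w - z) * (LINT x|hl. \<psi> z x * \<psi> w x) = - (LINT x|hl. \<psi> z x * \<psi> w x) * (z - w)"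
      by (simp add: algebra_simps)
    finally show ?case using elim by simp
  qed
qed

text \<open>
  Green's formula tested with elements \<open>w\<close> that have prescribed boundary values and small norm is the
  source of all information on \<open>m (\<i> y)\<close> for large \<open>y\<close>.
\<close>

lemma Green_test_bound:
  assumes w: "w \<in> Dstar l q" and z: "Im z \<noteq> 0"
  shows "cmod (m z * w l + D1 l w l) \<le> L2norm hl (\<psi> z) * (cmod z * L2norm hl w + L2norm hl (sl_expr l q w))"
proof -
  define A B where "A = (LINT x|hl. \<psi> z x * w x)" and "B = (LINT x|hl. \<psi> z x * sl_expr l q w x)"
  have "m z * w l + D1 l w l = z * A - B"
    unfolding A_def B_def by (rule Green_psi[OF z w, symmetric]) simp
  then have "cmod (m z * w l + D1 l w l) \<le> cmod z * cmod A + cmod B"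
    using norm_triangle_ineq4[of "z * A" B] by (simp add: norm_mult)
  also have "\<dots> \<le> cmod z * (L2norm hl (\<psi> z) * L2norm hl w) + L2norm hl (\<psi> z) * L2norm hl (sl_expr l q w)"
    unfolding A_def B_def
    by (intro add_mono mult_left_mono Cauchy_Schwarz_L2 psi_sq_integrable z DstarD[OF w]) auto
  finally show ?thesis by (simp add: algebra_simps)
qed

lemma boundary_test_function:
  assumes "\<delta> > 0"
  obtains w where "w \<in> Dstar l q" "w l = \<alpha>" "D1 l w l = \<beta>" "L2norm hl w \<le> \<delta>"
proof -
  define u where "u x = (- \<alpha>) * \<phi>2 \<i> x + \<beta> * \<phi>1 \<i> x" for x
  have u: "sl_solution l q \<i> u"
    unfolding u_def[abs_def] by (rule sl_solution_linear[OF phi2(1) phi1(1)])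
  have "u l = \<alpha>" by (simp add: u_def phi1(2) phi2(2))
  moreover have "D1 l u l = \<beta>"
    unfolding u_def[abs_def] sl_regular_linear(2)[OF sl_solutionD(1)[OF phi2(1)] sl_solutionD(1)[OF phi1(1)] order_refl]
    by (simp add: phi1(3) phi2(3))
  ultimately show thesis using small_with_boundary_values[OF u assms] that by metis
qed

text \<open>The bound says \<open>f y \<ge> y / (y \<delta> + C)\<close>, which tends to \<open>1 / \<delta>\<close>; and \<open>\<delta>\<close> is arbitrary.\<close>

lemma filterlim_at_top_if_small:
  fixes f :: "real \<Rightarrow> real"
  assumes "\<And>\<delta>. \<delta> > 0 \<Longrightarrow> \<exists>C\<ge>0. \<forall>\<^sub>F y in at_top. y \<le> f y * (y * \<delta> + C)"
  shows "filterlim f at_top at_top"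
  unfolding filterlim_at_top_gt[where c=0]
proof (intro allI impI)
  fix Z :: real assume "Z > 0"
  obtain C where C: "C \<ge> 0" "\<forall>\<^sub>F y in at_top. y \<le> f y * (y * (1 / (2 * Z)) + C)"
    using assms[of "1 / (2 * Z)"] \<open>Z > 0\<close> by auto
  show "\<forall>\<^sub>F y in at_top. Z \<le> f y"
    using C(2) eventually_gt_at_top[of "2 * Z * C"] eventually_gt_at_top[of 0]
  proof eventually_elim
    case (elim y)
    have p: "y * (1 / (2 * Z)) + C > 0" using elim C(1) \<open>Z > 0\<close> by (simp add: add_pos_nonneg)
    have "Z * (y * (1 / (2 * Z)) + C) \<le> y" using elim \<open>Z > 0\<close> by (simp add: field_simps)
    also have "\<dots> \<le> f y * (y * (1 / (2 * Z)) + C)" by (rule elim)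
    finally show ?case using p by (simp only: mult_le_cancel_right_pos)
  qed
qed

text \<open>
  With \<open>w l = 0\<close> and \<open>w' l = 1\<close> the boundary term \<open>m w(l) + w'(l)\<close> is \<open>1\<close>.
\<close>

lemma psi_norm_growth: "filterlim (\<lambda>y. y * L2norm hl (\<psi> (\<i> * of_real y))) at_top at_top"
proof (rule filterlim_at_top_if_small)
  fix \<delta> :: real assume "\<delta> > 0"
  obtain w where w: "w \<in> Dstar l q" "w l = 0" "D1 l w l = 1" "L2norm hl w \<le> \<delta>"
    using boundary_test_function[OF \<open>\<delta> > 0\<close>] .
  define C where "C = L2norm hl (sl_expr l q w)"
  have "\<forall>\<^sub>F y in at_top. y \<le> y * L2norm hl (\<psi> (\<i> * of_real y)) * (y * \<delta> + C)"
    using eventually_gt_at_top[of 0]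
  proof eventually_elim
    case (elim y)
    let ?n = "L2norm hl (\<psi> (\<i> * of_real y))"
    have "1 \<le> ?n * (y * L2norm hl w + C)"
      using Green_test_bound[OF w(1), of "\<i> * of_real y"] w(2,3) elim by (simp add: C_def norm_mult)
    also have "\<dots> \<le> ?n * (y * \<delta> + C)"
      using w(4) elim by (intro mult_left_mono add_right_mono) auto
    finally have "y * 1 \<le> y * (?n * (y * \<delta> + C))" using elim by (intro mult_left_mono) auto
    then show ?case by (simp add: mult.assoc)
  qed
  then show "\<exists>C\<ge>0. \<forall>\<^sub>F y in at_top. y \<le> y * L2norm hl (\<psi> (\<i> * of_real y)) * (y * \<delta> + C)"
    by (intro exI[of _ C]) (simp add: C_def)
qed

text \<open>
  With \<open>w l = 1\<close> and \<open>w' l = - r\<close> the boundary term \<open>m w(l) + w'(l)\<close> is \<open>m - r\<close>.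
\<close>

lemma psi_norm_quotient_growth:
  "filterlim (\<lambda>y. y * L2norm hl (\<psi> (\<i> * of_real y)) / cmod (m (\<i> * of_real y) - of_real r)) at_top at_top"
proof (rule filterlim_at_top_if_small)
  fix \<delta> :: real assume "\<delta> > 0"
  obtain w where w: "w \<in> Dstar l q" "w l = 1" "D1 l w l = - of_real r" "L2norm hl w \<le> \<delta>"
    using boundary_test_function[OF \<open>\<delta> > 0\<close>] .
  define C where "C = L2norm hl (sl_expr l q w)"
  have "\<forall>\<^sub>F y in at_top. y \<le> y * L2norm hl (\<psi> (\<i> * of_real y)) / cmod (m (\<i> * of_real y) - of_real r) * (y * \<delta> + C)"
    using eventually_gt_at_top[of 0]
  proof eventually_elim
    case (elim y)
    let ?n = "L2norm hl (\<psi> (\<i> * of_real y))" and ?d = "cmod (m (\<i> * of_real y) - of_real r)"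
    have "Im (m (\<i> * of_real y) - of_real r) \<noteq> 0" using Im_m_nonzero[of "\<i> * of_real y"] elim by simp
    then have d: "?d > 0" by auto
    have "?d \<le> ?n * (y * L2norm hl w + C)"
      using Green_test_bound[OF w(1), of "\<i> * of_real y"] w(2,3) elim by (simp add: C_def norm_mult)
    also have "\<dots> \<le> ?n * (y * \<delta> + C)"
      using w(4) elim by (intro mult_left_mono add_right_mono) auto
    finally have "1 \<le> ?n * (y * \<delta> + C) / ?d" using d by simp
    then have "y * 1 \<le> y * (?n * (y * \<delta> + C) / ?d)" using elim by (intro mult_left_mono) auto
    then show ?case by (simp add: mult.assoc)
  qed
  then show "\<exists>C\<ge>0. \<forall>\<^sub>F y in at_top. y \<le> y * L2norm hl (\<psi> (\<i> * of_real y)) / cmod (m (\<i> * of_real y) - of_real r) * (y * \<delta> + C)"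
    by (intro exI[of _ C]) (simp add: C_def)
qed

end

section \<open>Transfer and impedance functions\<close>

context limit_point_problem
begin

lemma fundamental_solutions_independent:
  assumes "x \<ge> l"
  shows "\<phi>1 z x \<noteq> 0 \<or> \<phi>2 z x \<noteq> 0"
  using solution_wronskian[OF phi1(1) phi2(1) order_refl assms, of z z]
  by (auto simp: wronskian_def phi1(2,3) phi2(2,3))

text \<open>
  Green's formula for \<open>y\<close> and \<open>cnj w\<close>; it expresses the adjoint of a state-space operator, and so its
  real part, by boundary values.
\<close>

lemma inner_Green:
  assumes y: "y \<in> Dstar l q" and w: "w \<in> Dstar l q"
  shows "cnj (inner_L2 l (sl_expr l q w) y)
      = inner_L2 l (sl_expr l q y) w - D1 l y l * cnj (w l) + y l * cnj (D1 l w l)"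
proof -
  have "AE x in lebesgue. x \<ge> l \<longrightarrow> sl_expr l q (\<lambda>x. cnj (w x)) x = cnj (sl_expr l q w x)"
    by (rule sl_regular_cnj(3)[OF DstarD(1)[OF w]])
  from Green_AE[OF y Dstar_cnj[OF w] _ this, of "sl_expr l q y"]
  have "inner_L2 l (sl_expr l q y) w - (LINT x|hl. y x * cnj (sl_expr l q w x)) = D1 l y l * cnj (w l) - y l * cnj (D1 l w l)"
    using sl_regular_cnj(2)[OF DstarD(1)[OF w] order_refl] by (simp add: inner_L2_eq)
  moreover have "cnj (inner_L2 l (sl_expr l q w) y) = (LINT x|hl. y x * cnj (sl_expr l q w x))"
    unfolding inner_L2_eq Bochner_Integration.integral_cnj[symmetric] by (simp add: mult.commute)
  ultimately show ?thesis by (simp add: algebra_simps)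
qed

lemma inner_L2_diff:
  assumes "sq_integrable hl f" "sq_integrable hl g" "sq_integrable hl w"
  shows "inner_L2 l (\<lambda>x. f x - c * g x) w = inner_L2 l f w - c * inner_L2 l g w"
proof -
  have w: "sq_integrable hl (\<lambda>x. cnj (w x))" using assms(3) by simp
  have "inner_L2 l (\<lambda>x. f x - c * g x) w = (LINT x|hl. f x * cnj (w x) - c * (g x * cnj (w x)))"
    by (simp add: inner_L2_eq algebra_simps)
  also have "\<dots> = inner_L2 l f w - c * inner_L2 l g w"
    using sq_integrable_mult[OF assms(1) w] sq_integrable_mult[OF assms(2) w] by (simp add: inner_L2_eq)
  finally show ?thesis .
qed

text \<open>
  All forms in question are \<open>(l(y), w)\<close> plus a boundary term of rank one.  Testing
  \<open>(\<A> - z) y = g\<close> with the minimal domain gives \<open>l(y) = z y\<close>, hence \<open>y = k \<psi>\<close>, and the boundary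
  term fixes \<open>k\<close>.
\<close>

lemma compressed_resolvent_eq:
  fixes a0 a1 \<Lambda>0 \<Lambda>1 s :: complex
  defines "a \<equiv> \<lambda>y. a0 * y l + a1 * D1 l y l"
    and "\<Lambda> \<equiv> \<lambda>y. \<Lambda>0 * y l + \<Lambda>1 * D1 l y l"
  assumes z: "Im z \<noteq> 0"
    and A: "\<And>y w. y \<in> Dstar l q \<Longrightarrow> w \<in> Dstar l q \<Longrightarrow> A y w = inner_L2 l (sl_expr l q y) w - \<Lambda> y * cnj (a w)"
    and g: "\<And>w. w \<in> Dstar l q \<Longrightarrow> g w = s * cnj (a w)"
    and a_nz: "a (\<psi> z) \<noteq> 0" and \<Lambda>_nz: "\<Lambda> (\<psi> z) \<noteq> 0"
  shows "compressed_resolvent l q A g z = - s * cnj s * a (\<psi> z) / \<Lambda> (\<psi> z)"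
  unfolding compressed_resolvent_def
proof (rule the_equality)
  define k where "k = - s / \<Lambda> (\<psi> z)"
  define y where "y x = k * \<psi> z x + 0 * \<psi> z x" for x
  note r = sl_solutionD(1)[OF psi(1), of z]
  have y: "y \<in> Dstar l q" unfolding y_def[abs_def] by (intro Dstar_linear psi_Dstar z)
  have yl: "y l = k * \<psi> z l" "D1 l y l = k * D1 l (\<psi> z) l"
    unfolding y_def[abs_def] using sl_regular_linear(2)[OF r r order_refl, of k 0] by simp_all
  have ay: "a y = k * a (\<psi> z)" "\<Lambda> y = k * \<Lambda> (\<psi> z)"
    unfolding a_def \<Lambda>_def yl by (simp_all add: algebra_simps)
  have sol: "AE x in hl. sl_expr l q y x - z * y x = 0"
    unfolding AE_half_line y_def[abs_def]
    using sl_regular_linear(3)[OF r r, of q k 0] sl_solutionD(2)[OF psi(1), of z]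
    by eventually_elim auto
  have "A y w - z * inner_L2 l y w = g w" if w: "w \<in> Dstar l q" for w
  proof -
    have "inner_L2 l (\<lambda>x. sl_expr l q y x - z * y x) w = 0"
      unfolding inner_L2_eq by (rule integral_eq_zero_AE) (use sol in \<open>auto elim!: eventually_mono\<close>)
    then have "inner_L2 l (sl_expr l q y) w - z * inner_L2 l y w = 0"
      using inner_L2_diff[OF DstarD(3)[OF y] DstarD(2)[OF y] DstarD(2)[OF w]] by simp
    then show ?thesis
      using \<Lambda>_nz by (simp add: A[OF y w] g[OF w] ay k_def)
  qed
  moreover have "- s * cnj s * a (\<psi> z) / \<Lambda> (\<psi> z) = cnj (g y)"
    by (simp add: g[OF y] ay k_def)
  ultimately show "\<exists>y\<in>Dstar l q. (\<forall>w\<in>Dstar l q. A y w - z * inner_L2 l y w = g w) \<and>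
      - s * cnj s * a (\<psi> z) / \<Lambda> (\<psi> z) = cnj (g y)"
    using y by blast
next
  fix v assume "\<exists>y\<in>Dstar l q. (\<forall>w\<in>Dstar l q. A y w - z * inner_L2 l y w = g w) \<and> v = cnj (g y)"
  then obtain y where y: "y \<in> Dstar l q" and eq: "\<And>w. w \<in> Dstar l q \<Longrightarrow> A y w - z * inner_L2 l y w = g w"
    and v: "v = cnj (g y)" by blast
  let ?f = "\<lambda>x. sl_expr l q y x - z * y x"
  have f: "sq_integrable hl ?f" by (intro sq_integrable_diff sq_integrable_cmult DstarD[OF y])
  have inner: "inner_L2 l ?f w = (\<Lambda> y + s) * cnj (a w)" if w: "w \<in> Dstar l q" for w
    using eq[OF w] inner_L2_diff[OF DstarD(3)[OF y] DstarD(2)[OF y] DstarD(2)[OF w], of z]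
    by (simp add: A[OF y w] g[OF w] algebra_simps)
  have ae: "AE x in hl. ?f x = 0"
  proof (rule orthogonal_minimal_domain[OF f phi1(1)[of \<i>] phi2(1)[of \<i>] fundamental_solutions_independent])
    fix w assume "w \<in> minimal_domain l q"
    then show "inner_L2 l ?f w = 0" by (subst inner) (auto simp: minimal_domain_def a_def)
  qed
  have "inner_L2 l ?f (\<psi> z) = 0"
    unfolding inner_L2_eq by (rule integral_eq_zero_AE) (use ae in \<open>auto elim!: eventually_mono\<close>)
  then have \<Lambda>s: "\<Lambda> y + s = 0"
    using inner[OF psi_Dstar[OF z]] a_nz by simp
  have "AE x in lebesgue. x \<ge> l \<longrightarrow> sl_expr l q y x = z * y x"
    using ae unfolding AE_half_line by eventually_elim auto
  note yy = L2_solution_multiple_of_psi[OF z y this]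
  define k where "k = - y l"
  have ay: "a y = k * a (\<psi> z)" "\<Lambda> y = k * \<Lambda> (\<psi> z)"
    unfolding a_def \<Lambda>_def k_def using yy(2) by (simp_all add: psi(2,3) algebra_simps)
  have "k = - s / \<Lambda> (\<psi> z)" using \<Lambda>s \<Lambda>_nz by (simp add: ay field_simps eq_neg_iff_add_eq_0)
  then show "v = - s * cnj s * a (\<psi> z) / \<Lambda> (\<psi> z)"
    by (simp add: v g[OF y] ay)
qed

lemma m_plus_nz:
  assumes "Im z \<noteq> 0" "Im z * Im h \<le> 0"
  shows "m z + h \<noteq> 0"
proof
  assume "m z + h = 0"
  then have "Im (m z) + Im h = 0" by (metis plus_complex.sel(2) zero_complex.sel(2))
  then have h: "Im h = Im z * (L2norm hl (\<psi> z))\<^sup>2" using Im_m[OF assms(1)] by simp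
  have "Im z * Im h = (Im z)\<^sup>2 * (L2norm hl (\<psi> z))\<^sup>2" unfolding h by (simp add: power2_eq_square)
  moreover have "\<dots> > 0" using assms(1) psi_norm_pos[OF assms(1)] by simp
  ultimately show False using assms(2) by simp
qed

lemma resolvent_Infty:
  assumes z: "Im z \<noteq> 0" and h: "Im h \<ge> 0" and nz: "m z + h' \<noteq> 0"
    and A: "\<And>y w. y \<in> Dstar l q \<Longrightarrow> w \<in> Dstar l q \<Longrightarrow>
        A y w = inner_L2 l (sl_expr l q y) w - (D1 l y l - h' * y l) * cnj (w l)"
  shows "compressed_resolvent l q A (channel_vec l Infty h) z = Im h / (m z + h')"
proof -
  have "compressed_resolvent l q A (channel_vec l Infty h) z
      = - (of_real (sqrt (Im h))) * cnj (of_real (sqrt (Im h))) * (1 * \<psi> z l + 0 * D1 l (\<psi> z) l) / (- h' * \<psi> z l + 1 * D1 l (\<psi> z) l)"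
    by (rule compressed_resolvent_eq[OF z]) (use nz in \<open>simp_all add: A delta_def psi(2,3) add.commute\<close>)
  also have "\<dots> = of_real (sqrt (Im h) * sqrt (Im h)) / (m z + h')"
    unfolding of_real_mult by (simp add: psi(2,3) add.commute)
  finally show ?thesis using h by simp
qed

lemma impedance_Infty:
  assumes z: "Im z \<noteq> 0" and h: "Im h \<ge> 0"
  shows "impedance_function l q Infty h z = Im h / (m z + Re h)"
  unfolding impedance_function_def
proof (rule resolvent_Infty[OF z h])
  show "m z + complex_of_real (Re h) \<noteq> 0" by (rule m_plus_nz[OF z]) simp
  fix y w assume y: "y \<in> Dstar l q" and w: "w \<in> Dstar l q"
  have "re_part (state_op l q Infty h) y w = (inner_L2 l (sl_expr l q y) w - (D1 l y l - h * y l) * cnj (w l)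
      + (cnj (inner_L2 l (sl_expr l q w) y) - (cnj (D1 l w l) - cnj h * cnj (w l)) * y l)) / 2"
    by (simp add: re_part_def delta_def)
  also have "\<dots> = inner_L2 l (sl_expr l q y) w - (D1 l y l - (h + cnj h) / 2 * y l) * cnj (w l)"
    unfolding inner_Green[OF y w] by (simp add: field_simps)
  also have "(h + cnj h) / 2 = complex_of_real (Re h)" by (simp add: complex_add_cnj)
  finally show "re_part (state_op l q Infty h) y w
      = inner_L2 l (sl_expr l q y) w - (D1 l y l - complex_of_real (Re h) * y l) * cnj (w l)" .
qed

lemma transfer_Infty:
  assumes z: "Im z < 0" and h: "Im h > 0"
  shows "transfer_function l q Infty h z = (m z + cnj h) / (m z + h)"
proof -
  have nz: "m z + h \<noteq> 0" by (rule m_plus_nz) (use z h in \<open>auto simp: mult_le_0_iff\<close>)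
  have "compressed_resolvent l q (state_op l q Infty h) (channel_vec l Infty h) z = Im h / (m z + h)"
    by (rule resolvent_Infty[OF _ _ nz]) (use z h in \<open>auto simp: delta_def\<close>)
  then have "transfer_function l q Infty h z = (m z + (h - 2 * \<i> * Im h)) / (m z + h)"
    using nz by (simp add: transfer_function_def field_simps)
  also have "h - 2 * \<i> * Im h = cnj h" by (simp add: complex_eq_iff)
  finally show ?thesis .
qed

text \<open>
  In the boundary values \<open>y(l)\<close> and \<open>a(y) = \<mu> y(l) - y'(l)\<close>, the state-space operator has the boundary
  term \<open>(y(l) - \<tau> a(y)) cnj (a(w))\<close> with \<open>\<tau> = 1 / (\<mu> - h)\<close>, and passing to the real part merely
  replaces \<open>\<tau>\<close> by \<open>Re \<tau>\<close>.
\<close>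

lemma resolvent_Fin:
  fixes \<mu> :: real and h :: complex
  defines "s \<equiv> sqrt (Im h) / cmod (of_real \<mu> - h)"
  assumes z: "Im z \<noteq> 0" and h: "Im h > 0" and nz: "\<tau> * (\<mu> + m z) - 1 \<noteq> 0"
    and A: "\<And>y w. y \<in> Dstar l q \<Longrightarrow> w \<in> Dstar l q \<Longrightarrow>
        A y w = inner_L2 l (sl_expr l q y) w - (y l - \<tau> * (of_real \<mu> * y l - D1 l y l)) * cnj (of_real \<mu> * w l - D1 l w l)"
  shows "compressed_resolvent l q A (channel_vec l (Fin \<mu>) h) z
      = of_real (Im h / (cmod (of_real \<mu> - h))\<^sup>2) * (\<mu> + m z) / (\<tau> * (\<mu> + m z) - 1)"
proof -
  have mu: "\<mu> + m z \<noteq> 0"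
    using m_plus_nz[OF z, of "of_real \<mu>"] by (simp add: add.commute)
  have "compressed_resolvent l q A (channel_vec l (Fin \<mu>) h) z
      = - (of_real s) * cnj (of_real s) * (\<mu> * \<psi> z l + (-1) * D1 l (\<psi> z) l)
        / ((1 - \<tau> * \<mu>) * \<psi> z l + \<tau> * D1 l (\<psi> z) l)"
  proof (rule compressed_resolvent_eq[OF z])
    have e: "of_real \<mu> * \<psi> z l + (-1) * D1 l (\<psi> z) l = - (of_real \<mu> + m z)"
      by (simp add: psi(2,3))
    show "of_real \<mu> * \<psi> z l + (-1) * D1 l (\<psi> z) l \<noteq> 0"
      unfolding e using mu by (simp only: neg_equal_0_iff_equal) simp
    show "(1 - \<tau> * \<mu>) * \<psi> z l + \<tau> * D1 l (\<psi> z) l \<noteq> 0"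
      using nz by (simp add: psi(2,3) algebra_simps)
    show "channel_vec l (Fin \<mu>) h w = of_real s * cnj (of_real \<mu> * w l + (-1) * D1 l w l)" for w
      by (simp add: s_def delta_def delta'_def)
    fix y w assume yw: "y \<in> Dstar l q" "w \<in> Dstar l q"
    have "y l - \<tau> * (of_real \<mu> * y l - D1 l y l) = (1 - \<tau> * \<mu>) * y l + \<tau> * D1 l y l"
      by (simp add: algebra_simps)
    then show "A y w = inner_L2 l (sl_expr l q y) w - ((1 - \<tau> * \<mu>) * y l + \<tau> * D1 l y l) * cnj (of_real \<mu> * w l + (-1) * D1 l w l)"
      using A[OF yw] by simp
  qed
  also have "\<dots> = of_real (s * s) * (\<mu> + m z) / (\<tau> * (\<mu> + m z) - 1)"
    by (simp add: psi(2,3) algebra_simps)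
  also have "s * s = Im h / (cmod (of_real \<mu> - h))\<^sup>2"
    using h by (simp add: s_def power2_eq_square)
  finally show ?thesis .
qed

lemma state_op_Fin:
  fixes \<mu> :: real and h :: complex and y w :: "real \<Rightarrow> complex"
  assumes "Im h > 0"
  shows "state_op l q (Fin \<mu>) h y w
    = inner_L2 l (sl_expr l q y) w - (y l - (1 / (\<mu> - h)) * (of_real \<mu> * y l - D1 l y l)) * cnj (of_real \<mu> * w l - D1 l w l)"
proof -
  have "\<mu> - h \<noteq> 0" using assms by (auto simp: complex_eq_iff)
  then have "y l - (1 / (\<mu> - h)) * (of_real \<mu> * y l - D1 l y l) = 1 / (\<mu> - h) * (D1 l y l - h * y l)"
    by (simp add: field_simps)
  then show ?thesis by (simp add: delta_def delta'_def)
qed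

lemma impedance_Fin:
  fixes \<mu> :: real and h :: complex
  assumes z: "Im z \<noteq> 0" and h: "Im h > 0"
  defines "d \<equiv> of_real \<mu> - h"
  shows "impedance_function l q (Fin \<mu>) h z
    = of_real (Im h) * (\<mu> + m z) / (of_real (Re d) * (\<mu> + m z) - of_real ((cmod d)\<^sup>2))"
proof -
  have d: "d \<noteq> 0" using h by (auto simp: d_def complex_eq_iff)
  define \<rho> where "\<rho> = Re (1 / d)"
  have rho: "\<rho> = Re d / (cmod d)\<^sup>2" by (simp add: \<rho>_def Re_divide cmod_power2)
  have nz: "of_real \<rho> * (\<mu> + m z) - 1 \<noteq> 0"
  proof
    assume 0: "of_real \<rho> * (\<mu> + m z) - 1 = 0"
    then have "Im (of_real \<rho> * (\<mu> + m z) - 1) = 0" by simp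
    then have "\<rho> * Im (m z) = 0" by simp
    then have "\<rho> = 0" using Im_m_nonzero[OF z] by simp
    then show False using 0 by simp
  qed
  have "impedance_function l q (Fin \<mu>) h z
      = of_real (Im h / (cmod (of_real \<mu> - h))\<^sup>2) * (\<mu> + m z) / (of_real \<rho> * (\<mu> + m z) - 1)"
    unfolding impedance_function_def
  proof (rule resolvent_Fin[OF z h nz])
    fix y w assume y: "y \<in> Dstar l q" and w: "w \<in> Dstar l q"
    define ay aw where "ay = of_real \<mu> * y l - D1 l y l" and "aw = of_real \<mu> * w l - D1 l w l"
    have D: "D1 l y l = of_real \<mu> * y l - ay" "D1 l w l = of_real \<mu> * w l - aw" by (simp_all add: ay_def aw_def)
    have "re_part (state_op l q (Fin \<mu>) h) y w = (inner_L2 l (sl_expr l q y) w - (y l - (1 / d) * ay) * cnj aw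
        + (cnj (inner_L2 l (sl_expr l q w) y) - (cnj (w l) - cnj (1 / d) * cnj aw) * ay)) / 2"
      unfolding re_part_def state_op_Fin[OF h] ay_def[symmetric] aw_def[symmetric] d_def[symmetric] by simp
    also have "\<dots> = inner_L2 l (sl_expr l q y) w - (y l - (1 / d + cnj (1 / d)) / 2 * ay) * cnj aw"
      unfolding inner_Green[OF y w] D by (simp add: field_simps)
    also have "(1 / d + cnj (1 / d)) / 2 = complex_of_real \<rho>"
      unfolding complex_add_cnj \<rho>_def by simp
    finally show "re_part (state_op l q (Fin \<mu>) h) y w
      = inner_L2 l (sl_expr l q y) w - (y l - of_real \<rho> * (of_real \<mu> * y l - D1 l y l)) * cnj (of_real \<mu> * w l - D1 l w l)"
      by (simp only: ay_def aw_def)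
  qed
  also have "\<dots> = of_real (Im h) * (\<mu> + m z) / (of_real ((cmod d)\<^sup>2) * (of_real \<rho> * (\<mu> + m z) - 1))"
    by (simp add: d_def)
  also have "of_real ((cmod d)\<^sup>2) * (of_real \<rho> * (\<mu> + m z) - 1) = of_real ((cmod d)\<^sup>2 * \<rho>) * (\<mu> + m z) - of_real ((cmod d)\<^sup>2)"
    by (simp add: algebra_simps)
  also have "(cmod d)\<^sup>2 * \<rho> = Re d" using d by (simp add: rho)
  finally show ?thesis .
qed

lemma transfer_Fin:
  fixes \<mu> :: real and h :: complex
  assumes z: "Im z < 0" and h: "Im h > 0"
  shows "transfer_function l q (Fin \<mu>) h z = (\<mu> - h) / (\<mu> - cnj h) * ((m z + cnj h) / (m z + h))"
proof -
  define d where "d = of_real \<mu> - h"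
  have d: "d \<noteq> 0" "cnj d \<noteq> 0" using h by (auto simp: d_def complex_eq_iff)
  have nz: "m z + h \<noteq> 0" by (rule m_plus_nz) (use z h in \<open>auto simp: mult_le_0_iff\<close>)
  have e: "(1 / d) * (\<mu> + m z) - 1 = (m z + h) / d"
    using d by (simp add: d_def field_simps)
  have "compressed_resolvent l q (state_op l q (Fin \<mu>) h) (channel_vec l (Fin \<mu>) h) z
      = of_real (Im h / (cmod (of_real \<mu> - h))\<^sup>2) * (\<mu> + m z) / ((1 / d) * (\<mu> + m z) - 1)"
    by (rule resolvent_Fin) (use z h nz d e state_op_Fin[OF h] in \<open>auto simp: d_def\<close>)
  also have "\<dots> = of_real (Im h) / of_real ((cmod d)\<^sup>2) * (\<mu> + m z) * d / (m z + h)"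
    unfolding e by (simp add: d_def)
  also have "of_real ((cmod d)\<^sup>2) = d * cnj d" by (rule complex_norm_square)
  also have "of_real (Im h) / (d * cnj d) * (\<mu> + m z) * d / (m z + h) = of_real (Im h) * (\<mu> + m z) / (cnj d * (m z + h))"
    using d(1) by simp
  finally have "transfer_function l q (Fin \<mu>) h z = (cnj d * (m z + h) - 2 * \<i> * (of_real (Im h) * (\<mu> + m z))) / (cnj d * (m z + h))"
    using d nz by (simp add: transfer_function_def diff_divide_distrib del: state_op.simps channel_vec.simps)
  also have "cnj d * (m z + h) - 2 * \<i> * (of_real (Im h) * (\<mu> + m z)) = d * (m z + cnj h)"
    by (simp add: d_def complex_eq_iff algebra_simps)
  finally show ?thesis by (simp add: d_def)
qed

text \<open>
  The first factor of the transfer function is unimodular, and \<open>m (- \<i>) = cnj (m \<i>)\<close>.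
\<close>

lemma cmod_transfer:
  assumes h: "Im h > 0"
  shows "cmod (transfer_function l q \<mu> h (- \<i>)) = cmod (m \<i> + h) / cmod (m \<i> + cnj h)"
proof -
  have mi: "m (- \<i>) = cnj (m \<i>)" using m_cnj[of \<i>] by simp
  have "cmod (cnj (m \<i>) + cnj h) = cmod (m \<i> + h)" "cmod (cnj (m \<i>) + h) = cmod (m \<i> + cnj h)"
    by (metis complex_cnj_add complex_mod_cnj complex_cnj_cnj)+
  then have q: "cmod ((m (- \<i>) + cnj h) / (m (- \<i>) + h)) = cmod (m \<i> + h) / cmod (m \<i> + cnj h)"
    by (simp add: mi norm_divide)
  show ?thesis
  proof (cases \<mu>)
    case (Fin \<mu>')
    have "cmod (of_real \<mu>' - cnj h) = cmod (of_real \<mu>' - h)"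
      by (metis complex_cnj_complex_of_real complex_cnj_diff complex_mod_cnj)
    moreover have "of_real \<mu>' - h \<noteq> 0" using h by (auto simp: complex_eq_iff)
    ultimately have one: "cmod ((of_real \<mu>' - h) / (of_real \<mu>' - cnj h)) = 1" by (simp add: norm_divide)
    have "transfer_function l q \<mu> h (- \<i>) = (of_real \<mu>' - h) / (of_real \<mu>' - cnj h) * ((m (- \<i>) + cnj h) / (m (- \<i>) + h))"
      unfolding Fin by (rule transfer_Fin) (use h in auto)
    then show ?thesis by (simp only: norm_mult[of "_ / _" "_ / _"] q one mult_1)
  next
    case Infty
    then show ?thesis using q h by (simp add: transfer_Infty)
  qed
qed

lemma c_entropy_iff:
  assumes h: "Im h > 0"
  shows "c_entropy l q \<mu> h = ereal S \<longleftrightarrow> cmod (m \<i> + h) = exp (- S) * cmod (m \<i> + cnj h)"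
proof -
  have "m \<i> + cnj h \<noteq> 0" by (rule m_plus_nz) (use h in auto)
  then have n: "cmod (m \<i> + cnj h) > 0" by simp
  let ?W = "transfer_function l q \<mu> h (- \<i>)"
  have "c_entropy l q \<mu> h = ereal S \<longleftrightarrow> ?W \<noteq> 0 \<and> - ln (cmod ?W) = S"
    by (simp add: c_entropy_def Let_def)
  also have "\<dots> \<longleftrightarrow> cmod ?W = exp (- S)"
    by (metis add.inverse_inverse exp_gt_zero exp_ln ln_exp norm_eq_zero order_less_irrefl zero_less_norm_iff)
  also have "\<dots> \<longleftrightarrow> cmod (m \<i> + h) = exp (- S) * cmod (m \<i> + cnj h)"
    unfolding cmod_transfer[OF h] using n by (simp add: field_simps)
  finally show ?thesis .
qed

end

section \<open>The Herglotz representation\<close>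

text \<open>
  Runs once through the unit circle as \<open>t\<close> runs through \<open>[0, 1]\<close>.
\<close>

definition circ :: "real \<Rightarrow> complex" where
  "circ t = exp (2 * of_real pi * \<i> * of_real t)"

lemma norm_circ [simp]: "cmod (circ t) = 1"
proof -
  have "circ t = cis (2 * pi * t)" by (simp add: circ_def cis_conv_exp mult_ac)
  then show ?thesis by simp
qed

lemma circ_nz [simp]: "circ t \<noteq> 0"
  using norm_circ[of t] by (metis norm_zero zero_neq_one)

lemma cnj_circ: "cnj (circ t) = inverse (circ t)"
  using complex_norm_square[of "circ t"] by (simp add: field_simps)

lemma continuous_circ [continuous_intros]: "continuous_on A circ"
  unfolding circ_def[abs_def] by (intro continuous_intros)

lemma circ_minus_nz: "cmod \<zeta> < 1 \<Longrightarrow> circ t - \<zeta> \<noteq> 0"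
  using norm_circ[of t] by auto

lemma Cauchy_circle:
  assumes g: "g holomorphic_on ball 0 R" and R: "R > 1" and w: "cmod w < 1"
  shows "((\<lambda>t. g (circ t) * circ t / (circ t - w)) has_integral g w) {0..1}"
proof -
  have "g holomorphic_on cball 0 1" by (rule holomorphic_on_subset[OF g]) (use R in auto)
  then have "((\<lambda>u. g u / (u - w)) has_contour_integral (2 * of_real pi * \<i> * g w)) (circlepath 0 1)"
    using w by (intro Cauchy_integral_circlepath_simple) auto
  then have "((\<lambda>t. g (circ t) / (circ t - w) * (2 * pi * \<i> * circ t)) has_integral (2 * of_real pi * \<i> * g w)) {0..1}"
    unfolding has_contour_integral
    by (rule has_integral_eq[rotated])
      (simp only: vector_derivative_circlepath vector_derivative_circlepath01 atLeastAtMost_iff, simp add: circlepath circ_def)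
  then have "((\<lambda>t. (1 / (2 * pi * \<i>)) * (g (circ t) / (circ t - w) * (2 * pi * \<i> * circ t)))
      has_integral (1 / (2 * pi * \<i>)) * (2 * of_real pi * \<i> * g w)) {0..1}"
    by (rule has_integral_mult_right)
  then show ?thesis by (simp add: field_simps)
qed

text \<open>
  Cauchy's formula for \<open>w\<close>, plus the conjugate of the one that belongs to the reflection \<open>1 / cnj w\<close>
  of \<open>w\<close> in the circle: \<open>g(u) / (1 - cnj w \<cdot> u)\<close> is holomorphic in the disc and has the value \<open>g(0)\<close> at \<open>0\<close>.
\<close>

lemma Schwarz_formula:
  assumes g: "g holomorphic_on ball 0 R" and R: "R > 1" and w: "cmod w < 1"
  shows "((\<lambda>t. complex_of_real (Re (g (circ t))) * ((circ t + w) / (circ t - w)))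
      has_integral (g w - \<i> * Im (g 0))) {0..1}"
proof -
  have 1: "((\<lambda>t. g (circ t) * circ t / (circ t - w)) has_integral g w) {0..1}"
    by (rule Cauchy_circle[OF g R w])
  have 0: "((\<lambda>t. g (circ t)) has_integral g 0) {0..1}"
    using Cauchy_circle[OF g R, of 0] by simp
  have 2: "((\<lambda>t. cnj (g (circ t)) * circ t / (circ t - w)) has_integral cnj (g 0)) {0..1}"
  proof (cases "w = 0")
    case True
    have "((\<lambda>t. cnj (g (circ t))) has_integral cnj (g 0)) {0..1}"
      using has_integral_linear[OF 0 bounded_linear_cnj] by (simp add: o_def)
    then show ?thesis using True by simp
  next
    case False
    define R' where "R' = min R (1 / cmod w)"
    have R': "R' > 1" using R w False by (simp add: R'_def)
    have nz: "1 - cnj w * u \<noteq> 0" if "u \<in> ball 0 R'" for u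
    proof
      assume "1 - cnj w * u = 0"
      then have "cmod (cnj w * u) = 1" by (metis eq_iff_diff_eq_0 norm_one)
      then have "cmod u = 1 / cmod w" using False by (simp add: norm_mult field_simps)
      then show False using that by (simp add: R'_def)
    qed
    have "(\<lambda>u. g u / (1 - cnj w * u)) holomorphic_on ball 0 R'"
      by (intro holomorphic_intros holomorphic_on_subset[OF g] nz) (auto simp: R'_def)
    from Cauchy_circle[OF this R', of 0]
    have "((\<lambda>t. g (circ t) / (1 - cnj w * circ t)) has_integral g 0) {0..1}" by simp
    from has_integral_linear[OF this bounded_linear_cnj]
    have "((\<lambda>t. cnj (g (circ t) / (1 - cnj w * circ t))) has_integral cnj (g 0)) {0..1}"
      by (simp only: o_def)
    moreover have "cnj (g (circ t) / (1 - cnj w * circ t)) = cnj (g (circ t)) * circ t / (circ t - w)" for t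
      using circ_minus_nz[OF w, of t] by (simp add: cnj_circ field_simps)
    ultimately show ?thesis by simp
  qed
  have "((\<lambda>t. complex_of_real (Re (g (circ t)))) has_integral complex_of_real (Re (g 0))) {0..1}"
    using has_integral_linear[OF 0 bounded_linear_compose[OF bounded_linear_of_real bounded_linear_Re]]
    by (simp add: o_def)
  from has_integral_diff[OF has_integral_add[OF 1 2] this]
  have "((\<lambda>t. g (circ t) * circ t / (circ t - w) + cnj (g (circ t)) * circ t / (circ t - w) - complex_of_real (Re (g (circ t))))
    has_integral (g w + cnj (g 0) - complex_of_real (Re (g 0)))) {0..1}" .
  moreover have "g (circ t) * circ t / (circ t - w) + cnj (g (circ t)) * circ t / (circ t - w) - complex_of_real (Re (g (circ t)))
      = complex_of_real (Re (g (circ t))) * ((circ t + w) / (circ t - w))" for t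
  proof -
    have "g (circ t) * circ t / (circ t - w) + cnj (g (circ t)) * circ t / (circ t - w)
        = (g (circ t) + cnj (g (circ t))) * (circ t / (circ t - w))"
      by (simp add: distrib_right add_divide_distrib)
    also have "g (circ t) + cnj (g (circ t)) = 2 * complex_of_real (Re (g (circ t)))" by (simp add: complex_add_cnj)
    finally show ?thesis using circ_minus_nz[OF w, of t] by (simp add: field_simps)
  qed
  moreover have "g w + cnj (g 0) - complex_of_real (Re (g 0)) = g w - \<i> * Im (g 0)"
    by (simp add: complex_eq_iff)
  ultimately show ?thesis by simp
qed

text \<open>
  On circles of radius below one the measures have the densities \<open>Re f\<close>; they live on a compact
  interval, so Helly's theorem gives a limit.
\<close>

lemma Herglotz_disc:
  assumes f: "f holomorphic_on ball 0 1" and pos: "\<And>w. cmod w < 1 \<Longrightarrow> Re (f w) \<ge> 0"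
    and f0: "f 0 = complex_of_real c" and c: "c > 0"
  obtains N where "real_distribution N"
    "\<And>w. cmod w < 1 \<Longrightarrow> f w = of_real c * (LINT t|N. (circ t + w) / (circ t - w))"
proof -
  define r where "r n = 1 - 1 / (real n + 2)" for n
  have r: "r n > 0" "r n < 1" for n by (auto simp: r_def field_simps)
  define g where "g n w = f (of_real (r n) * w)" for n w
  define D where "D n t = indicator {0..1} t * Re (g n (circ t)) / c" for n t
  define M where "M n = density lborel (\<lambda>t. ennreal (D n t))" for n
  have g: "g n holomorphic_on ball 0 (1 / r n)" for n
    unfolding g_def[abs_def]
    by (rule holomorphic_on_compose_gen[OF _ f, unfolded o_def])
      (use r[of n] in \<open>auto intro!: holomorphic_intros simp: norm_mult field_simps\<close>)
  have R: "1 / r n > 1" for n using r[of n] by (simp add: field_simps)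
  have g0: "g n 0 = complex_of_real c" for n by (simp add: g_def f0)
  have gpos: "Re (g n (circ t)) \<ge> 0" for n t
    unfolding g_def by (rule pos) (use r[of n] in \<open>simp add: norm_mult\<close>)
  have gcont: "continuous_on {0..1} (\<lambda>t. g n (circ t))" for n
    by (rule continuous_on_compose2[OF holomorphic_on_imp_continuous_on[OF g[of n]]])
      (use R[of n] in \<open>auto intro!: continuous_intros\<close>)
  have Dnn: "D n t \<ge> 0" for n t using gpos[of n t] c by (simp add: D_def)
  have Dm [measurable]: "D n \<in> borel_measurable borel" for n
  proof -
    have "(\<lambda>t. indicator {0..1} t *\<^sub>R (Re (g n (circ t)) / c)) \<in> borel_measurable borel"
      by (rule borel_measurable_continuous_on_indicator) (auto intro!: continuous_intros gcont simp: c[THEN less_imp_neq, symmetric])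
    then show ?thesis by (simp add: D_def[abs_def])
  qed
  have int: "(LINT t|M n. (circ t + w) / (circ t - w)) = g n w / of_real c" if w: "cmod w < 1" for n w
  proof -
    let ?K = "\<lambda>t. (circ t + w) / (circ t - w)"
    have Kc: "continuous_on A ?K" for A
      by (intro continuous_intros) (use circ_minus_nz[OF w] in auto)
    have Km: "?K \<in> borel_measurable borel" by (rule borel_measurable_continuous_onI[OF Kc])
    have "(LINT t|M n. ?K t) = (LINT t|lborel. D n t *\<^sub>R ?K t)"
      unfolding M_def by (rule integral_density) (use Km Dnn in auto)
    also have "\<dots> = (LINT t:{0..1}|lborel. complex_of_real (Re (g n (circ t))) * ?K t / of_real c)"
      unfolding set_lebesgue_integral_def
      by (rule Bochner_Integration.integral_cong) (auto simp: D_def indicator_def scaleR_conv_of_real)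
    also have "\<dots> = integral {0..1} (\<lambda>t. complex_of_real (Re (g n (circ t))) * ?K t / of_real c)"
      by (rule set_borel_integral_eq_integral(2), rule borel_integrable_atLeastAtMost')
        (intro continuous_intros gcont Kc; use c in auto)
    also have "\<dots> = (g n w - \<i> * Im (g n 0)) / of_real c"
      by (rule integral_unique, rule has_integral_divide, rule Schwarz_formula[OF g R w])
    finally show ?thesis by (simp add: g0)
  qed
  have ind: "integral\<^sup>N lborel (\<lambda>t. ennreal (D n t)) = 1" for n
  proof -
    have "((\<lambda>t. Re (g n (circ t)) / c) has_integral 1) {0..1}"
    proof -
      have "((\<lambda>t. g n (circ t)) has_integral g n 0) {0..1}"
        using Cauchy_circle[OF g[of n] R[of n], of 0] by simp
      from has_integral_linear[OF this bounded_linear_Re]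
      have "((\<lambda>t. Re (g n (circ t))) has_integral c) {0..1}" by (simp add: o_def g0)
      then show ?thesis using has_integral_divide[of "\<lambda>t. Re (g n (circ t))" c "{0..1}" c] c by simp
    qed
    then have h: "(D n has_integral 1) UNIV"
      unfolding D_def[abs_def] has_integral_restrict_UNIV[of "{0..1}", symmetric] 
      by (rule has_integral_eq[rotated]) (auto simp: indicator_def)
    show ?thesis
      using nn_integral_has_integral_lborel[OF Dm Dnn h] by simp
  qed
  have Mdist: "real_distribution (M n)" for n
    unfolding real_distribution_def real_distribution_axioms_def
  proof
    show "prob_space (M n)"
      by (rule prob_spaceI) (simp add: M_def emeasure_density ind)
  qed (simp add: M_def)
  have "tight M"
    unfolding tight_def
  proof (intro conjI allI impI Mdist)
    fix e :: real assume "e > 0"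
    have "measure (M n) {-1<..1} = 1" for n
    proof -
      have "emeasure (M n) {-1<..1} = (\<integral>\<^sup>+t. ennreal (D n t) * indicator {-1<..1} t \<partial>lborel)"
        unfolding M_def by (rule emeasure_density) auto
      also have "\<dots> = (\<integral>\<^sup>+t. ennreal (D n t) \<partial>lborel)"
        by (rule nn_integral_cong) (auto simp: D_def indicator_def)
      finally show ?thesis by (simp add: ind measure_def)
    qed
    then show "\<exists>a b. a < b \<and> (\<forall>n. 1 - e < measure (M n) {a<..b})"
      using \<open>e > 0\<close> by (intro exI[of _ "-1"] exI[of _ 1]) auto
  qed
  then obtain s N where s: "strict_mono s" and N: "real_distribution N" and conv: "weak_conv_m (M \<circ> id \<circ> s) N"
    using tight_imp_convergent_subsubsequence[of M id] by (auto simp: strict_mono_id)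
  show thesis
  proof (rule that[OF N])
    fix w :: complex assume w: "cmod w < 1"
    let ?K = "\<lambda>t. (circ t + w) / (circ t - w)"
    have bd: "norm (?K t) \<le> 2 / (1 - cmod w)" for t
    proof -
      have "cmod (circ t + w) \<le> 2" using norm_triangle_ineq[of "circ t" w] w by simp
      moreover have "1 - cmod w \<le> cmod (circ t - w)" using norm_triangle_ineq2[of "circ t" w] by simp
      ultimately show ?thesis using w by (auto simp: norm_divide intro!: frac_le)
    qed
    have ct: "isCont ?K t" for t
    proof -
      have "continuous_on UNIV ?K" by (intro continuous_intros) (use circ_minus_nz[OF w] in auto)
      then show ?thesis by (simp add: continuous_on_eq_continuous_at)
    qed
    have "(\<lambda>n. LINT t|(M \<circ> id \<circ> s) n. ?K t) \<longlonglongrightarrow> (LINT t|N. ?K t)"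
      by (rule weak_conv_imp_integral_bdd_continuous_conv[OF _ N conv ct bd]) (simp add: Mdist)
    then have 1: "(\<lambda>n. g (s n) w / of_real c) \<longlonglongrightarrow> (LINT t|N. ?K t)"
      by (simp add: int[OF w])
    have "(\<lambda>n. g n w) \<longlonglongrightarrow> f w"
    proof -
      have "r \<longlonglongrightarrow> 1" unfolding r_def[abs_def] by real_asymp
      then have "(\<lambda>n. of_real (r n) * w) \<longlonglongrightarrow> of_real 1 * w" by (intro tendsto_intros)
      moreover have "isCont f w"
        using holomorphic_on_imp_continuous_on[OF f] w by (simp add: continuous_on_eq_continuous_at)
      ultimately show ?thesis unfolding g_def using isCont_tendsto_compose[of w f] by simp
    qed
    then have "(\<lambda>n. g (s n) w / of_real c) \<longlonglongrightarrow> f w / of_real c"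
      using c s by (intro tendsto_divide tendsto_const) (auto dest: LIMSEQ_subseq_LIMSEQ simp: o_def)
    with 1 have "f w / of_real c = (LINT t|N. ?K t)" by (metis LIMSEQ_unique)
    then show "f w = of_real c * (LINT t|N. ?K t)" using c by (simp add: field_simps)
  qed
qed

lemma circ_measurable [measurable]: "circ \<in> borel_measurable borel"
  by (rule borel_measurable_continuous_onI[OF continuous_circ])

text \<open>
  The Cayley transform turns the circle into the real line; the point \<open>1\<close> of the circle goes to
  infinity and contributes the linear term.
\<close>

lemma Cayley_real:
  assumes "circ s \<noteq> 1"
  shows "\<i> * (1 + circ s) / (1 - circ s) = of_real (Re (\<i> * (1 + circ s) / (1 - circ s)))"
proof -
  have "cnj (\<i> * (1 + circ s) / (1 - circ s)) = \<i> * (1 + circ s) / (1 - circ s)"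
    using assms by (simp add: cnj_circ divide_simps) (simp add: algebra_simps)
  then have "\<i> * (1 + circ s) / (1 - circ s) \<in> \<real>" by (simp add: Reals_cnj_iff)
  then show ?thesis by (simp add: of_real_Re)
qed

lemma Cayley_kernel:
  assumes "e \<noteq> 1" and t: "\<i> * (1 + e) / (1 - e) = t" and z: "z + \<i> \<noteq> 0" "t - z \<noteq> 0"
  shows "(e + (z - \<i>) / (z + \<i>)) / (e - (z - \<i>) / (z + \<i>)) = - \<i> * ((1 + t * z) / (t - z))"
proof -
  have e1: "1 - e \<noteq> 0" using assms(1) by simp
  have te: "\<i> * (1 + e) = t * (1 - e)" using t e1 by (simp add: field_simps)
  have ti: "t * (1 - e) * \<i> = - (1 + e)" unfolding te[symmetric] by (simp add: algebra_simps)
  have "e - (z - \<i>) / (z + \<i>) = (e * (z + \<i>) - (z - \<i>)) / (z + \<i>)"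
    using z(1) by (simp add: field_simps)
  also have "e * (z + \<i>) - (z - \<i>) = (1 - e) * (t - z)"
    using te by (simp add: algebra_simps)
  finally have d: "e - (z - \<i>) / (z + \<i>) = (1 - e) * (t - z) / (z + \<i>)" .
  have "e + (z - \<i>) / (z + \<i>) = (e * (z + \<i>) + (z - \<i>)) / (z + \<i>)"
    using z(1) by (simp add: field_simps)
  also have "e * (z + \<i>) + (z - \<i>) = (1 - e) * (- \<i> * (1 + t * z))"
  proof -
    have "(1 - e) * (- \<i> * (1 + t * z)) = - \<i> * (1 - e) - (t * (1 - e) * \<i>) * z"
      by (simp add: algebra_simps)
    also have "\<dots> = - \<i> * (1 - e) + (1 + e) * z" unfolding ti by (simp add: algebra_simps)
    finally show ?thesis by (simp add: algebra_simps)
  qed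
  finally have n: "e + (z - \<i>) / (z + \<i>) = (1 - e) * (- \<i> * (1 + t * z)) / (z + \<i>)" .
  show ?thesis unfolding n d using e1 z by simp
qed

lemma Herglotz_half_plane:
  assumes V: "V holomorphic_on {z. Im z > 0}" and pos: "\<And>z. Im z > 0 \<Longrightarrow> Im (V z) \<ge> 0"
    and Vi: "V \<i> = \<i> * of_real c" and c: "c > 0"
  obtains p and \<rho> :: "real measure" where "p \<ge> 0" "finite_measure \<rho>" "sets \<rho> = sets borel"
    "\<And>z. Im z > 0 \<Longrightarrow> V z = of_real p * z + (LINT t|\<rho>. (1 + of_real t * z) / (of_real t - z))"
proof -
  define C where "C w = \<i> * (1 + w) / (1 - w)" for w :: complex
  have ImC: "Im (C w) > 0" if "cmod w < 1" for w
  proof -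
    have w1: "1 - w \<noteq> 0" using that by auto
    have "C w = \<i> * ((1 + w) * cnj (1 - w)) / of_real ((cmod (1 - w))\<^sup>2)"
      unfolding complex_norm_square C_def mult.assoc[symmetric]
      using w1 by (subst mult_divide_mult_cancel_right) (simp_all del: complex_cnj_diff add: complex_cnj_zero_iff)
    then have "Im (C w) = Re ((1 + w) * cnj (1 - w)) / (cmod (1 - w))\<^sup>2"
      by (simp only: Im_divide_of_real) simp
    also have "Re ((1 + w) * cnj (1 - w)) = 1 - (cmod w)\<^sup>2"
      unfolding cmod_power2 by (simp add: algebra_simps power2_eq_square)
    finally show ?thesis using that w1 by (simp add: power_less_one_iff abs_square_less_1)
  qed
  define f where "f w = - \<i> * V (C w)" for w
  have "f holomorphic_on ball 0 1"
    unfolding f_def[abs_def]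
    by (intro holomorphic_intros holomorphic_on_compose_gen[OF _ V, unfolded o_def])
      (auto simp: C_def[abs_def] intro!: holomorphic_intros ImC[unfolded C_def])
  moreover have "Re (f w) \<ge> 0" if "cmod w < 1" for w
    using pos[OF ImC[OF that]] by (simp add: f_def)
  moreover have "f 0 = complex_of_real c" by (simp add: f_def C_def Vi)
  ultimately obtain N where N: "real_distribution N"
    and rep: "\<And>w. cmod w < 1 \<Longrightarrow> f w = of_real c * (LINT t|N. (circ t + w) / (circ t - w))"
    using c by (rule Herglotz_disc) (assumption, rule that, assumption, simp)
  interpret N: real_distribution N by fact
  define E where "E = {s. circ s \<noteq> 1}"
  have E [measurable]: "E \<in> sets borel" unfolding E_def by measurable
  define lam where "lam s = Re (\<i> * (1 + circ s) / (1 - circ s))" for s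
  have lam [measurable]: "lam \<in> borel_measurable borel" unfolding lam_def[abs_def] by measurable
  define \<rho> where "\<rho> = distr (density N (\<lambda>s. ennreal (c * indicator E s))) borel lam"
  define p where "p = c * measure N (- E)"
  show thesis
  proof (rule that)
    show "p \<ge> 0" using c by (simp add: p_def)
    show "sets \<rho> = sets borel" by (simp add: \<rho>_def)
    have "emeasure \<rho> UNIV = (\<integral>\<^sup>+s. ennreal (c * indicator E s) \<partial>N)"
      unfolding \<rho>_def by (simp add: emeasure_distr emeasure_density)
    also have "\<dots> \<le> (\<integral>\<^sup>+s. ennreal c \<partial>N)"
      using c by (intro nn_integral_mono ennreal_leI) (auto simp: indicator_def)
    also have "\<dots> < \<infinity>" using N.emeasure_space_1 N.space_eq_univ by simp
    finally show "finite_measure \<rho>" by (intro finite_measureI) (simp add: \<rho>_def)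
    fix z :: complex assume z: "Im z > 0"
    define w where "w = (z - \<i>) / (z + \<i>)"
    have zi: "z + \<i> \<noteq> 0" using z by (auto simp: complex_eq_iff)
    have "(cmod (z - \<i>))\<^sup>2 < (cmod (z + \<i>))\<^sup>2"
      unfolding cmod_power2 using z by (simp add: power2_eq_square algebra_simps)
    then have "cmod (z - \<i>) < cmod (z + \<i>)" by (rule power2_less_imp_less) simp
    then have w: "cmod w < 1" using zi by (simp add: w_def norm_divide)
    have "1 + w = 2 * z / (z + \<i>)" "1 - w = 2 * \<i> / (z + \<i>)"
      using zi by (simp_all add: w_def field_simps)
    then have Cw: "C w = z" using zi by (simp add: C_def)
    let ?K = "\<lambda>s. (circ s + w) / (circ s - w)"
    let ?F = "\<lambda>t::real. (1 + of_real t * z) / (of_real t - z)"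
    have Km [measurable]: "?K \<in> borel_measurable borel" by measurable
    have bd: "norm (?K t) \<le> 2 / (1 - cmod w)" for t
    proof -
      have "cmod (circ t + w) \<le> 2" using norm_triangle_ineq[of "circ t" w] w by simp
      moreover have "1 - cmod w \<le> cmod (circ t - w)" using norm_triangle_ineq2[of "circ t" w] by simp
      ultimately show ?thesis using w by (auto simp: norm_divide intro!: frac_le)
    qed
    have Ki: "integrable N ?K"
      by (rule N.integrable_const_bound[of _ "2 / (1 - cmod w)"]) (use bd in auto)
    have K1: "?K s = - \<i> * ?F (lam s)" if "s \<in> E" for s
    proof -
      have e: "circ s \<noteq> 1" using that by (simp add: E_def)
      show ?thesis
        unfolding w_def
      proof (rule Cayley_kernel[OF e _ zi])
        show "\<i> * (1 + circ s) / (1 - circ s) = complex_of_real (lam s)"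
          unfolding lam_def by (rule Cayley_real[OF e])
        show "complex_of_real (lam s) - z \<noteq> 0" using z by (auto simp: complex_eq_iff)
      qed
    qed
    have K2: "?K s = - \<i> * z" if "s \<notin> E" for s
    proof -
      have "circ s = 1" using that by (simp add: E_def)
      then have "?K s = (1 + w) / (1 - w)" by simp
      also have "\<dots> = - \<i> * C w" by (simp add: C_def)
      finally show ?thesis by (simp add: Cw)
    qed
    have i1: "integrable N (\<lambda>s. indicator E s *\<^sub>R ?K s)"
      by (rule integrable_mult_indicator[OF _ Ki]) simp
    have i2: "integrable N (\<lambda>s. indicator (- E) s *\<^sub>R (- \<i> * z))"
      by (rule integrable_mult_indicator) auto
    have "(LINT s|N. ?K s) = (LINT s|N. indicator E s *\<^sub>R ?K s + indicator (- E) s *\<^sub>R (- \<i> * z))"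
      by (rule Bochner_Integration.integral_cong) (use K2 in \<open>auto simp: indicator_def\<close>)
    also have "\<dots> = (LINT s|N. indicator E s *\<^sub>R ?K s) + (LINT s|N. indicator (- E) s *\<^sub>R (- \<i> * z))"
      by (rule Bochner_Integration.integral_add[OF i1 i2])
    also have "(LINT s|N. indicator (- E) s *\<^sub>R (- \<i> * z)) = measure N (- E) *\<^sub>R (- \<i> * z)"
    proof -
      have "integrable N (\<lambda>s. indicator (- E) s *\<^sub>R (1::real))"
        by (rule integrable_mult_indicator) auto
      then show ?thesis by (subst integral_scaleR_left) auto
    qed
    finally have sum: "(LINT s|N. ?K s) = (LINT s|N. indicator E s *\<^sub>R ?K s) + measure N (- E) *\<^sub>R (- \<i> * z)" .
    have K1': "(c * indicator E s) *\<^sub>R ?F (lam s) = (\<i> * of_real c) * (indicator E s *\<^sub>R ?K s)" for s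
    proof (cases "s \<in> E")
      case True
      have "\<i> * of_real c * (- \<i> * X) = of_real c * X" for X :: complex by (simp add: complex_eq_iff)
      then show ?thesis unfolding K1[OF True] using True by (simp add: scaleR_conv_of_real del: times_divide_eq_right)
    qed simp
    have "(LINT t|\<rho>. ?F t) = (LINT s|density N (\<lambda>s. ennreal (c * indicator E s)). ?F (lam s))"
      unfolding \<rho>_def by (rule integral_distr) auto
    also have "\<dots> = (LINT s|N. (c * indicator E s) *\<^sub>R ?F (lam s))"
      by (rule integral_density) (use c in auto)
    also have "\<dots> = (LINT s|N. (\<i> * of_real c) * (indicator E s *\<^sub>R ?K s))"
      by (rule Bochner_Integration.integral_cong)
        (simp, rule K1')
    also have "\<dots> = \<i> * of_real c * (LINT s|N. indicator E s *\<^sub>R ?K s)"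
      by (rule integral_mult_right_zero)
    finally have F: "(LINT t|\<rho>. ?F t) = \<i> * of_real c * (LINT s|N. indicator E s *\<^sub>R ?K s)" .
    have "V z = \<i> * f w" by (simp add: f_def Cw)
    also have "\<dots> = \<i> * of_real c * ((LINT s|N. indicator E s *\<^sub>R ?K s) + measure N (- E) *\<^sub>R (- \<i> * z))"
      unfolding rep[OF w] sum by simp
    also have "\<dots> = of_real p * z + (LINT t|\<rho>. ?F t)"
      unfolding F by (simp add: p_def scaleR_conv_of_real algebra_simps)
    finally show "V z = of_real p * z + (LINT t|\<rho>. ?F t)" .
  qed
qed

text \<open>
  Along the imaginary axis the representation gives \<open>Im V(i y) / y \<ge> p\<close>, and \<open>y Im V(i y)\<close> is at
  most the total mass of \<open>\<sigma>\<close>; so the two growth conditions exclude a linear term and a finite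
  measure.
\<close>

theorem gen_donoghueI:
  assumes V: "V holomorphic_on {z. Im z > 0}" and pos: "\<And>z. Im z > 0 \<Longrightarrow> Im (V z) \<ge> 0"
    and sym: "\<And>z. Im z > 0 \<Longrightarrow> V (cnj z) = cnj (V z)"
    and \<kappa>: "0 \<le> \<kappa>" "\<kappa> < 1" and Vi: "V \<i> = \<i> * of_real ((1 - \<kappa>) / (1 + \<kappa>))"
    and small: "((\<lambda>y. Im (V (\<i> * of_real y)) / y) \<longlongrightarrow> 0) at_top"
    and large: "filterlim (\<lambda>y. y * Im (V (\<i> * of_real y))) at_top at_top"
  shows "V \<in> gen_donoghue \<kappa>"
proof -
  have c: "(1 - \<kappa>) / (1 + \<kappa>) > 0" using \<kappa> by simp
  obtain p and \<rho> :: "real measure" where p: "p \<ge> 0" and fin: "finite_measure \<rho>" and sets: "sets \<rho> = sets borel"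
    and rep: "\<And>z. Im z > 0 \<Longrightarrow> V z = of_real p * z + (LINT t|\<rho>. (1 + of_real t * z) / (of_real t - z))"
    by (rule Herglotz_half_plane[OF V pos Vi c]) (assumption, rule that, assumption, assumption, assumption, simp)
  interpret \<rho>: finite_measure \<rho> by fact
  note [measurable_cong] = sets
  have space: "space \<rho> = UNIV" using sets_eq_imp_space_eq[OF sets] by simp
  define F where "F z t = (1 + of_real t * z) / (of_real t - z)" for z :: complex and t :: real
  have Fm [measurable]: "F z \<in> borel_measurable borel" for z unfolding F_def[abs_def] by measurable
  have axis: "Im (F (\<i> * of_real y) t) = y * (1 + t\<^sup>2) / (t\<^sup>2 + y\<^sup>2)" for y t
    by (simp add: F_def Im_divide power2_eq_square algebra_simps)
  have Fbd: "norm (F (\<i> * of_real y) t) \<le> max y (1 / y)" if y: "y > 0" for y t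
  proof -
    have "(cmod (1 + of_real t * (\<i> * of_real y)))\<^sup>2 = 1 + t\<^sup>2 * y\<^sup>2"
      unfolding cmod_power2 by (simp add: power_mult_distrib)
    also have "\<dots> \<le> (max y (1 / y))\<^sup>2 * (t\<^sup>2 + y\<^sup>2)"
    proof -
      have "1 = (1 / y)\<^sup>2 * y\<^sup>2" using y by (simp add: power_divide)
      also have "\<dots> \<le> (max y (1 / y))\<^sup>2 * y\<^sup>2" using y by (intro mult_right_mono power_mono) auto
      finally have 1: "1 \<le> (max y (1 / y))\<^sup>2 * y\<^sup>2" .
      have "t\<^sup>2 * y\<^sup>2 \<le> t\<^sup>2 * (max y (1 / y))\<^sup>2" using y by (intro mult_left_mono power_mono) auto
      then show ?thesis using 1 by (simp add: algebra_simps)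
    qed
    also have "t\<^sup>2 + y\<^sup>2 = (cmod (of_real t - \<i> * of_real y))\<^sup>2" unfolding cmod_power2 by simp
    finally have "(cmod (1 + of_real t * (\<i> * of_real y)))\<^sup>2 \<le> (max y (1 / y) * cmod (of_real t - \<i> * of_real y))\<^sup>2"
      by (simp add: power_mult_distrib)
    then have "cmod (1 + of_real t * (\<i> * of_real y)) \<le> max y (1 / y) * cmod (of_real t - \<i> * of_real y)"
      by (rule power2_le_imp_le) (use y in auto)
    moreover have "cmod (of_real t - \<i> * of_real y) > 0" using y by (auto simp: complex_eq_iff)
    ultimately show ?thesis by (simp add: F_def norm_divide divide_le_eq)
  qed
  have Fi: "integrable \<rho> (F (\<i> * of_real y))" if "y > 0" for y
    by (rule \<rho>.integrable_const_bound[of _ "max y (1 / y)"]) (use Fbd[OF that] in auto)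
  have ImV: "Im (V (\<i> * of_real y)) = p * y + (LINT t|\<rho>. y * (1 + t\<^sup>2) / (t\<^sup>2 + y\<^sup>2))"
    and ImFi: "integrable \<rho> (\<lambda>t. y * (1 + t\<^sup>2) / (t\<^sup>2 + y\<^sup>2))" if y: "y > 0" for y
  proof -
    have "Im (LINT t|\<rho>. F (\<i> * of_real y) t) = (LINT t|\<rho>. Im (F (\<i> * of_real y) t))"
      by (rule integral_Im[OF Fi[OF y], symmetric])
    then show "Im (V (\<i> * of_real y)) = p * y + (LINT t|\<rho>. y * (1 + t\<^sup>2) / (t\<^sup>2 + y\<^sup>2))"
      using rep[of "\<i> * of_real y"] y unfolding F_def[symmetric] by (simp add: axis)
    show "integrable \<rho> (\<lambda>t. y * (1 + t\<^sup>2) / (t\<^sup>2 + y\<^sup>2))"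
      using integrable_Im[OF Fi[OF y]] by (simp add: axis)
  qed
  have "p \<le> 0"
  proof (rule tendsto_lowerbound[OF small])
    show "\<forall>\<^sub>F y in at_top. p \<le> Im (V (\<i> * of_real y)) / y"
      using eventually_gt_at_top[of 0]
    proof eventually_elim
      case (elim y)
      have "0 \<le> (LINT t|\<rho>. y * (1 + t\<^sup>2) / (t\<^sup>2 + y\<^sup>2))"
        using elim by (intro integral_nonneg_AE AE_I2) (simp add: add_nonneg_nonneg)
      then show ?case using elim by (simp add: ImV field_simps)
    qed
  qed simp
  then have p0: "p = 0" using p by simp
  have rep0: "V z = (LINT t|\<rho>. F z t)" if "Im z > 0" for z
    using rep[OF that] by (simp add: p0 F_def)
  define \<sigma> where "\<sigma> = density \<rho> (\<lambda>t. ennreal (1 + t\<^sup>2))"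
  have nz: "1 + t\<^sup>2 > 0" for t :: real by (simp add: add_pos_nonneg)
  have nz0 [simp]: "1 + t\<^sup>2 \<noteq> 0" for t :: real using nz[of t] by simp
  have s1: "sets \<sigma> = sets borel" by (simp add: \<sigma>_def sets)
  have cancel: "(1 + t\<^sup>2) * (1 / (1 + t\<^sup>2)) = 1" for t :: real using nz[of t] by simp
  have s2: "integrable \<sigma> (\<lambda>t. 1 / (1 + t\<^sup>2))"
    unfolding \<sigma>_def by (subst integrable_density) (auto simp: cancel intro!: AE_I2)
  have s3: "(LINT t|\<sigma>. 1 / (1 + t\<^sup>2)) = (1 - \<kappa>) / (1 + \<kappa>)"
  proof -
    have "(LINT t|\<sigma>. 1 / (1 + t\<^sup>2)) = (LINT t|\<rho>. 1)"
      unfolding \<sigma>_def by (subst integral_density) (auto simp: cancel intro!: AE_I2)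
    also have "\<dots> = Im (V (\<i> * of_real 1))"
    proof -
      have one: "1 * (1 + t\<^sup>2) / (t\<^sup>2 + 1\<^sup>2) = 1" for t :: real using nz0[of t] by (simp add: add.commute)
      have "Im (V (\<i> * of_real 1)) = p * 1 + (LINT t|\<rho>. 1 * (1 + t\<^sup>2) / (t\<^sup>2 + 1\<^sup>2))"
        by (rule ImV) simp
      then show ?thesis unfolding one p0 by simp
    qed
    finally show ?thesis by (simp add: Vi)
  qed
  have s4: "emeasure \<sigma> UNIV = \<infinity>"
  proof (rule ccontr)
    assume "emeasure \<sigma> UNIV \<noteq> \<infinity>"
    moreover have "emeasure \<sigma> UNIV = (\<integral>\<^sup>+t. ennreal (1 + t\<^sup>2) \<partial>\<rho>)"
      unfolding \<sigma>_def by (subst emeasure_density) (auto simp: sets)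
    ultimately have int: "integrable \<rho> (\<lambda>t. 1 + t\<^sup>2)"
      by (intro integrableI_nonneg) (auto simp: less_top add_nonneg_nonneg intro!: AE_I2)
    have "\<forall>\<^sub>F y in at_top. y * Im (V (\<i> * of_real y)) \<le> (LINT t|\<rho>. 1 + t\<^sup>2)"
      using eventually_gt_at_top[of 0]
    proof eventually_elim
      case (elim y)
      have "y * Im (V (\<i> * of_real y)) = (LINT t|\<rho>. y * (y * (1 + t\<^sup>2) / (t\<^sup>2 + y\<^sup>2)))"
        using elim by (simp add: ImV p0 del: times_divide_eq_right)
      also have "\<dots> \<le> (LINT t|\<rho>. 1 + t\<^sup>2)"
      proof (rule integral_mono[OF Bochner_Integration.integrable_mult_right[OF ImFi[OF elim]] int])
        fix t :: real
        have "t\<^sup>2 + y\<^sup>2 > 0" using elim by (simp add: add_nonneg_pos)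
        moreover have "y * y * (1 + t\<^sup>2) \<le> (t\<^sup>2 + y\<^sup>2) * (1 + t\<^sup>2)"
          using nz[of t] by (intro mult_right_mono) (auto simp: power2_eq_square)
        ultimately show "y * (y * (1 + t\<^sup>2) / (t\<^sup>2 + y\<^sup>2)) \<le> 1 + t\<^sup>2"
          by (simp add: divide_le_eq mult.assoc mult.commute[of "1 + t\<^sup>2"])
      qed
      finally show ?case .
    qed
    moreover have "\<forall>\<^sub>F y in at_top. y * Im (V (\<i> * of_real y)) > (LINT t|\<rho>. 1 + t\<^sup>2)"
      using large by (simp add: filterlim_at_top_dense)
    ultimately have "\<forall>\<^sub>F y::real in at_top. False" by eventually_elim simp
    then show False by simp
  qed
  have Fs: "(1 + t\<^sup>2) *\<^sub>R (1 / (of_real t - z) - of_real (t / (1 + t\<^sup>2))) = F z t" if z: "Im z \<noteq> 0" for z t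
  proof -
    have d: "of_real t - z \<noteq> 0" using z by (auto simp: complex_eq_iff)
    have n: "1 + (complex_of_real t)\<^sup>2 \<noteq> 0"
      using nz[of t] by (metis of_real_1 of_real_add of_real_eq_0_iff of_real_power order_less_irrefl)
    have "(1 + t\<^sup>2) *\<^sub>R (1 / (of_real t - z) - of_real (t / (1 + t\<^sup>2)))
        = (1 + (of_real t)\<^sup>2) / (of_real t - z) - of_real t"
      using n by (simp add: scaleR_conv_of_real right_diff_distrib)
    also have "\<dots> = F z t" using d by (simp add: F_def field_simps power2_eq_square)
    finally show ?thesis .
  qed
  have Frep: "(LINT t|\<sigma>. 1 / (of_real t - z) - of_real (t / (1 + t\<^sup>2))) = (LINT t|\<rho>. F z t)" if z: "Im z \<noteq> 0" for z
  proof -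
    have "(LINT t|\<sigma>. 1 / (of_real t - z) - of_real (t / (1 + t\<^sup>2)))
        = (LINT t|\<rho>. (1 + t\<^sup>2) *\<^sub>R (1 / (of_real t - z) - of_real (t / (1 + t\<^sup>2))))"
      unfolding \<sigma>_def by (rule integral_density) (auto simp: add_nonneg_nonneg intro!: AE_I2)
    then show ?thesis by (simp only: Fs[OF z])
  qed
  have "V z = (LINT t|\<sigma>. 1 / (of_real t - z) - of_real (t / (1 + t\<^sup>2)))" if z: "Im z \<noteq> 0" for z
  proof (cases "Im z > 0")
    case True
    then show ?thesis using rep0 Frep by simp
  next
    case False
    then have z': "Im (cnj z) > 0" using z by simp
    have "F z t = cnj (F (cnj z) t)" for t by (simp add: F_def)
    then have "(LINT t|\<rho>. F z t) = cnj (LINT t|\<rho>. F (cnj z) t)"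
      by (simp only: Bochner_Integration.integral_cnj)
    also have "\<dots> = V z" using sym[OF z'] rep0[OF z'] by simp
    finally show ?thesis using Frep[OF z] by simp
  qed
  then show ?thesis
    unfolding gen_donoghue_def using \<kappa> s1 s2 s3 s4 by blast
qed

text \<open>Conversely, the value at \<open>\<i>\<close> is fixed by the normalization of the measure.\<close>

lemma gen_donoghue_at_i:
  assumes "V \<in> gen_donoghue \<kappa>"
  shows "V \<i> = \<i> * of_real ((1 - \<kappa>) / (1 + \<kappa>))"
proof -
  obtain \<sigma> :: "real measure" where s: "(LINT t|\<sigma>. 1 / (1 + t\<^sup>2)) = (1 - \<kappa>) / (1 + \<kappa>)"
    "V \<i> = (LINT t|\<sigma>. 1 / (complex_of_real t - \<i>) - complex_of_real (t / (1 + t\<^sup>2)))"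
    using assms unfolding gen_donoghue_def by force
  have "1 / (complex_of_real t - \<i>) - complex_of_real (t / (1 + t\<^sup>2)) = \<i> * complex_of_real (1 / (1 + t\<^sup>2))" for t
    by (simp add: complex_eq_iff Re_divide Im_divide power2_eq_square)
  then have "V \<i> = \<i> * (LINT t|\<sigma>. complex_of_real (1 / (1 + t\<^sup>2)))"
    unfolding s(2) by (simp only: integral_mult_right_zero)
  then show ?thesis by (simp only: integral_complex_of_real s(1))
qed

section \<open>The minimal coefficient of dissipation\<close>

lemma tanh_half_eq: "(1 - exp (- S)) / (1 + exp (- S)) = tanh (S / 2 :: real)"
proof -
  define e where "e = exp (- (S / 2))"
  have ee: "exp (- S) = e * e" unfolding e_def exp_add[symmetric] by simp
  have e: "e > 0" "exp (S / 2) = 1 / e" by (simp_all add: e_def exp_minus field_simps)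
  have "tanh (S / 2) = (1 / e - e) / (1 / e + e)" unfolding e(2)[symmetric] by (simp add: tanh_altdef e_def)
  also have "1 / e - e = (1 - e * e) / e" using e(1) by (simp add: field_simps)
  also have "1 / e + e = (1 + e * e) / e" using e(1) by (simp add: field_simps)
  finally show ?thesis using e(1) by (simp add: ee)
qed

text \<open>
  The points \<open>h\<close> with a prescribed modulus of \<open>(M + h) / (M + cnj h)\<close> form an Apollonius circle
  with centre on the line \<open>Re h = - Re M\<close>; its lowest point is \<open>Im h = - \<tau> Im M\<close>.
\<close>

lemma Apollonius_lowest_point:
  fixes M h :: complex
  assumes M: "Im M < 0" and h: "Im h > 0" and k: "0 < k" "k < 1"
    and eq: "cmod (M + h) = k * cmod (M + cnj h)"
  defines "\<tau> \<equiv> (1 - k) / (1 + k)"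
  shows "- \<tau> * Im M \<le> Im h" "Im h = - \<tau> * Im M \<Longrightarrow> Re h = - Re M"
proof -
  define X b y where "X = Re M + Re h" and "b = - Im M" and "y = Im h"
  have b: "b > 0" and y: "y > 0" using M h by (auto simp: b_def y_def)
  have "(cmod (M + h))\<^sup>2 = k\<^sup>2 * (cmod (M + cnj h))\<^sup>2" unfolding eq by (simp add: power_mult_distrib)
  then have circle: "X\<^sup>2 + (y - b)\<^sup>2 = k\<^sup>2 * (X\<^sup>2 + (y + b)\<^sup>2)"
    unfolding cmod_power2 by (simp add: X_def b_def y_def power2_eq_square algebra_simps)
  have k2: "1 - k\<^sup>2 > 0" using k by (simp add: power_less_one_iff)
  have fac: "X\<^sup>2 * (1 - k\<^sup>2) = ((1 + k) * y - (1 - k) * b) * ((1 + k) * b - (1 - k) * y)"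
    using circle by (simp add: power2_eq_square algebra_simps)
  have low: "(1 + k) * y \<ge> (1 - k) * b"
  proof (rule ccontr)
    assume "\<not> (1 + k) * y \<ge> (1 - k) * b"
    then have l: "(1 + k) * y < (1 - k) * b" by simp
    have "(1 - k) * y \<le> (1 + k) * y" using k y by (intro mult_right_mono) auto
    also have "\<dots> < (1 - k) * b" by (rule l)
    also have "\<dots> \<le> (1 + k) * b" using k b by (intro mult_right_mono) auto
    finally have "(1 + k) * b - (1 - k) * y > 0" by simp
    then have "((1 + k) * y - (1 - k) * b) * ((1 + k) * b - (1 - k) * y) < 0"
      using l by (intro mult_neg_pos) auto
    moreover have "X\<^sup>2 * (1 - k\<^sup>2) \<ge> 0" using k2 by simp
    ultimately show False using fac by simp
  qed
  have k1: "1 + k > 0" using k by simp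
  have tb: "- \<tau> * Im M = (1 - k) * b / (1 + k)" by (simp add: \<tau>_def b_def)
  show "- \<tau> * Im M \<le> Im h"
    unfolding tb y_def[symmetric] using low k1 by (simp add: divide_le_eq mult.commute)
  assume "Im h = - \<tau> * Im M"
  then have "(1 + k) * y = (1 - k) * b" using k1 unfolding tb y_def[symmetric] by (simp add: field_simps)
  then have "X\<^sup>2 * (1 - k\<^sup>2) = 0" using fac by simp
  then show "Re h = - Re M" using k2 by (simp add: X_def)
qed

context limit_point_problem
begin

text \<open>
  Here \<open>V = c / (m - r)\<close> with \<open>r = Re m(\<i>)\<close>; \<open>Im m < 0\<close> in the upper half-plane gives \<open>Im V > 0\<close>, and \<open>h0\<close> is
  chosen so that \<open>V(\<i>)\<close> has the required value.  The two growth conditions are the two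
  estimates of \<open>\<parallel>\<psi>\<parallel>\<close> along the imaginary axis.
\<close>

lemma impedance_Infty_gen_donoghue:
  assumes S: "S > 0"
  defines "h0 \<equiv> Complex (- Re (m \<i>)) (- tanh (S / 2) * Im (m \<i>))"
  shows "impedance_function l q Infty h0 \<in> gen_donoghue (exp (- S))"
proof -
  define \<tau> r c where "\<tau> = tanh (S / 2)" and "r = Re (m \<i>)" and "c = - \<tau> * Im (m \<i>)"
  have \<tau>: "\<tau> > 0" "\<tau> = (1 - exp (- S)) / (1 + exp (- S))"
    using S by (simp_all add: \<tau>_def tanh_half_eq)
  have mi: "Im (m \<i>) < 0" by (rule Im_m_neg) simp
  have c: "c > 0" unfolding c_def using \<tau>(1) mi by (simp add: mult_pos_neg)
  have h0: "Im h0 = c" "Re h0 = - r" by (simp_all add: h0_def c_def \<tau>_def r_def)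
  let ?V = "impedance_function l q Infty h0"
  have V: "?V z = of_real c / (m z - of_real r)" if "Im z \<noteq> 0" for z
    using impedance_Infty[OF that, of h0] c by (simp add: h0)
  have nz: "m z - of_real r \<noteq> 0" if "Im z \<noteq> 0" for z
    using m_plus_nz[OF that, of "of_real (- r)"] by simp
  have ImV: "Im (?V z) = c * (- Im (m z)) / (cmod (m z - of_real r))\<^sup>2" if "Im z \<noteq> 0" for z
    unfolding V[OF that] by (simp add: Im_divide cmod_power2)
  show ?thesis
  proof (rule gen_donoghueI)
    have "(\<lambda>z. of_real c / (m z - of_real r)) holomorphic_on {z. Im z > 0}"
    proof (intro holomorphic_intros)
      show "m holomorphic_on {z. Im z > 0}"
        unfolding holomorphic_on_def field_differentiable_def
        by (intro ballI exI, rule has_field_derivative_at_within, rule m_has_field_derivative) simp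
    qed (use nz in auto)
    then show "?V holomorphic_on {z. Im z > 0}"
      by (rule holomorphic_transform) (simp add: V)
    show "Im (?V z) \<ge> 0" if "Im z > 0" for z
    proof -
      have "Im z \<noteq> 0" using that by simp
      then show ?thesis unfolding ImV[OF \<open>Im z \<noteq> 0\<close>] using Im_m_neg[OF that] c
        by (intro divide_nonneg_nonneg mult_nonneg_nonneg) auto
    qed
    show "?V (cnj z) = cnj (?V z)" if "Im z > 0" for z
      using that by (simp add: V m_cnj)
    show "0 \<le> exp (- S)" "exp (- S) < 1" using S by simp_all
    have "m \<i> - of_real r = \<i> * of_real (Im (m \<i>))" by (simp add: r_def complex_eq_iff)
    then have "?V \<i> = of_real c / (\<i> * of_real (Im (m \<i>)))" by (simp add: V)
    also have "\<dots> = \<i> * of_real \<tau>" using mi by (simp add: c_def field_simps)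
    finally show "?V \<i> = \<i> * of_real ((1 - exp (- S)) / (1 + exp (- S)))" by (simp only: \<tau>(2))
    \<comment> \<open>Along the imaginary axis \<open>Im m = - y N\<^sup>2\<close>, where \<open>N\<close> is the norm of \<open>\<psi>\<close>.\<close>
    let ?N = "\<lambda>y::real. L2norm hl (\<psi> (\<i> * of_real y))" and ?d = "\<lambda>y::real. cmod (m (\<i> * of_real y) - of_real r)"
    have axis: "Im (?V (\<i> * of_real y)) = c * (y * (?N y)\<^sup>2) / (?d y)\<^sup>2" if "y > 0" for y
      using ImV[of "\<i> * of_real y"] Im_m[of "\<i> * of_real y"] that by simp
    show "((\<lambda>y. Im (?V (\<i> * of_real y)) / y) \<longlongrightarrow> 0) at_top"
    proof (rule Lim_null_comparison)
      show "\<forall>\<^sub>F y in at_top. norm (Im (?V (\<i> * of_real y)) / y) \<le> c / (y * ?N y)\<^sup>2"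
        using eventually_gt_at_top[of 0]
      proof eventually_elim
        case (elim y)
        have N: "?N y > 0" using psi_norm_pos[of "\<i> * of_real y"] elim by simp
        have "Im (m (\<i> * of_real y)) = - (y * (?N y)\<^sup>2)" using Im_m[of "\<i> * of_real y"] elim by simp
        then have "y * (?N y)\<^sup>2 \<le> ?d y"
          using abs_Im_le_cmod[of "m (\<i> * of_real y) - of_real r"] by simp
        then have d: "(y * (?N y)\<^sup>2)\<^sup>2 \<le> (?d y)\<^sup>2"
          using elim by (intro power_mono) auto
        have "norm (Im (?V (\<i> * of_real y)) / y) = c * (?N y)\<^sup>2 / (?d y)\<^sup>2"
          unfolding axis[OF elim] using elim c by (simp add: abs_mult)
        also have "\<dots> \<le> c * (?N y)\<^sup>2 / (y * (?N y)\<^sup>2)\<^sup>2"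
          using d c N elim by (intro divide_left_mono) (auto intro!: mult_pos_pos order.strict_trans2[OF _ d])
        also have "\<dots> = c / (y * ?N y)\<^sup>2" using N elim by (simp add: field_simps power2_eq_square)
        finally show ?case .
      qed
      have "((\<lambda>y. c * (inverse (y * ?N y))\<^sup>2) \<longlongrightarrow> c * 0\<^sup>2) at_top"
        by (intro tendsto_intros tendsto_inverse_0_at_top psi_norm_growth)
      then show "((\<lambda>y. c / (y * ?N y)\<^sup>2) \<longlongrightarrow> 0) at_top"
        by (simp add: divide_inverse power_inverse del: inverse_mult_distrib)
    qed
    have "filterlim (\<lambda>y. c * (y * ?N y / ?d y * (y * ?N y / ?d y))) at_top at_top"
      by (intro filterlim_tendsto_pos_mult_at_top[OF tendsto_const c] filterlim_at_top_mult_at_top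
          psi_norm_quotient_growth)
    moreover have "\<forall>\<^sub>F y in at_top. c * (y * ?N y / ?d y * (y * ?N y / ?d y)) = y * Im (?V (\<i> * of_real y))"
      using eventually_gt_at_top[of 0]
      by eventually_elim (simp add: axis power2_eq_square field_simps)
    ultimately show "filterlim (\<lambda>y. y * Im (?V (\<i> * of_real y))) at_top at_top"
      by (rule filterlim_cong[OF refl refl, THEN iffD1, rotated])
  qed
qed

text \<open>
  With \<open>h = h0\<close>, the value at \<open>\<i>\<close> excludes all finite \<open>\<mu>\<close>: it would force \<open>Im h0 = - Im m(\<i>)\<close>.
\<close>

lemma impedance_Fin_not_gen_donoghue:
  assumes S: "S > 0" and h: "Re h = - Re (m \<i>)" "Im h = - tanh (S / 2) * Im (m \<i>)"
  shows "impedance_function l q (Fin \<mu>) h \<notin> gen_donoghue (exp (- S))"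
proof
  assume "impedance_function l q (Fin \<mu>) h \<in> gen_donoghue (exp (- S))"
  then have Vi: "impedance_function l q (Fin \<mu>) h \<i> = \<i> * of_real (tanh (S / 2))"
    using gen_donoghue_at_i tanh_half_eq by metis
  define b y a t where "b = - Im (m \<i>)" and "y = Im h" and "a = \<mu> - Re h" and "t = tanh (S / 2)"
  have t: "0 < t" "t < 1" using S by (simp_all add: t_def tanh_real_lt_1)
  have b: "b > 0" using Im_m_neg[of \<i>] by (simp add: b_def)
  have "y = t * b" using h by (simp add: y_def b_def t_def)
  then have y: "y = t * b" "y > 0" using t b by simp_all
  have mm: "of_real \<mu> + m \<i> = Complex a (- b)" using h by (simp add: a_def b_def complex_eq_iff)
  have d: "Re (of_real \<mu> - h) = a" "(cmod (of_real \<mu> - h))\<^sup>2 = a\<^sup>2 + y\<^sup>2"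
    by (simp_all add: a_def y_def cmod_power2)
  define B where "B = Complex (y\<^sup>2) (a * b)"
  have "B \<noteq> 0" using y(2) by (simp add: B_def complex_eq_iff)
  have den: "of_real a * Complex a (- b) - of_real (a\<^sup>2 + y\<^sup>2) = - B"
    by (simp add: B_def complex_eq_iff power2_eq_square)
  have "impedance_function l q (Fin \<mu>) h \<i> = of_real y * Complex a (- b) / (of_real a * Complex a (- b) - of_real (a\<^sup>2 + y\<^sup>2))"
    using impedance_Fin[of \<i> h \<mu>] y(2) unfolding mm d y_def[symmetric] by simp
  then have "\<i> * of_real t = of_real y * Complex a (- b) / - B"
    unfolding Vi den t_def .
  then have "of_real y * Complex a (- b) = - (\<i> * of_real t) * B"
    using \<open>B \<noteq> 0\<close> by (simp add: field_simps)
  then have "of_real y * Complex a (- b) = - (\<i> * of_real t) * Complex (y\<^sup>2) (a * b)"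
    by (simp only: B_def)
  then have "Im (of_real y * Complex a (- b)) = Im (- (\<i> * of_real t) * Complex (y\<^sup>2) (a * b))" by (rule arg_cong)
  then have "y * b = t * y\<^sup>2" by simp
  then have "t * b * b * 1 = t * b * b * (t * t)" using y(1) by (simp add: power2_eq_square algebra_simps)
  then have "t * t = 1" using b t by simp
  moreover have "t * t < 1 * 1" using t by (intro mult_strict_mono) auto
  ultimately show False by simp
qed

end

theorem theorem20:
  fixes l S :: real
    and q :: "real \<Rightarrow> real"
    and \<phi>1 \<phi>2 :: "complex \<Rightarrow> real \<Rightarrow> complex"
    and m :: "complex \<Rightarrow> complex"
  assumes "locally_summable l q"
    and "deficiency_indices_1_1 l q"
    and "weyl_function l q \<phi>1 \<phi>2 m"
    and "S > 0"
  defines "Dmin \<equiv> - tanh (S / 2) * Im (m \<i>)"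
    and "h0 \<equiv> Complex (- Re (m \<i>)) (- tanh (S / 2) * Im (m \<i>))"
  shows "(\<exists>\<Theta> \<in> entropy_donoghue_systems l q S. dissipation_coeff \<Theta> = Dmin) \<and>
         (\<forall>\<Theta> \<in> entropy_donoghue_systems l q S. Dmin \<le> dissipation_coeff \<Theta>) \<and>
         {\<Theta> \<in> entropy_donoghue_systems l q S. dissipation_coeff \<Theta> = Dmin} = {(Infty, h0)}"
proof -
  interpret limit_point_problem l q \<phi>1 \<phi>2 m
    using assms(2,3) by (rule limit_point_problem.intro)
  define k where "k = exp (- S)"
  have k: "0 < k" "k < 1" using \<open>S > 0\<close> by (simp_all add: k_def)
  have \<tau>: "(1 - k) / (1 + k) = tanh (S / 2)" by (simp add: k_def tanh_half_eq)
  have mi: "Im (m \<i>) < 0" by (rule Im_m_neg) simp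
  have h0: "Im h0 > 0" "Im h0 = Dmin" "Re h0 = - Re (m \<i>)"
    using mi \<open>S > 0\<close> by (simp_all add: h0_def Dmin_def mult_pos_neg)
  have mem: "(Infty, h0) \<in> entropy_donoghue_systems l q S"
  proof -
    have "m \<i> + h0 = \<i> * of_real ((1 - tanh (S / 2)) * Im (m \<i>))"
      "m \<i> + cnj h0 = \<i> * of_real ((1 + tanh (S / 2)) * Im (m \<i>))"
      by (simp_all add: h0_def complex_eq_iff algebra_simps)
    then have n: "cmod (m \<i> + h0) = \<bar>1 - tanh (S / 2)\<bar> * \<bar>Im (m \<i>)\<bar>"
      "cmod (m \<i> + cnj h0) = \<bar>1 + tanh (S / 2)\<bar> * \<bar>Im (m \<i>)\<bar>"
      by (simp_all only: norm_mult norm_ii norm_of_real abs_mult mult_1)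
    have "1 - (1 - k) / (1 + k) = k * (1 + (1 - k) / (1 + k))"
      using k by (simp add: field_simps)
    then have "1 - tanh (S / 2) = k * (1 + tanh (S / 2))"
      by (simp only: \<tau>)
    moreover have "1 + tanh (S / 2) > 0" using \<open>S > 0\<close> by (simp add: add_pos_pos)
    ultimately have "cmod (m \<i> + h0) = k * cmod (m \<i> + cnj h0)"
      unfolding n using k by (simp add: abs_mult)
    then have "c_entropy l q Infty h0 = ereal S"
      using c_entropy_iff[OF h0(1)] by (simp add: k_def)
    moreover have "impedance_function l q Infty h0 \<in> gen_donoghue (exp (- S))"
      unfolding h0_def by (rule impedance_Infty_gen_donoghue[OF \<open>S > 0\<close>])
    ultimately show ?thesis using h0(1) by (simp add: entropy_donoghue_systems_def)
  qed
  have lower: "Dmin \<le> Im h" "Im h = Dmin \<Longrightarrow> \<mu> = Infty \<and> h = h0"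
    if \<Theta>: "(\<mu>, h) \<in> entropy_donoghue_systems l q S" for \<mu> h
  proof -
    have h: "Im h > 0" and S: "c_entropy l q \<mu> h = ereal S"
      and V: "impedance_function l q \<mu> h \<in> gen_donoghue (exp (- S))"
      using \<Theta> by (simp_all add: entropy_donoghue_systems_def)
    have "cmod (m \<i> + h) = k * cmod (m \<i> + cnj h)"
      using S c_entropy_iff[OF h] by (simp add: k_def)
    note A = Apollonius_lowest_point[OF mi h k this, unfolded \<tau>]
    show "Dmin \<le> Im h" using A(1) by (simp add: Dmin_def)
    assume eq: "Im h = Dmin"
    then have R: "Re h = - Re (m \<i>)" using A(2) by (simp add: Dmin_def)
    have "\<mu> = Infty"
    proof (cases \<mu>)
      case (Fin \<mu>')
      then show ?thesis
        using impedance_Fin_not_gen_donoghue[OF \<open>S > 0\<close> R, of \<mu>'] V eq by (simp add: Dmin_def)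
    qed
    moreover have "h = h0" using R eq h0 by (simp add: complex_eq_iff)
    ultimately show "\<mu> = Infty \<and> h = h0" by blast
  qed
  have D0: "dissipation_coeff (Infty, h0) = Dmin" by (simp add: dissipation_coeff_def h0)
  have all: "Dmin \<le> dissipation_coeff \<Theta>" "dissipation_coeff \<Theta> = Dmin \<Longrightarrow> \<Theta> = (Infty, h0)"
    if "\<Theta> \<in> entropy_donoghue_systems l q S" for \<Theta>
    using lower[of "fst \<Theta>" "snd \<Theta>"] that unfolding dissipation_coeff_def prod.collapse
    by (auto simp only: prod_eq_iff fst_conv snd_conv)
  show ?thesis
  proof (intro conjI)
    show "\<exists>\<Theta> \<in> entropy_donoghue_systems l q S. dissipation_coeff \<Theta> = Dmin"
      using mem D0 by (rule bexI[rotated])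
    show "\<forall>\<Theta> \<in> entropy_donoghue_systems l q S. Dmin \<le> dissipation_coeff \<Theta>"
      using all(1) by (rule ballI)
    show "{\<Theta> \<in> entropy_donoghue_systems l q S. dissipation_coeff \<Theta> = Dmin} = {(Infty, h0)}"
    proof (intro equalityI subsetI)
      fix \<Theta> assume "\<Theta> \<in> {\<Theta> \<in> entropy_donoghue_systems l q S. dissipation_coeff \<Theta> = Dmin}"
      then show "\<Theta> \<in> {(Infty, h0)}" using all(2)[of \<Theta>] by simp
    next
      fix \<Theta> assume "\<Theta> \<in> {(Infty :: ext_real_param, h0)}"
      then show "\<Theta> \<in> {\<Theta> \<in> entropy_donoghue_systems l q S. dissipation_coeff \<Theta> = Dmin}"
        using mem D0 by simp
    qed
  qed
qed

end
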